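(* Let $\mathbf{x}=\{x_0,\dots,x_n\}$ be a discrete curve on $S$ with $(x_k,x_{k+1})\in V$ for $k=0,\dots,n-1$, and let $\mathbf{q}=\{q_0,\dots,q_n\}$ be a discrete curve on $Q$ with momentum $\mu$ obtained by lifting $\mathbf{x}$, i.e. $[q_k]_G=x_k$ for $k=0,\dots,n$, and $(q_k,q_{k+1})\in U$ (so in particular $\mathbf{J}_d(q_k,q_{k+1})=\mu$) for $k=0,\dots,n-1$. Then the following are equivalent. 1. $\mathbf{q}$ solves the discrete Euler--Lagrange (DEL) equations: $D_2L_d(q_{k-1},q_k)+D_1L_d(q_k,q_{k+1})=0$ for $k=1,\dots,n-1$. 2. $\mathbf{q}$ is a solution of the discrete Hamilton's variational principle $$\delta\sum_{k=0}^{n-1}L_d(q_k,q_{k+1})=0$$ for all variations $\delta\mathbf{q}=\{\delta q_k\in T_{q_k}Q\}$ of $\mathbf{q}$ that vanish at the endpoints ($\delta q_0=0$, $\delta q_n=0$). 3. $\mathbf{x}$ solves the discrete Routh (DR) equations $$D_2\hat L_d(x_{k-1},x_k)+D_1\hat L_d(x_k,x_{k+1})=\hat{\mathcal{A}}_2(x_{k-1},x_k)+\hat{\mathcal{A}}_1(x_k,x_{k+1})$$ for $k=1,\dots,n-1$. 4. $\mathbf{x}$ is a solution of the reduced variational principle $$\delta\sum_{k=0}^{n-1}\hat L_d(x_k,x_{k+1})=\sum_{k=0}^{n-1}\hat{\mathcal{A}}(x_k,x_{k+1})\cdot(\delta x_k,\delta x_{k+1})$$ for all variations $\delta\mathbf{x}=\{\delta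 x_k\in T_{x_k}S\}$ of $\mathbf{x}$ that vanish at the endpoints ($\delta x_0=0$, $\delta x_n=0$).
   Context: Setting. $G$ is an abelian Lie group with Lie algebra $\mathfrak{g}$, acting smoothly, freely and properly on a smooth finite-dimensional manifold $Q$; $S=Q/G$ is shape space, and $[q]_G\in S$ is the class of $q\in Q$. For $\xi\in\mathfrak{g}$, $\xi_Q$ is the infinitesimal generator on $Q$, and $\operatorname{Ver}(q)=\{\xi_Q(q):\xi\in\mathfrak{g}\}\subset T_qQ$. $G$ acts diagonally on $Q\times Q$. $L_d:Q\times Q\to\mathbb{R}$ is a smooth $G$-invariant discrete Lagrangian; $D_1,D_2$ denote derivatives in the first and second slot. The discrete momentum map $\mathbf{J}_d:Q\times Q\to\mathfrak{g}^*$ is $\mathbf{J}_d(q_0,q_1)\cdot\xi=D_2L_d(q_0,q_1)\cdot\xi_Q(q_1)$; it is $G$-invariant. Fix $\mu\in\mathfrak{g}^*$. Standing assumptions. $L_d$ is regular (for every $q\in Q$ the bilinear form $D_2D_1L_d(q,q):T_qQ\times T_qQ\to\mathbb{R}$ is nondegenerate) and group-regular (its restriction to $\operatorname{Ver}(q)\times\operatorname{Ver}(q)$ is nondegenerate). Localization. Let $O\subset Q\times Q$ be a $G$-invariant open neighborhood of the diagonal on which the discrete Legendre transform $\mathbb{F}L_d=D_2L_d:Q\times Q\to T^*Q$, $(q_0,q_1)\mapsto D_2L_d(q_0,q_1)\in T^*_{q_1}Q$, is a local diffeomorphism; then $\mathbf{J}_d^{-1}(\mu)\cap O$ is a submanifold.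 Points are taken closely spaced in the following sense: $U\subset\mathbf{J}_d^{-1}(\mu)\cap O$ is a fixed $G$-invariant open subset such that $\varphi_\mu:U/G\to S\times S$, $[(q,q')]_G\mapsto([q]_G,[q']_G)$, is a diffeomorphism onto an open set $V\subset S\times S$. Let $\pi_{\mu,d}:U\to V$, $(q,q')\mapsto([q]_G,[q']_G)$, and let $\iota_{\mu,d}:U\hookrightarrow Q\times Q$ be the inclusion. Reduced objects. The discrete reduced Lagrangian $\hat L_d:V\to\mathbb{R}$ is the function with $\hat L_d\circ\pi_{\mu,d}=L_d|_U$. Fix a principal connection $\mathfrak{A}:TQ\to\mathfrak{g}$ on $Q\to Q/G$, and let $\mathfrak{A}_\mu$ be the 1-form on $Q$ with $\mathfrak{A}_\mu(q)\cdot v=\langle\mu,\mathfrak{A}(v)\rangle$ for $v\in T_qQ$. Let $\mathcal{A}=\pi_2^*\mathfrak{A}_\mu-\pi_1^*\mathfrak{A}_\mu$, a 1-form on $Q\times Q$, where $\pi_1,\pi_2:Q\times Q\to Q$ are the projections. $\hat{\mathcal{A}}$ is the (well-defined, unique) 1-form on $V$ with $\pi_{\mu,d}^*\hat{\mathcal{A}}=\iota_{\mu,d}^*\mathcal{A}$, and its components are defined by $\hat{\mathcal{A}}(x_0,x_1)\cdot(\delta x_0,\delta x_1)=\hat{\mathcal{A}}_1(x_0,x_1)\cdot\delta x_0+\hat{\mathcal{A}}_2(x_0,x_1)\cdot\delta x_1$. Variations of sums: $\delta\sum_k L_d(q_k,q_{k+1})=\sum_k\left(D_1L_d(q_k,q_{k+1})\cdot\delta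 q_k+D_2L_d(q_k,q_{k+1})\cdot\delta q_{k+1}\right)$, and likewise for $\hat L_d$ with $\delta x_k$. *)

theory Defs
  imports "HOL-Analysis.Analysis" "HOL-Algebra.Group_Action"
begin

text \<open>On an open set, \<open>Ck_on S f k\<close> says that all iterated directional derivatives up to order
  \<open>k\<close> exist and are continuous, which in finite dimensions is the usual class $C^k$.\<close>

primrec Ck_on ::
  "'a set \<Rightarrow> ('a::real_normed_vector \<Rightarrow> 'b::real_normed_vector) \<Rightarrow> nat \<Rightarrow> bool" where
  "Ck_on S f 0 \<longleftrightarrow> continuous_on S f"
| "Ck_on S f (Suc k) \<longleftrightarrow>
     (\<forall>x\<in>S. f differentiable (at x)) \<and> (\<forall>v. Ck_on S (\<lambda>x. frechet_derivative f (at x) v) k)"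

definition smooth_on ::
  "'a set \<Rightarrow> ('a::real_normed_vector \<Rightarrow> 'b::real_normed_vector) \<Rightarrow> bool" where
  "smooth_on S f \<longleftrightarrow> (\<forall>k. Ck_on S f k)"

text \<open>A chart is a pair of a domain and a coordinate map. The coordinates live in an arbitrary
  finite-dimensional normed space rather than in a type of class \<open>euclidean_space\<close>, so that
  zero-dimensional manifolds are included. The points of a manifold are the \<open>topspace\<close> of its
  topology.\<close>

type_synonym ('a, 'e) chart = "'a set \<times> ('a \<Rightarrow> 'e)"

record ('a, 'e) manifold =
  mtop :: "'a topology"
  atlas :: "('a, 'e) chart set"

abbreviation points :: "('a, 'e) manifold \<Rightarrow> 'a set" where
  "points M \<equiv> topspace (mtop M)"

definition chart_inv :: "('a, 'e) chart \<Rightarrow> 'e \<Rightarrow> 'a" where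
  "chart_inv c = inv_into (fst c) (snd c)"

definition charts_at :: "('a, 'e) manifold \<Rightarrow> 'a \<Rightarrow> ('a, 'e) chart set" where
  "charts_at M p = {c \<in> atlas M. p \<in> fst c}"

definition smooth_manifold :: "('a, 'e::real_normed_vector) manifold \<Rightarrow> bool" where
  "smooth_manifold M \<longleftrightarrow>
     (\<exists>B::'e set. finite B \<and> span B = UNIV) \<and>
     Hausdorff_space (mtop M) \<and> second_countable (mtop M) \<and>
     (\<Union>c\<in>atlas M. fst c) = points M \<and>
     (\<forall>c\<in>atlas M. openin (mtop M) (fst c) \<and> open (snd c ` fst c) \<and>
        homeomorphic_map (subtopology (mtop M) (fst c)) (top_of_set (snd c ` fst c)) (snd c)) \<and>
     (\<forall>c\<in>atlas M. \<forall>d\<in>atlas M. smooth_on (snd c ` (fst c \<inter> fst d)) (snd d \<circ> chart_inv c))"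

definition prod_manifold ::
  "('a, 'e) manifold \<Rightarrow> ('b, 'f) manifold \<Rightarrow> ('a \<times> 'b, 'e \<times> 'f) manifold" where
  "prod_manifold M N =
     \<lparr> mtop = prod_topology (mtop M) (mtop N),
       atlas = {(fst c \<times> fst d, map_prod (snd c) (snd d)) | c d. c \<in> atlas M \<and> d \<in> atlas N} \<rparr>"

text \<open>Smoothness of a map defined on an open subset \<open>W\<close> of \<open>M\<close>; values outside \<open>W\<close> are
  irrelevant.\<close>

definition smooth_map ::
  "('a, 'e::real_normed_vector) manifold \<Rightarrow> ('b, 'f::real_normed_vector) manifold
     \<Rightarrow> 'a set \<Rightarrow> ('a \<Rightarrow> 'b) \<Rightarrow> bool" where
  "smooth_map M N W f \<longleftrightarrow>
     openin (mtop M) W \<and> continuous_map (subtopology (mtop M) W) (mtop N) f \<and>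
     (\<forall>c\<in>atlas M. \<forall>d\<in>atlas N.
        smooth_on (snd c ` {p \<in> fst c \<inter> W. f p \<in> fst d}) (snd d \<circ> f \<circ> chart_inv c))"

definition smooth_fun ::
  "('a, 'e::real_normed_vector) manifold \<Rightarrow> 'a set \<Rightarrow> ('a \<Rightarrow> real) \<Rightarrow> bool" where
  "smooth_fun M W f \<longleftrightarrow>
     openin (mtop M) W \<and> (\<forall>c\<in>atlas M. smooth_on (snd c ` (fst c \<inter> W)) (f \<circ> chart_inv c))"

definition diffeo_on ::
  "('a, 'e::real_normed_vector) manifold \<Rightarrow> ('b, 'f::real_normed_vector) manifold
     \<Rightarrow> 'a set \<Rightarrow> ('a \<Rightarrow> 'b) \<Rightarrow> bool" where
  "diffeo_on M N W f \<longleftrightarrow>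
     smooth_map M N W f \<and> inj_on f W \<and> openin (mtop N) (f ` W) \<and>
     smooth_map N M (f ` W) (inv_into W f)"

definition local_diffeo_on ::
  "('a, 'e::real_normed_vector) manifold \<Rightarrow> ('b, 'f::real_normed_vector) manifold
     \<Rightarrow> 'a set \<Rightarrow> ('a \<Rightarrow> 'b) \<Rightarrow> bool" where
  "local_diffeo_on M N W f \<longleftrightarrow> (\<forall>p\<in>W. \<exists>W'. p \<in> W' \<and> W' \<subseteq> W \<and> diffeo_on M N W' f)"

text \<open>A tangent vector at \<open>p\<close> is the family of its coordinate representatives in all charts
  around \<open>p\<close>, related by the derivatives of the transition maps. The family is set to 0 on all
  other charts, so that equality of tangent vectors is equality of functions and the linear
  structure of the tangent space is the pointwise one.\<close>

type_synonym ('a, 'e) tvector = "('a, 'e) chart \<Rightarrow> 'e"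

definition tangent_space ::
  "('a, 'e::real_normed_vector) manifold \<Rightarrow> 'a \<Rightarrow> ('a, 'e) tvector set" where
  "tangent_space M p =
     {v. (\<forall>c. c \<notin> charts_at M p \<longrightarrow> v c = 0) \<and>
         (\<forall>c\<in>charts_at M p. \<forall>d\<in>charts_at M p.
            v d = frechet_derivative (snd d \<circ> chart_inv c) (at (snd c p)) (v c))}"

definition tzero :: "('a, 'e::real_normed_vector) tvector" where
  "tzero = (\<lambda>c. 0)"

definition tadd ::
  "('a, 'e::real_normed_vector) tvector \<Rightarrow> ('a, 'e) tvector \<Rightarrow> ('a, 'e) tvector" where
  "tadd u v = (\<lambda>c. u c + v c)"

definition tscale :: "real \<Rightarrow> ('a, 'e::real_normed_vector) tvector \<Rightarrow> ('a, 'e) tvector" where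
  "tscale r v = (\<lambda>c. r *\<^sub>R v c)"

definition tvec_of ::
  "('a, 'e::real_normed_vector) manifold \<Rightarrow> ('a, 'e) chart \<Rightarrow> 'a \<Rightarrow> 'e \<Rightarrow> ('a, 'e) tvector" where
  "tvec_of M c p e =
     (\<lambda>d. if d \<in> charts_at M p
          then frechet_derivative (snd d \<circ> chart_inv c) (at (snd c p)) e else 0)"

text \<open>The tangent map of \<open>f\<close> at \<open>p\<close> and the derivative of a real-valued function at \<open>p\<close>. For
  tangent vectors the value does not depend on the chart that is picked.\<close>

definition tmap ::
  "('a, 'e::real_normed_vector) manifold \<Rightarrow> ('b, 'f::real_normed_vector) manifold
     \<Rightarrow> ('a \<Rightarrow> 'b) \<Rightarrow> 'a \<Rightarrow> ('a, 'e) tvector \<Rightarrow> ('b, 'f) tvector" where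
  "tmap M N f p v =
     (let c = (SOME c. c \<in> charts_at M p) in
       (\<lambda>d. if d \<in> charts_at N (f p)
            then frechet_derivative (snd d \<circ> f \<circ> chart_inv c) (at (snd c p)) (v c) else 0))"

definition mderiv ::
  "('a, 'e::real_normed_vector) manifold \<Rightarrow> ('a \<Rightarrow> real) \<Rightarrow> 'a \<Rightarrow> ('a, 'e) tvector \<Rightarrow> real" where
  "mderiv M f p v =
     (let c = (SOME c. c \<in> charts_at M p) in
       frechet_derivative (f \<circ> chart_inv c) (at (snd c p)) (v c))"

text \<open>The identification of \<open>T\<^sub>xM \<times> T\<^sub>yN\<close> with the tangent space of the product.\<close>

definition tpair ::
  "('a, 'e::real_normed_vector) manifold \<Rightarrow> ('b, 'f::real_normed_vector) manifold \<Rightarrow> 'a \<times> 'b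
     \<Rightarrow> ('a, 'e) tvector \<Rightarrow> ('b, 'f) tvector \<Rightarrow> ('a \<times> 'b, 'e \<times> 'f) tvector" where
  "tpair M N p v w =
     (THE u. u \<in> tangent_space (prod_manifold M N) p \<and>
             tmap (prod_manifold M N) M fst p u = v \<and>
             tmap (prod_manifold M N) N snd p u = w)"

definition submersion_on ::
  "('a, 'e::real_normed_vector) manifold \<Rightarrow> ('b, 'f::real_normed_vector) manifold
     \<Rightarrow> 'a set \<Rightarrow> ('a \<Rightarrow> 'b) \<Rightarrow> bool" where
  "submersion_on M N W f \<longleftrightarrow>
     smooth_map M N W f \<and> (\<forall>p\<in>W. tmap M N f p ` tangent_space M p = tangent_space N (f p))"

definition embedded_submanifold ::
  "('a, 'e::real_normed_vector) manifold \<Rightarrow> ('a, 'f::real_normed_vector) manifold \<Rightarrow> bool" where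
  "embedded_submanifold N M \<longleftrightarrow>
     smooth_manifold N \<and> points N \<subseteq> points M \<and> mtop N = subtopology (mtop M) (points N) \<and>
     smooth_map N M (points N) (\<lambda>p. p) \<and>
     (\<forall>p\<in>points N. inj_on (tmap N M (\<lambda>p. p) p) (tangent_space N p))"

definition linear_form ::
  "('a, 'e::real_normed_vector) tvector set \<Rightarrow> (('a, 'e) tvector \<Rightarrow> 'b::real_normed_vector) \<Rightarrow> bool"
  where
  "linear_form T f \<longleftrightarrow>
     (\<forall>u\<in>T. \<forall>v\<in>T. f (tadd u v) = f u + f v) \<and> (\<forall>r. \<forall>v\<in>T. f (tscale r v) = r *\<^sub>R f v)"

definition nondegenerate_on ::
  "('a, 'e::real_normed_vector) tvector set
     \<Rightarrow> (('a, 'e) tvector \<Rightarrow> ('a, 'e) tvector \<Rightarrow> real) \<Rightarrow> bool" where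
  "nondegenerate_on T B \<longleftrightarrow>
     (\<forall>v\<in>T. (\<forall>w\<in>T. B v w = 0) \<longrightarrow> v = tzero) \<and> (\<forall>w\<in>T. (\<forall>v\<in>T. B v w = 0) \<longrightarrow> w = tzero)"

text \<open>Covectors are linear forms that are \<open>extensional\<close> (undefined off the tangent space), so that
  equal covectors are equal as functions.\<close>

definition cotangent_space ::
  "('a, 'e::real_normed_vector) manifold \<Rightarrow> 'a \<Rightarrow> (('a, 'e) tvector \<Rightarrow> real) set" where
  "cotangent_space M p =
     {\<alpha>. linear_form (tangent_space M p) \<alpha> \<and> \<alpha> \<in> extensional (tangent_space M p)}"

text \<open>The cotangent bundle, with the bundle charts \<open>(q, \<alpha>) \<mapsto> (c q, \<alpha> \<circ> (T\<^sub>q c)\<^sup>-\<^sup>1)\<close> and the topology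
  which they generate.\<close>

definition cotangent_chart ::
  "('a, 'e::real_normed_vector) manifold \<Rightarrow> ('a, 'e) chart
     \<Rightarrow> ('a \<times> (('a, 'e) tvector \<Rightarrow> real), 'e \<times> ('e \<Rightarrow>\<^sub>L real)) chart" where
  "cotangent_chart M c =
     ({(q, \<alpha>). q \<in> fst c \<and> \<alpha> \<in> cotangent_space M q},
      (\<lambda>(q, \<alpha>). (snd c q, Blinfun (\<lambda>e. \<alpha> (tvec_of M c q e)))))"

definition cotangent_bundle ::
  "('a, 'e::real_normed_vector) manifold
     \<Rightarrow> ('a \<times> (('a, 'e) tvector \<Rightarrow> real), 'e \<times> ('e \<Rightarrow>\<^sub>L real)) manifold" where
  "cotangent_bundle M =
     \<lparr> mtop = topology_generated_by
         {{z \<in> fst (cotangent_chart M c). snd (cotangent_chart M c) z \<in> B} | c B.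
            c \<in> atlas M \<and> open B},
       atlas = cotangent_chart M ` atlas M \<rparr>"

text \<open>A field of linear forms, smooth in the sense that its coefficient functions in every chart
  are smooth.\<close>

definition one_form_on ::
  "('a, 'e::real_normed_vector) manifold \<Rightarrow> 'a set
     \<Rightarrow> ('a \<Rightarrow> ('a, 'e) tvector \<Rightarrow> 'b::real_normed_vector) \<Rightarrow> bool" where
  "one_form_on M W \<omega> \<longleftrightarrow>
     openin (mtop M) W \<and> (\<forall>p\<in>W. linear_form (tangent_space M p) (\<omega> p)) \<and>
     (\<forall>c\<in>atlas M. \<forall>e. smooth_on (snd c ` (fst c \<inter> W))
        (\<lambda>y. \<omega> (chart_inv c y) (tvec_of M c (chart_inv c y) e)))"

definition pullback ::
  "('a, 'e::real_normed_vector) manifold \<Rightarrow> ('b, 'f::real_normed_vector) manifold \<Rightarrow> ('a \<Rightarrow> 'b)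
     \<Rightarrow> ('b \<Rightarrow> ('b, 'f) tvector \<Rightarrow> real) \<Rightarrow> 'a \<Rightarrow> ('a, 'e) tvector \<Rightarrow> real" where
  "pullback M N f \<omega> p v = \<omega> (f p) (tmap M N f p v)"

definition form_comp1 ::
  "('a, 'e::real_normed_vector) manifold
     \<Rightarrow> ('a \<times> 'a \<Rightarrow> ('a \<times> 'a, 'e \<times> 'e) tvector \<Rightarrow> real) \<Rightarrow> 'a \<times> 'a \<Rightarrow> ('a, 'e) tvector \<Rightarrow> real"
  where
  "form_comp1 M \<omega> p v = \<omega> p (tpair M M p v tzero)"

definition form_comp2 ::
  "('a, 'e::real_normed_vector) manifold
     \<Rightarrow> ('a \<times> 'a \<Rightarrow> ('a \<times> 'a, 'e \<times> 'e) tvector \<Rightarrow> real) \<Rightarrow> 'a \<times> 'a \<Rightarrow> ('a, 'e) tvector \<Rightarrow> real"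
  where
  "form_comp2 M \<omega> p w = \<omega> p (tpair M M p tzero w)"

definition lie_group ::
  "('g, 'b) monoid_scheme \<Rightarrow> ('g, 'l::real_normed_vector) manifold \<Rightarrow> bool" where
  "lie_group G MG \<longleftrightarrow>
     group G \<and> smooth_manifold MG \<and> points MG = carrier G \<and>
     smooth_map (prod_manifold MG MG) MG (carrier G \<times> carrier G) (\<lambda>(g, h). g \<otimes>\<^bsub>G\<^esub> h) \<and>
     smooth_map MG MG (carrier G) (\<lambda>g. inv\<^bsub>G\<^esub> g)"

definition lie_algebra ::
  "('g, 'b) monoid_scheme \<Rightarrow> ('g, 'l::real_normed_vector) manifold \<Rightarrow> ('g, 'l) tvector set" where
  "lie_algebra G MG = tangent_space MG \<one>\<^bsub>G\<^esub>"

definition lie_dual ::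
  "('g, 'b) monoid_scheme \<Rightarrow> ('g, 'l::real_normed_vector) manifold
     \<Rightarrow> (('g, 'l) tvector \<Rightarrow> real) set" where
  "lie_dual G MG = cotangent_space MG \<one>\<^bsub>G\<^esub>"

definition Ad ::
  "('g, 'b) monoid_scheme \<Rightarrow> ('g, 'l::real_normed_vector) manifold
     \<Rightarrow> 'g \<Rightarrow> ('g, 'l) tvector \<Rightarrow> ('g, 'l) tvector" where
  "Ad G MG g = tmap MG MG (\<lambda>h. g \<otimes>\<^bsub>G\<^esub> h \<otimes>\<^bsub>G\<^esub> inv\<^bsub>G\<^esub> g) \<one>\<^bsub>G\<^esub>"

definition smooth_action ::
  "('g, 'b) monoid_scheme \<Rightarrow> ('g, 'l::real_normed_vector) manifold
     \<Rightarrow> ('a, 'e::real_normed_vector) manifold \<Rightarrow> ('g \<Rightarrow> 'a \<Rightarrow> 'a) \<Rightarrow> bool" where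
  "smooth_action G MG M \<Phi> \<longleftrightarrow>
     group_action G (points M) \<Phi> \<and>
     smooth_map (prod_manifold MG M) M (points (prod_manifold MG M)) (\<lambda>(g, q). \<Phi> g q)"

definition free_action ::
  "('g, 'b) monoid_scheme \<Rightarrow> 'a set \<Rightarrow> ('g \<Rightarrow> 'a \<Rightarrow> 'a) \<Rightarrow> bool" where
  "free_action G E \<Phi> \<longleftrightarrow> (\<forall>q\<in>E. stabilizer G \<Phi> q = {\<one>\<^bsub>G\<^esub>})"

definition proper_action ::
  "('g, 'l) manifold \<Rightarrow> ('a, 'e) manifold \<Rightarrow> ('g \<Rightarrow> 'a \<Rightarrow> 'a) \<Rightarrow> bool" where
  "proper_action MG M \<Phi> \<longleftrightarrow>
     proper_map (prod_topology (mtop MG) (mtop M)) (prod_topology (mtop M) (mtop M))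
       (\<lambda>(g, q). (\<Phi> g q, q))"

text \<open>\<open>\<xi>\<^sub>M(q) = d/dt (exp(t\<xi>)\<cdot>q)\<close> at \<open>t = 0\<close>, i.e. the derivative at the identity of the orbit map
  \<open>g \<mapsto> g\<cdot>q\<close> applied to \<open>\<xi>\<close>.\<close>

definition inf_gen ::
  "('g, 'b) monoid_scheme \<Rightarrow> ('g, 'l::real_normed_vector) manifold
     \<Rightarrow> ('a, 'e::real_normed_vector) manifold \<Rightarrow> ('g \<Rightarrow> 'a \<Rightarrow> 'a)
     \<Rightarrow> ('g, 'l) tvector \<Rightarrow> 'a \<Rightarrow> ('a, 'e) tvector" where
  "inf_gen G MG M \<Phi> \<xi> q = tmap MG M (\<lambda>g. \<Phi> g q) \<one>\<^bsub>G\<^esub> \<xi>"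

definition vertical_space ::
  "('g, 'b) monoid_scheme \<Rightarrow> ('g, 'l::real_normed_vector) manifold
     \<Rightarrow> ('a, 'e::real_normed_vector) manifold \<Rightarrow> ('g \<Rightarrow> 'a \<Rightarrow> 'a) \<Rightarrow> 'a \<Rightarrow> ('a, 'e) tvector set"
  where
  "vertical_space G MG M \<Phi> q = {inf_gen G MG M \<Phi> \<xi> q | \<xi>. \<xi> \<in> lie_algebra G MG}"

definition diag_action :: "('g \<Rightarrow> 'a \<Rightarrow> 'a) \<Rightarrow> 'g \<Rightarrow> 'a \<times> 'a \<Rightarrow> 'a \<times> 'a" where
  "diag_action \<Phi> g = (\<lambda>(q, q'). (\<Phi> g q, \<Phi> g q'))"

definition invariant_set ::
  "('g, 'b) monoid_scheme \<Rightarrow> ('g \<Rightarrow> 'a \<Rightarrow> 'a) \<Rightarrow> 'a set \<Rightarrow> bool" where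
  "invariant_set G \<Phi> W \<longleftrightarrow> (\<forall>g\<in>carrier G. \<forall>p\<in>W. \<Phi> g p \<in> W)"

definition invariant_fun ::
  "('g, 'b) monoid_scheme \<Rightarrow> ('g \<Rightarrow> 'a \<Rightarrow> 'a) \<Rightarrow> 'a set \<Rightarrow> ('a \<Rightarrow> 'c) \<Rightarrow> bool" where
  "invariant_fun G \<Phi> W f \<longleftrightarrow> (\<forall>g\<in>carrier G. \<forall>p\<in>W. f (\<Phi> g p) = f p)"

text \<open>\<open>R\<close> is the orbit space of the invariant open set \<open>W\<close>, with the (unique) manifold structure
  making the projection onto orbits a submersion.\<close>

definition quotient_manifold ::
  "('g, 'b) monoid_scheme \<Rightarrow> ('g \<Rightarrow> 'a \<Rightarrow> 'a) \<Rightarrow> ('a, 'e::real_normed_vector) manifold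
     \<Rightarrow> 'a set \<Rightarrow> ('a set, 'f::real_normed_vector) manifold \<Rightarrow> bool" where
  "quotient_manifold G \<Phi> M W R \<longleftrightarrow>
     smooth_manifold R \<and> points R = orbits G W \<Phi> \<and> submersion_on M R W (orbit G \<Phi>)"

text \<open>A Lie-algebra-valued form takes values in tangent vectors at the identity; its linearity and
  smoothness are expressed through the coordinates of its values in the charts there.\<close>

definition principal_connection ::
  "('g, 'b) monoid_scheme \<Rightarrow> ('g, 'l::real_normed_vector) manifold
     \<Rightarrow> ('a, 'e::real_normed_vector) manifold \<Rightarrow> ('g \<Rightarrow> 'a \<Rightarrow> 'a)
     \<Rightarrow> ('a \<Rightarrow> ('a, 'e) tvector \<Rightarrow> ('g, 'l) tvector) \<Rightarrow> bool" where
  "principal_connection G MG M \<Phi> \<AA> \<longleftrightarrow>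
     (\<forall>q\<in>points M. \<forall>v\<in>tangent_space M q. \<AA> q v \<in> lie_algebra G MG) \<and>
     (\<forall>d\<in>charts_at MG \<one>\<^bsub>G\<^esub>. one_form_on M (points M) (\<lambda>q v. \<AA> q v d)) \<and>
     (\<forall>q\<in>points M. \<forall>\<xi>\<in>lie_algebra G MG. \<AA> q (inf_gen G MG M \<Phi> \<xi> q) = \<xi>) \<and>
     (\<forall>g\<in>carrier G. \<forall>q\<in>points M. \<forall>v\<in>tangent_space M q.
        \<AA> (\<Phi> g q) (tmap M M (\<Phi> g) q v) = Ad G MG g (\<AA> q v))"

definition D1 ::
  "('a, 'e::real_normed_vector) manifold \<Rightarrow> ('a \<times> 'a \<Rightarrow> real) \<Rightarrow> 'a \<times> 'a \<Rightarrow> ('a, 'e) tvector \<Rightarrow> real"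
  where
  "D1 M L p v = mderiv M (\<lambda>a. L (a, snd p)) (fst p) v"

definition D2 ::
  "('a, 'e::real_normed_vector) manifold \<Rightarrow> ('a \<times> 'a \<Rightarrow> real) \<Rightarrow> 'a \<times> 'a \<Rightarrow> ('a, 'e) tvector \<Rightarrow> real"
  where
  "D2 M L p w = mderiv M (\<lambda>b. L (fst p, b)) (snd p) w"

definition D2D1 ::
  "('a, 'e::real_normed_vector) manifold \<Rightarrow> ('a \<times> 'a \<Rightarrow> real) \<Rightarrow> 'a \<times> 'a
     \<Rightarrow> ('a, 'e) tvector \<Rightarrow> ('a, 'e) tvector \<Rightarrow> real" where
  "D2D1 M L p v w = mderiv M (\<lambda>b. D1 M L (fst p, b) v) (snd p) w"

definition regular_lagrangian ::
  "('a, 'e::real_normed_vector) manifold \<Rightarrow> ('a \<times> 'a \<Rightarrow> real) \<Rightarrow> bool" where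
  "regular_lagrangian Q L \<longleftrightarrow>
     (\<forall>q\<in>points Q. nondegenerate_on (tangent_space Q q) (D2D1 Q L (q, q)))"

definition group_regular_lagrangian ::
  "('g, 'b) monoid_scheme \<Rightarrow> ('g, 'l::real_normed_vector) manifold
     \<Rightarrow> ('a, 'e::real_normed_vector) manifold \<Rightarrow> ('g \<Rightarrow> 'a \<Rightarrow> 'a) \<Rightarrow> ('a \<times> 'a \<Rightarrow> real) \<Rightarrow> bool" where
  "group_regular_lagrangian G MG Q \<Phi> L \<longleftrightarrow>
     (\<forall>q\<in>points Q. nondegenerate_on (vertical_space G MG Q \<Phi> q) (D2D1 Q L (q, q)))"

definition discrete_legendre ::
  "('a, 'e::real_normed_vector) manifold \<Rightarrow> ('a \<times> 'a \<Rightarrow> real)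
     \<Rightarrow> 'a \<times> 'a \<Rightarrow> 'a \<times> (('a, 'e) tvector \<Rightarrow> real)" where
  "discrete_legendre Q L p = (snd p, restrict (D2 Q L p) (tangent_space Q (snd p)))"

definition momentum_map ::
  "('g, 'b) monoid_scheme \<Rightarrow> ('g, 'l::real_normed_vector) manifold
     \<Rightarrow> ('a, 'e::real_normed_vector) manifold \<Rightarrow> ('g \<Rightarrow> 'a \<Rightarrow> 'a) \<Rightarrow> ('a \<times> 'a \<Rightarrow> real)
     \<Rightarrow> 'a \<times> 'a \<Rightarrow> ('g, 'l) tvector \<Rightarrow> real" where
  "momentum_map G MG Q \<Phi> L p =
     restrict (\<lambda>\<xi>. D2 Q L p (inf_gen G MG Q \<Phi> \<xi> (snd p))) (lie_algebra G MG)"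

definition pair_proj ::
  "('g, 'b) monoid_scheme \<Rightarrow> ('g \<Rightarrow> 'a \<Rightarrow> 'a) \<Rightarrow> 'a \<times> 'a \<Rightarrow> 'a set \<times> 'a set" where
  "pair_proj G \<Phi> p = (orbit G \<Phi> (fst p), orbit G \<Phi> (snd p))"

text \<open>\<open>[(q, q')] \<mapsto> ([q], [q'])\<close>: the two coordinate projections of the diagonal orbit of \<open>(q, q')\<close>
  are the orbits of \<open>q\<close> and of \<open>q'\<close>.\<close>

definition orbit_pair :: "('a \<times> 'a) set \<Rightarrow> 'a set \<times> 'a set" where
  "orbit_pair X = (fst ` X, snd ` X)"

definition mu_form ::
  "(('g, 'l) tvector \<Rightarrow> real) \<Rightarrow> ('a \<Rightarrow> ('a, 'e) tvector \<Rightarrow> ('g, 'l) tvector)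
     \<Rightarrow> 'a \<Rightarrow> ('a, 'e) tvector \<Rightarrow> real" where
  "mu_form \<mu> \<AA> q v = \<mu> (\<AA> q v)"

definition diff_form ::
  "('a, 'e::real_normed_vector) manifold \<Rightarrow> ('a \<Rightarrow> ('a, 'e) tvector \<Rightarrow> real)
     \<Rightarrow> 'a \<times> 'a \<Rightarrow> ('a \<times> 'a, 'e \<times> 'e) tvector \<Rightarrow> real" where
  "diff_form Q \<alpha> p v =
     pullback (prod_manifold Q Q) Q snd \<alpha> p v - pullback (prod_manifold Q Q) Q fst \<alpha> p v"

definition fixed_end_variations ::
  "('a, 'e::real_normed_vector) manifold \<Rightarrow> nat \<Rightarrow> (nat \<Rightarrow> 'a) \<Rightarrow> (nat \<Rightarrow> ('a, 'e) tvector) set" where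
  "fixed_end_variations M n z =
     {\<delta>. (\<forall>k\<le>n. \<delta> k \<in> tangent_space M (z k)) \<and> \<delta> 0 = tzero \<and> \<delta> n = tzero}"

definition sum_variation ::
  "('a, 'e::real_normed_vector) manifold \<Rightarrow> ('a \<times> 'a \<Rightarrow> real) \<Rightarrow> nat \<Rightarrow> (nat \<Rightarrow> 'a)
     \<Rightarrow> (nat \<Rightarrow> ('a, 'e) tvector) \<Rightarrow> real" where
  "sum_variation M L n z \<delta> =
     (\<Sum>k<n. D1 M L (z k, z (Suc k)) (\<delta> k) + D2 M L (z k, z (Suc k)) (\<delta> (Suc k)))"

definition DEL ::
  "('a, 'e::real_normed_vector) manifold \<Rightarrow> ('a \<times> 'a \<Rightarrow> real) \<Rightarrow> nat \<Rightarrow> (nat \<Rightarrow> 'a) \<Rightarrow> bool" where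
  "DEL Q L n q \<longleftrightarrow>
     (\<forall>k\<in>{1..<n}. \<forall>v\<in>tangent_space Q (q k).
        D2 Q L (q (k - 1), q k) v + D1 Q L (q k, q (k + 1)) v = 0)"

definition discrete_hamilton ::
  "('a, 'e::real_normed_vector) manifold \<Rightarrow> ('a \<times> 'a \<Rightarrow> real) \<Rightarrow> nat \<Rightarrow> (nat \<Rightarrow> 'a) \<Rightarrow> bool" where
  "discrete_hamilton Q L n q \<longleftrightarrow>
     (\<forall>\<delta>\<in>fixed_end_variations Q n q. sum_variation Q L n q \<delta> = 0)"

definition discrete_routh ::
  "('a, 'e::real_normed_vector) manifold \<Rightarrow> ('a \<times> 'a \<Rightarrow> real)
     \<Rightarrow> ('a \<times> 'a \<Rightarrow> ('a \<times> 'a, 'e \<times> 'e) tvector \<Rightarrow> real) \<Rightarrow> nat \<Rightarrow> (nat \<Rightarrow> 'a) \<Rightarrow> bool" where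
  "discrete_routh S L \<A> n x \<longleftrightarrow>
     (\<forall>k\<in>{1..<n}. \<forall>v\<in>tangent_space S (x k).
        D2 S L (x (k - 1), x k) v + D1 S L (x k, x (k + 1)) v =
        form_comp2 S \<A> (x (k - 1), x k) v + form_comp1 S \<A> (x k, x (k + 1)) v)"

definition reduced_variational ::
  "('a, 'e::real_normed_vector) manifold \<Rightarrow> ('a \<times> 'a \<Rightarrow> real)
     \<Rightarrow> ('a \<times> 'a \<Rightarrow> ('a \<times> 'a, 'e \<times> 'e) tvector \<Rightarrow> real) \<Rightarrow> nat \<Rightarrow> (nat \<Rightarrow> 'a) \<Rightarrow> bool" where
  "reduced_variational S L \<A> n x \<longleftrightarrow>
     (\<forall>\<delta>\<in>fixed_end_variations S n x.
        sum_variation S L n x \<delta> =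
        (\<Sum>k<n. \<A> (x k, x (Suc k)) (tpair S S (x k, x (Suc k)) (\<delta> k) (\<delta> (Suc k)))))"

end

(* Every tangent vector of S x S at a point of V is the image of a vector (u0, u1) tangent to the
   momentum level set, on which the definitions of the reduced Lagrangian and the reduced one-form
   identify dL_reduced - A_reduced with (D1 L + A_mu) u0 + (D2 L - A_mu) u1. By invariance of L and
   J = mu both brackets vanish on vertical vectors, so (u0, u1) may be replaced by any (v0, v1) with
   the same projections. Adding the components at two consecutive points of the curve cancels A_mu:
   the discrete Routh expression at T pi v is the DEL expression at v, and T pi is onto.

   That two lifts of the same vector differ by a vertical vector is the one analytic point. A vector v
   with T pi v = 0 is the velocity of a sequence in the fibre (metric regularity of a submersion), the
   sequence has the form g_n q with g_n -> 1 (the action is free and proper), and the orbit map is an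
   immersion (the connection is a left inverse of its derivative), so v is an infinitesimal
   generator. *)

theory Submission
  imports Defs
begin

text \<open>The two brackets vanish on vertical vectors separately: \<open>D2 Q L\<close> and
  \<open>mu_form \<mu> \<AA>\<close> both send the generator of \<xi> to \<mu>(\<xi>), and
  invariance of \<open>L\<close> then forces \<open>D1 Q L\<close> to send it to -\<mu>(\<xi>). So
  the vertical corrections at the two ends of a pair need not be related to each other. Vectors
  tangent to the level set must appear because the reduced Lagrangian and the reduced one-form are
  known only through their pullbacks to \<open>U\<close>. For the same reason differentiability of
  \<open>Lr\<close> is a result: it descends along a submersion. The shape of the analysis comes
  from the model spaces. They are arbitrary normed spaces with a finite spanning set, possibly
  zero-dimensional, so completeness, boundedness of linear maps and operator-norm continuity of
  derivatives are all drawn from the spanning set. A single openness estimate with linear control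
  then does the work of local sections of the projection: it produces the sequence in the fibre, and
  it is what lets differentiability descend.\<close>

section \<open>Calculus in finite-dimensional normed spaces\<close>

text \<open>A complete subspace is closed, so \<open>b\<close> keeps a positive distance \<delta>
  from it, and scaling by \<open>r\<close> gives the estimate. It makes the
  \<open>b\<close>-coordinate on \<open>span (insert b F)\<close> a bounded functional, which drives
  the next two inductions.\<close>

lemma span_insert_bounded_below:
  fixes b :: "'e::real_normed_vector"
  assumes "complete (span F)" "b \<notin> span F"
  obtains \<delta> where "\<delta> > 0" "\<And>r y. y \<in> span F \<Longrightarrow> \<bar>r\<bar> * \<delta> \<le> norm (r *\<^sub>R b + y)"
proof -
  have "open (- span F)"
    using complete_imp_closed[OF assms(1)] by (simp add: open_Compl)
  then obtain \<delta> where \<delta>: "\<delta> > 0" "ball b \<delta> \<subseteq> - span F"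
    using assms(2) by (meson ComplI openE)
  have "\<bar>r\<bar> * \<delta> \<le> norm (r *\<^sub>R b + y)" if y: "y \<in> span F" for r y
  proof (cases "r = 0")
    case False
    have "(-1 / r) *\<^sub>R y \<in> span F"
      using y by (rule span_scale)
    then have "\<delta> \<le> dist b ((-1 / r) *\<^sub>R y)"
      using \<delta>(2) by (metis ComplD linorder_not_le mem_ball subsetD)
    also have "\<dots> = norm (b + (1 / r) *\<^sub>R y)"
      by (simp add: dist_norm)
    finally have "\<bar>r\<bar> * \<delta> \<le> \<bar>r\<bar> * norm (b + (1 / r) *\<^sub>R y)"
      by (simp add: mult_left_mono)
    also have "\<dots> = norm (r *\<^sub>R (b + (1 / r) *\<^sub>R y))"
      by simp
    also have "r *\<^sub>R (b + (1 / r) *\<^sub>R y) = r *\<^sub>R b + y"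
      using False by (simp add: scaleR_add_right)
    finally show ?thesis .
  qed simp
  with \<delta>(1) show thesis using that by blast
qed

text \<open>In the induction step a Cauchy sequence is split as \<open>r n *\<^sub>R b\<close> plus
  a part in \<open>span F\<close>. The bounded \<open>b\<close>-coordinate makes \<open>r\<close>
  Cauchy, hence the remaining part is Cauchy too.\<close>

lemma complete_span_finite:
  fixes F :: "'e::real_normed_vector set"
  assumes "finite F"
  shows "complete (span F)"
  using assms
proof (induction F rule: finite_induct)
  case empty
  show ?case by (simp add: compact_imp_complete)
next
  case (insert b F)
  show ?case
  proof (cases "b \<in> span F")
    case True
    then show ?thesis using insert.IH by (simp add: span_redundant)
  next
    case False
    obtain \<delta> where \<delta>: "\<delta> > 0" "\<And>r y. y \<in> span F \<Longrightarrow> \<bar>r\<bar> * \<delta> \<le> norm (r *\<^sub>R b + y)"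
      using span_insert_bounded_below[OF insert.IH False] by blast
    show ?thesis
      unfolding complete_def
    proof (intro allI impI, elim conjE)
      fix f :: "nat \<Rightarrow> 'e"
      assume f: "\<forall>n. f n \<in> span (insert b F)" "Cauchy f"
      then have "\<forall>n. \<exists>k. f n - k *\<^sub>R b \<in> span F"
        by (simp add: span_breakdown_eq)
      then obtain r where r: "\<And>n. f n - r n *\<^sub>R b \<in> span F"
        by metis
      have dr: "\<bar>r m - r n\<bar> * \<delta> \<le> norm (f m - f n)" for m n
      proof -
        have "(f m - r m *\<^sub>R b) - (f n - r n *\<^sub>R b) \<in> span F"
          by (intro span_diff r)
        from \<delta>(2)[OF this, of "r m - r n"] show ?thesis
          by (simp add: algebra_simps)
      qed
      have "Cauchy r"
      proof (rule metric_CauchyI)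
        fix e :: real assume "e > 0"
        then obtain M where M: "\<And>m n. m \<ge> M \<Longrightarrow> n \<ge> M \<Longrightarrow> norm (f m - f n) < e * \<delta>"
          using f(2) \<delta>(1) by (metis CauchyD mult_pos_pos)
        have "dist (r m) (r n) < e" if "m \<ge> M" "n \<ge> M" for m n
          using order_le_less_trans[OF dr M[OF that]] \<delta>(1) by (simp add: dist_real_def)
        then show "\<exists>M. \<forall>m\<ge>M. \<forall>n\<ge>M. dist (r m) (r n) < e" by blast
      qed
      then obtain R where R: "r \<longlonglongrightarrow> R"
        by (auto simp: Cauchy_convergent_iff convergent_def)
      then have rb: "(\<lambda>n. r n *\<^sub>R b) \<longlonglongrightarrow> R *\<^sub>R b"
        by (intro tendsto_intros)
      have "Cauchy (\<lambda>n. f n - r n *\<^sub>R b)"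
      proof (rule CauchyI)
        fix e :: real assume "e > 0"
        then obtain M M' where M: "\<And>m n. m \<ge> M \<Longrightarrow> n \<ge> M \<Longrightarrow> norm (f m - f n) < e / 2"
          "\<And>m n. m \<ge> M' \<Longrightarrow> n \<ge> M' \<Longrightarrow> norm (r m *\<^sub>R b - r n *\<^sub>R b) < e / 2"
          using CauchyD[OF f(2), of "e / 2"] CauchyD[OF LIMSEQ_imp_Cauchy[OF rb], of "e / 2"]
          by (meson half_gt_zero)
        have "norm ((f m - r m *\<^sub>R b) - (f n - r n *\<^sub>R b)) < e" if "m \<ge> max M M'" "n \<ge> max M M'" for m n
        proof -
          have "(f m - r m *\<^sub>R b) - (f n - r n *\<^sub>R b) = (f m - f n) - (r m *\<^sub>R b - r n *\<^sub>R b)"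
            by simp
          then have "norm ((f m - r m *\<^sub>R b) - (f n - r n *\<^sub>R b))
              \<le> norm (f m - f n) + norm (r m *\<^sub>R b - r n *\<^sub>R b)"
            by (metis norm_triangle_ineq4)
          then show ?thesis using M(1)[of m n] M(2)[of m n] that by simp
        qed
        then show "\<exists>M. \<forall>m\<ge>M. \<forall>n\<ge>M. norm ((f m - r m *\<^sub>R b) - (f n - r n *\<^sub>R b)) < e" by blast
      qed
      then obtain Y where Y: "Y \<in> span F" "(\<lambda>n. f n - r n *\<^sub>R b) \<longlonglongrightarrow> Y"
        using insert.IH[unfolded complete_def, rule_format, of "\<lambda>n. f n - r n *\<^sub>R b"] r by blast
      have "(\<lambda>n. (f n - r n *\<^sub>R b) + r n *\<^sub>R b) \<longlonglongrightarrow> Y + R *\<^sub>R b"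
        using Y(2) rb by (rule tendsto_add)
      then have "f \<longlonglongrightarrow> Y + R *\<^sub>R b" by simp
      moreover have "Y + R *\<^sub>R b \<in> span (insert b F)"
        using Y(1) by (metis add_diff_cancel_right' span_breakdown_eq)
      ultimately show "\<exists>l\<in>span (insert b F). f \<longlonglongrightarrow> l" by blast
    qed
  qed
qed

text \<open>Induction on the spanning set: the \<open>b\<close>-coordinate of \<open>x\<close> is at
  most \<open>norm x / \<delta>\<close>, which bounds both the contribution of \<open>b\<close> and
  the size of what remains in \<open>span F\<close>.\<close>

lemma linear_bounded_on_finite_span:
  fixes f :: "'e::real_normed_vector \<Rightarrow> 'b::real_normed_vector"
  assumes "finite F" "linear f"
  shows "\<exists>C. \<forall>x\<in>span F. norm (f x) \<le> C * norm x"
  using assms(1)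
proof (induction F rule: finite_induct)
  case empty
  show ?case using linear_0[OF assms(2)] by auto
next
  case (insert b F)
  then obtain C where C: "\<And>x. x \<in> span F \<Longrightarrow> norm (f x) \<le> C * norm x" by blast
  show ?case
  proof (cases "b \<in> span F")
    case True
    then show ?thesis using insert.IH by (simp add: span_redundant)
  next
    case False
    obtain \<delta> where \<delta>: "\<delta> > 0" "\<And>r y. y \<in> span F \<Longrightarrow> \<bar>r\<bar> * \<delta> \<le> norm (r *\<^sub>R b + y)"
      using span_insert_bounded_below[OF complete_span_finite[OF insert.hyps(1)] False] by blast
    \<comment> \<open>The induction hypothesis allows a negative \<open>C\<close> when
      \<open>span F\<close> is trivial; the absolute value keeps the estimates monotone.\<close>
    define D where "D = \<bar>C\<bar>"
    have "norm (f x) \<le> (norm (f b) / \<delta> + D * (1 + norm b / \<delta>)) * norm x"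
      if x: "x \<in> span (insert b F)" for x
    proof -
      obtain r where r: "x - r *\<^sub>R b \<in> span F"
        using x by (auto simp: span_breakdown_eq)
      have r_le: "\<bar>r\<bar> \<le> norm x / \<delta>"
        using \<delta>(2)[OF r, of r] \<delta>(1) by (simp add: field_simps)
      have "norm (f x) = norm (r *\<^sub>R f b + f (x - r *\<^sub>R b))"
        by (simp add: linear_diff[OF assms(2)] linear_scale[OF assms(2)])
      also have "\<dots> \<le> \<bar>r\<bar> * norm (f b) + norm (f (x - r *\<^sub>R b))"
        by (metis norm_scaleR norm_triangle_ineq)
      also have "norm (f (x - r *\<^sub>R b)) \<le> D * norm (x - r *\<^sub>R b)"
        using C[OF r] unfolding D_def by (meson abs_ge_self mult_right_mono norm_ge_zero order_trans)
      finally have "norm (f x) \<le> \<bar>r\<bar> * norm (f b) + D * norm (x - r *\<^sub>R b)" by simp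
      moreover have "norm (x - r *\<^sub>R b) \<le> norm x + \<bar>r\<bar> * norm b"
        by (metis norm_scaleR norm_triangle_ineq4)
      then have "norm (x - r *\<^sub>R b) \<le> norm x + norm x / \<delta> * norm b"
        using mult_right_mono[OF r_le norm_ge_zero[of b]] by linarith
      then have "D * norm (x - r *\<^sub>R b) \<le> D * (norm x + norm x / \<delta> * norm b)"
        by (rule mult_left_mono) (simp add: D_def)
      moreover have "\<bar>r\<bar> * norm (f b) \<le> norm x / \<delta> * norm (f b)"
        using r_le by (rule mult_right_mono) simp
      ultimately show ?thesis by (simp add: algebra_simps)
    qed
    then show ?thesis by blast
  qed
qed

lemma linear_bounded_linear_finite_span:
  fixes f :: "'e::real_normed_vector \<Rightarrow> 'b::real_normed_vector" and F :: "'e set"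
  assumes "finite F" "span F = UNIV" "linear f"
  shows "bounded_linear f"
proof -
  obtain C where "\<forall>x. norm (f x) \<le> C * norm x"
    using linear_bounded_on_finite_span[OF assms(1,3)] assms(2) by auto
  then show ?thesis
    using assms(3) by (intro bounded_linear_intro[of f C]) (auto simp: linear_add linear_scale mult.commute)
qed

text \<open>The threshold \<delta> does not depend on \<open>f\<close>: after passing to a basis
  inside \<open>B\<close>, the norms of the coordinate functionals bound \<open>onorm f\<close> by a
  fixed multiple of the largest value of \<open>f\<close> on the basis.\<close>

lemma onorm_small_on_finite_span:
  fixes B :: "'e::real_normed_vector set" and e :: real
  assumes "finite B" "span B = UNIV" "e > 0"
  obtains \<delta> where "\<delta> > 0"
    "\<And>f::'e \<Rightarrow> 'b::real_normed_vector. bounded_linear f \<Longrightarrow>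
       (\<And>b. b \<in> B \<Longrightarrow> norm (f b) \<le> \<delta>) \<Longrightarrow> onorm f \<le> e"
proof -
  obtain B' where B': "B' \<subseteq> B" "independent B'" "B \<subseteq> span B'"
    by (meson maximal_independent_subset)
  have fin: "finite B'" using B'(1) assms(1) finite_subset by blast
  have sp: "span B' = UNIV" using B'(3) assms(2) by (metis span_minimal subspace_span top.extremum_unique)
  have bl: "bounded_linear (\<lambda>x. representation B' x b)" for b
  proof (rule linear_bounded_linear_finite_span[OF assms(1,2)])
    show "linear (\<lambda>x. representation B' x b)"
      by (rule linearI) (simp_all add: representation_add representation_scale B'(2) sp)
  qed
  \<comment> \<open>The added 1 keeps \<open>K\<close> positive when the basis is empty, that is, in
    dimension zero.\<close>
  define K where "K = (\<Sum>b\<in>B'. onorm (\<lambda>x. representation B' x b)) + 1"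
  have Kpos: "K > 0"
    unfolding K_def by (simp add: add_nonneg_pos sum_nonneg onorm_pos_le[OF bl])
  show thesis
  proof (rule that[of "e / K"])
    show "e / K > 0" using Kpos assms(3) by simp
    fix f :: "'e \<Rightarrow> 'b" assume f: "bounded_linear f" "\<And>b. b \<in> B \<Longrightarrow> norm (f b) \<le> e / K"
    have "norm (f x) \<le> e * norm x" for x
    proof -
      have lf: "linear f" using f(1) by (rule bounded_linear.linear)
      have "f x = f (\<Sum>b\<in>B'. representation B' x b *\<^sub>R b)"
        using sum_representation_eq[OF B'(2) _ fin subset_refl] sp by simp
      also have "\<dots> = (\<Sum>b\<in>B'. representation B' x b *\<^sub>R f b)"
        by (simp add: linear_sum[OF lf] linear_scale[OF lf])
      also have "norm \<dots> \<le> (\<Sum>b\<in>B'. norm (representation B' x b *\<^sub>R f b))"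
        by (rule norm_sum)
      also have "\<dots> \<le> (\<Sum>b\<in>B'. onorm (\<lambda>x. representation B' x b) * norm x * (e / K))"
      proof (rule sum_mono)
        fix b assume b: "b \<in> B'"
        have "\<bar>representation B' x b\<bar> \<le> onorm (\<lambda>x. representation B' x b) * norm x"
          using onorm[OF bl, of x b] by simp
        then show "norm (representation B' x b *\<^sub>R f b)
            \<le> onorm (\<lambda>x. representation B' x b) * norm x * (e / K)"
          using f(2)[of b] b B'(1)
          by (simp only: norm_scaleR) (intro mult_mono, auto simp: onorm_pos_le[OF bl])
      qed
      also have "\<dots> = (K - 1) * (norm x * (e / K))"
        unfolding K_def by (simp only: sum_distrib_right mult.assoc add_diff_cancel_right')
      also have "\<dots> \<le> K * (norm x * (e / K))"
        using Kpos assms(3) by (intro mult_right_mono) auto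
      also have "\<dots> = e * norm x" using Kpos by simp
      finally show ?thesis .
    qed
    with \<open>e > 0\<close> show "onorm f \<le> e" by (intro onorm_bound) auto
  qed
qed

section \<open>Strict differentiability, metric regularity and fibres\<close>

text \<open>Continuity of each directional derivative gives continuity of the derivative in operator norm
  because the coordinate functionals of a finite spanning set are bounded.\<close>

lemma strict_derivative:
  fixes f :: "'e::real_normed_vector \<Rightarrow> 'f::real_normed_vector" and B :: "'e set"
  assumes B: "finite B" "span B = UNIV" and "open S" "a \<in> S"
    and diff: "\<And>x. x \<in> S \<Longrightarrow> f differentiable (at x)"
    and cont: "\<And>v. continuous_on S (\<lambda>x. frechet_derivative f (at x) v)"
    and "e > 0"
  obtains \<delta> where "\<delta> > 0" "ball a \<delta> \<subseteq> S"
    "\<And>x y. x \<in> ball a \<delta> \<Longrightarrow> y \<in> ball a \<delta> \<Longrightarrow>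
       norm (f x - f y - frechet_derivative f (at a) (x - y)) \<le> e * norm (x - y)"
proof -
  define D where "D x = frechet_derivative f (at x)" for x
  have D: "(f has_derivative D x) (at x)" if "x \<in> S" for x
    using diff[OF that] unfolding D_def by (simp add: frechet_derivative_works)
  obtain \<eta> where \<eta>: "\<eta> > 0"
    "\<And>g::'e \<Rightarrow> 'f. bounded_linear g \<Longrightarrow> (\<And>b. b \<in> B \<Longrightarrow> norm (g b) \<le> \<eta>) \<Longrightarrow> onorm g \<le> e"
    using onorm_small_on_finite_span[OF B \<open>e > 0\<close>] by blast
  \<comment> \<open>Finiteness of \<open>B\<close> turns pointwise continuity in each direction into
    one neighbourhood that works for all of \<open>B\<close>.\<close>
  have "\<forall>\<^sub>F x in nhds a. \<forall>b\<in>B. norm (D x b - D a b) \<le> \<eta>"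
  proof (rule eventually_ball_finite[OF B(1)], rule ballI)
    fix b
    have "isCont (\<lambda>x. D x b) a"
      using cont \<open>open S\<close> \<open>a \<in> S\<close> unfolding D_def by (simp add: continuous_on_eq_continuous_at)
    then have "((\<lambda>x. D x b) \<longlongrightarrow> D a b) (nhds a)"
      using tendsto_at_iff_tendsto_nhds[of "\<lambda>x. D x b" a] by (simp add: isCont_def)
    then show "\<forall>\<^sub>F x in nhds a. norm (D x b - D a b) \<le> \<eta>"
      using \<eta>(1) by (auto dest!: tendstoD simp: dist_norm elim: eventually_mono)
  qed
  moreover have "\<forall>\<^sub>F x in nhds a. x \<in> S"
    using \<open>open S\<close> \<open>a \<in> S\<close> by (rule eventually_nhds_in_open)
  ultimately have "\<forall>\<^sub>F x in nhds a. (\<forall>b\<in>B. norm (D x b - D a b) \<le> \<eta>) \<and> x \<in> S"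
    by (rule eventually_conj)
  then obtain \<delta> where \<delta>: "\<delta> > 0"
    "\<And>x. dist x a < \<delta> \<Longrightarrow> (\<forall>b\<in>B. norm (D x b - D a b) \<le> \<eta>) \<and> x \<in> S"
    by (auto simp: eventually_nhds_metric)
  have on: "onorm (\<lambda>v. D x v - D a v) \<le> e" if "x \<in> ball a \<delta>" for x
  proof -
    have "(\<forall>b\<in>B. norm (D x b - D a b) \<le> \<eta>) \<and> x \<in> S"
      using \<delta>(2)[of x] that by (simp add: dist_commute)
    then show ?thesis
      using D \<open>a \<in> S\<close> by (intro \<eta>(2) bounded_linear_sub) (auto dest: has_derivative_bounded_linear)
  qed
  show thesis
  proof (rule that[OF \<delta>(1)])
    show "ball a \<delta> \<subseteq> S" using \<delta>(2) by (auto simp: dist_commute)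
    fix x y assume xy: "x \<in> ball a \<delta>" "y \<in> ball a \<delta>"
    have bl: "bounded_linear (D a)" using D[OF \<open>a \<in> S\<close>] by (rule has_derivative_bounded_linear)
    \<comment> \<open>Mean value inequality on the convex ball for \<open>f\<close> minus its linear
      part at \<open>a\<close>, whose derivative at \<open>z\<close> is
      \<open>D z - D a\<close>.\<close>
    have "norm ((f x - D a x) - (f y - D a y)) \<le> e * norm (x - y)"
    proof (rule differentiable_bound[OF convex_ball _ on xy])
      fix z assume "z \<in> ball a \<delta>"
      then have "z \<in> S" using \<delta>(2)[of z] by (simp add: dist_commute)
      then show "((\<lambda>x. f x - D a x) has_derivative (\<lambda>v. D z v - D a v)) (at z within ball a \<delta>)"
        by (intro has_derivative_diff bounded_linear_imp_has_derivative[OF bl]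
            has_derivative_at_withinI[OF D])
    qed
    moreover have "(f x - D a x) - (f y - D a y) = f x - f y - D a (x - y)"
      using bl by (simp add: bounded_linear.linear linear_diff)
    ultimately show "norm (f x - f y - frechet_derivative f (at a) (x - y)) \<le> e * norm (x - y)"
      unfolding D_def by simp
  qed
qed

lemma has_derivative_atE:
  fixes f :: "'a::real_normed_vector \<Rightarrow> 'b::real_normed_vector"
  assumes "(f has_derivative f') (at x)" "e > 0"
  obtains d where "d > 0"
    "\<And>y. norm (y - x) < d \<Longrightarrow> norm (f y - f x - f' (y - x)) \<le> e * norm (y - x)"
  using assms by (auto simp: has_derivative_at_alt)

text \<open>A Newton-type fixed point argument, with a right inverse of the derivative at \<open>a\<close> in place of
  the inverse derivative.\<close>

lemma metric_regularity:
  fixes f :: "'e::real_normed_vector \<Rightarrow> 'f::real_normed_vector" and B :: "'e set" and C :: "'f set"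
  assumes B: "finite B" "span B = UNIV" and C: "finite C" "span C = UNIV"
    and "open S" "a \<in> S"
    and diff: "\<And>x. x \<in> S \<Longrightarrow> f differentiable (at x)"
    and cont: "\<And>v. continuous_on S (\<lambda>x. frechet_derivative f (at x) v)"
    and surj: "surj (frechet_derivative f (at a))"
  obtains K \<delta> where "K > 0" "\<delta> > 0"
    "\<And>u y. u \<in> ball a \<delta> \<Longrightarrow> y \<in> ball (f a) \<delta> \<Longrightarrow>
       \<exists>u'\<in>S. f u' = y \<and> norm (u' - u) \<le> K * norm (y - f u)"
proof -
  define A where "A = frechet_derivative f (at a)"
  have fA: "(f has_derivative A) (at a)"
    using diff[OF \<open>a \<in> S\<close>] unfolding A_def by (simp add: frechet_derivative_works)
  have linA: "linear A" using fA has_derivative_linear by blast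
  obtain R where R: "linear R" "A \<circ> R = id"
    using linear_surjective_right_inverse[OF linA] surj unfolding A_def by blast
  have AR: "A (R z) = z" for z using R(2) by (metis comp_apply id_apply)
  have blR: "bounded_linear R" using linear_bounded_linear_finite_span[OF C R(1)] .
  obtain k where k: "k > 0" "\<And>z. norm (R z) \<le> norm z * k"
    using bounded_linear.pos_bounded[OF blR] by blast
  \<comment> \<open>The linearisation error \<open>1 / (2 * k)\<close> times the bound
    \<open>k\<close> of the right inverse gives the contraction factor 1/2.\<close>
  obtain \<delta>1 where \<delta>1: "\<delta>1 > 0" "ball a \<delta>1 \<subseteq> S"
    "\<And>x y. x \<in> ball a \<delta>1 \<Longrightarrow> y \<in> ball a \<delta>1 \<Longrightarrow> norm (f x - f y - A (x - y)) \<le> (1 / (2 * k)) * norm (x - y)"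
    using strict_derivative[OF B \<open>open S\<close> \<open>a \<in> S\<close> diff cont, of "1 / (2 * k)"] k(1)
    unfolding A_def by (metis zero_less_divide_1_iff zero_less_mult_iff zero_less_numeral)
  have "isCont f a" using fA by (rule has_derivative_continuous)
  moreover have "\<delta>1 / (8 * k) > 0" using \<delta>1(1) k(1) by simp
  ultimately obtain \<delta>2 where \<delta>2: "\<delta>2 > 0" "\<And>u. dist u a < \<delta>2 \<Longrightarrow> dist (f u) (f a) < \<delta>1 / (8 * k)"
    by (metis continuous_at_eps_delta)
  \<comment> \<open>The last two radii give \<open>norm (y - f u) < \<delta>1 / (4 * k)\<close>,
    hence \<open>r * k < \<delta>1 / 2\<close> below. With \<open>u\<close> within
    \<open>\<delta>1 / 2\<close> of \<open>a\<close>, all points \<open>u + R z\<close> then stay in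
    the ball of radius \<open>\<delta>1\<close>.\<close>
  define \<delta> where "\<delta> = min (\<delta>1 / 2) (min \<delta>2 (\<delta>1 / (8 * k)))"
  have "\<delta> > 0" unfolding \<delta>_def using \<delta>1(1) \<delta>2(1) k(1) by simp
  have "\<exists>u'\<in>S. f u' = y \<and> norm (u' - u) \<le> (2 * k) * norm (y - f u)"
    if u: "u \<in> ball a \<delta>" and y: "y \<in> ball (f a) \<delta>" for u y
  proof -
    \<comment> \<open>Since \<open>norm (T 0) = r / 2\<close> and \<open>T\<close> contracts by 1/2,
      the ball of radius \<open>r\<close> is mapped into itself. A fixed point \<open>z\<close> of
      \<open>T\<close> is exactly a solution of \<open>f (u + R z) = y\<close>.\<close>
    define r where "r = 2 * norm (y - f u)"
    define T where "T z = z + y - f (u + R z)" for z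
    have "norm (y - f u) \<le> dist (f a) y + dist (f u) (f a)"
      by (metis dist_commute dist_norm dist_triangle2 add.commute dist_triangle)
    also have "\<dots> < \<delta>1 / (8 * k) + \<delta>1 / (8 * k)"
      using y \<delta>2(2)[of u] u unfolding \<delta>_def by (simp add: dist_commute)
    finally have kr: "r * k < \<delta>1 / 2"
      unfolding r_def using k(1) by (simp add: field_simps)
    have dom: "u + R z \<in> ball a \<delta>1" if "z \<in> cball 0 r" for z
    proof -
      have "norm (R z) \<le> r * k"
        using k that by (meson mem_cball_0 mult_right_mono less_imp_le order_trans)
      moreover have "dist a u < \<delta>1 / 2" using u unfolding \<delta>_def by simp
      moreover have "dist a (u + R z) \<le> dist a u + norm (R z)"
        by (metis dist_norm dist_triangle dist_commute add_diff_cancel_left')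
      ultimately show ?thesis using kr by simp
    qed
    have contr: "norm (T z - T z') \<le> (1 / 2) * norm (z - z')" if "z \<in> cball 0 r"
      "z' \<in> cball 0 r" for z z'
    proof -
      have Rd: "(u + R z) - (u + R z') = R (z - z')"
        by (simp add: linear_diff[OF R(1)])
      have "norm (T z - T z') = norm (f (u + R z) - f (u + R z') - (z - z'))"
        unfolding T_def by (simp add: norm_minus_commute algebra_simps)
      also have "\<dots> \<le> 1 / (2 * k) * norm (R (z - z'))"
        using \<delta>1(3)[OF dom[OF that(1)] dom[OF that(2)]] unfolding Rd AR .
      also have "\<dots> \<le> 1 / (2 * k) * (norm (z - z') * k)"
        using k by (intro mult_left_mono) auto
      finally show ?thesis using k(1) by simp
    qed
    have r0: "r \<ge> 0" unfolding r_def by simp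
    have T0: "norm (T 0) = r / 2"
      unfolding T_def r_def by (simp add: linear_0[OF R(1)])
    have "\<exists>!z\<in>cball 0 r. T z = z"
    proof (rule Banach_fix[where c = "1/2"])
      show "complete (cball 0 r :: 'f set)"
        using complete_Int_closed[OF complete_span_finite[OF C(1)], of "cball 0 r"] C(2) by simp
      show "T ` cball 0 r \<subseteq> cball 0 r"
      proof
        fix w assume "w \<in> T ` cball 0 r"
        then obtain z where z: "z \<in> cball 0 r" "w = T z" by blast
        have "norm (T z - T 0) \<le> (1 / 2) * norm z"
          using contr[OF z(1), of 0] r0 by simp
        then show "w \<in> cball 0 r"
          using z T0 norm_triangle_sub[of "T z" "T 0"] by simp
      qed
      show "dist (T z) (T z') \<le> 1 / 2 * dist z z'" if "z \<in> cball 0 r" "z' \<in> cball 0 r" for z z'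
        using contr[OF that] by (simp add: dist_norm)
    qed (use r0 in auto)
    then obtain z where z: "z \<in> cball 0 r" "T z = z" by blast
    have "f (u + R z) = y" using z(2) unfolding T_def by (simp add: algebra_simps)
    moreover have "u + R z \<in> S" using dom[OF z(1)] \<delta>1(2) by blast
    moreover have "norm (R z) \<le> r * k"
      using k z(1) by (meson mem_cball_0 mult_right_mono less_imp_le order_trans)
    ultimately show ?thesis
      unfolding r_def by (intro bexI[of _ "u + R z"]) (simp_all add: mult_ac)
  qed
  then show thesis using that[of "2 * k" \<delta>] k(1) \<open>\<delta> > 0\<close> by simp
qed

text \<open>The points \<open>a + v / (n + 1)\<close> miss the fibre only by o(1/n), because the
  derivative kills \<open>v\<close>. Metric regularity moves them onto the fibre at a cost of the
  same order, and this correction disappears after multiplication by \<open>n + 1\<close>.\<close>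

lemma kernel_vector_tangent_to_fibre:
  fixes f :: "'e::real_normed_vector \<Rightarrow> 'f::real_normed_vector" and B :: "'e set" and C :: "'f set"
  assumes B: "finite B" "span B = UNIV" and C: "finite C" "span C = UNIV"
    and "open S" "a \<in> S"
    and diff: "\<And>x. x \<in> S \<Longrightarrow> f differentiable (at x)"
    and cont: "\<And>v. continuous_on S (\<lambda>x. frechet_derivative f (at x) v)"
    and surj: "surj (frechet_derivative f (at a))"
    and ker: "frechet_derivative f (at a) v = 0"
  obtains u :: "nat \<Rightarrow> 'e" where "\<And>n. u n \<in> S" "\<And>n. f (u n) = f a"
    "(\<lambda>n. real (Suc n) *\<^sub>R (u n - a)) \<longlonglongrightarrow> v"
proof -
  define A where "A = frechet_derivative f (at a)"
  have fA: "(f has_derivative A) (at a)"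
    using diff[OF \<open>a \<in> S\<close>] unfolding A_def by (simp add: frechet_derivative_works)
  have linA: "linear A" using fA has_derivative_linear by blast
  obtain K \<delta> where K: "K > 0" "\<delta> > 0"
    "\<And>u y. u \<in> ball a \<delta> \<Longrightarrow> y \<in> ball (f a) \<delta> \<Longrightarrow>
       \<exists>u'\<in>S. f u' = y \<and> norm (u' - u) \<le> K * norm (y - f u)"
    using metric_regularity[OF B C \<open>open S\<close> \<open>a \<in> S\<close> diff cont surj] by metis
  define w where "w n = a + (1 / real (Suc n)) *\<^sub>R v" for n
  \<comment> \<open>For the finitely many \<open>n\<close> with \<open>w n\<close> outside the ball,
    \<open>a\<close> itself serves as the point of the fibre.\<close>
  have "\<exists>u'\<in>S. f u' = f a \<and> (w n \<in> ball a \<delta> \<longrightarrow> norm (u' - w n) \<le> K * norm (f a - f (w n)))" for n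
    using K(3)[of "w n" "f a"] K(2) \<open>a \<in> S\<close> by (cases "w n \<in> ball a \<delta>") auto
  then obtain u where u: "\<And>n. u n \<in> S" "\<And>n. f (u n) = f a"
    "\<And>n. w n \<in> ball a \<delta> \<Longrightarrow> norm (u n - w n) \<le> K * norm (f a - f (w n))"
    by metis
  have "(\<lambda>n. (1 / real (Suc n)) *\<^sub>R v) \<longlonglongrightarrow> 0 *\<^sub>R v"
    using LIMSEQ_inverse_real_of_nat
    by (intro tendsto_scaleR tendsto_const) (simp add: inverse_eq_divide)
  then have w_lim: "(\<lambda>n. w n - a) \<longlonglongrightarrow> 0" unfolding w_def by simp
  have "(\<lambda>n. real (Suc n) *\<^sub>R (u n - a) - v) \<longlonglongrightarrow> 0"
  proof (rule LIMSEQ_I)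
    fix e :: real assume "e > 0"
    \<comment> \<open>Chosen so that \<open>K * e' * norm v < e\<close>; the 1 covers
      \<open>v = 0\<close>.\<close>
    define e' where "e' = e / (2 * K * (norm v + 1))"
    have nv: "norm v + 1 > 0" by (simp add: add_nonneg_pos)
    have "e' > 0" unfolding e'_def using \<open>e > 0\<close> K(1) nv by simp
    obtain d where d: "d > 0"
      "\<And>y. norm (y - a) < d \<Longrightarrow> norm (f y - f a - A (y - a)) \<le> e' * norm (y - a)"
      using has_derivative_atE[OF fA \<open>e' > 0\<close>] by blast
    obtain M where M: "\<And>n. n \<ge> M \<Longrightarrow> norm (w n - a) < min d \<delta>"
      using LIMSEQ_D[OF w_lim, of "min d \<delta>"] d(1) K(2) by auto
    have "norm (real (Suc n) *\<^sub>R (u n - a) - v) < e" if "n \<ge> M" for n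
    proof -
      have Av: "A (w n - a) = 0"
        using ker unfolding w_def A_def[symmetric] by (simp add: linear_scale[OF linA])
      have "norm (f a - f (w n)) \<le> e' * norm (w n - a)"
        using d(2)[of "w n"] M[OF that] Av by (simp add: norm_minus_commute)
      also have "norm (w n - a) = norm v / real (Suc n)" unfolding w_def by simp
      finally have 1: "norm (f a - f (w n)) \<le> e' * (norm v / real (Suc n))" .
      have "norm (u n - w n) \<le> K * norm (f a - f (w n))"
        using u(3)[of n] M[OF that] by (simp add: dist_norm norm_minus_commute)
      also have "\<dots> \<le> K * (e' * (norm v / real (Suc n)))"
        using 1 K(1) by (intro mult_left_mono) auto
      finally have 2: "real (Suc n) * norm (u n - w n) \<le> K * e' * norm v"
        by (simp add: field_simps)
      have "real (Suc n) *\<^sub>R (u n - a) - v = real (Suc n) *\<^sub>R (u n - w n)"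
        unfolding w_def by (simp add: scaleR_diff_right scaleR_add_right)
      then have "norm (real (Suc n) *\<^sub>R (u n - a) - v) \<le> K * e' * norm v"
        using 2 by simp
      also have "\<dots> = e * (norm v / (2 * (norm v + 1)))"
      proof -
        have "K * (e / (2 * K * c)) * x = e * (x / (2 * c))" for c x
          using K(1) by simp
        from this[of "norm v + 1" "norm v"] show ?thesis unfolding e'_def .
      qed
      also have "\<dots> < e"
      proof -
        have "norm v / (2 * (norm v + 1)) < 1" using nv by (simp add: field_simps)
        from mult_strict_left_mono[OF this \<open>e > 0\<close>] show ?thesis by simp
      qed
      finally show ?thesis .
    qed
    then show "\<exists>M. \<forall>n\<ge>M. norm (real (Suc n) *\<^sub>R (u n - a) - v - 0) < e" by auto
  qed
  then have "(\<lambda>n. real (Suc n) *\<^sub>R (u n - a)) \<longlonglongrightarrow> v" by (simp add: LIM_zero_iff)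
  with u(1,2) show thesis using that by blast
qed

text \<open>A left inverse \<open>I\<close> of \<open>A\<close> bounds \<open>norm (y n - b)\<close>
  by a multiple of the displacement of \<psi>, so the remainder of the linearisation is negligible
  even after scaling by \<open>r n\<close>. Hence \<open>v\<close> is a limit of vectors in the
  range of \<open>A\<close>, which is closed.\<close>

lemma immersion_limit_direction_in_range:
  fixes \<psi> :: "'g::real_normed_vector \<Rightarrow> 'e::real_normed_vector" and B :: "'e set"
  assumes B: "finite B" "span B = UNIV"
    and \<psi>: "(\<psi> has_derivative A) (at b)" "inj A"
    and y: "y \<longlonglongrightarrow> b" and lim: "(\<lambda>n. r n *\<^sub>R (\<psi> (y n) - \<psi> b)) \<longlonglongrightarrow> v"
  shows "v \<in> range A"
proof -
  have blA: "bounded_linear A" using \<psi>(1) by (rule has_derivative_bounded_linear)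
  then have linA: "linear A" by (rule bounded_linear.linear)
  obtain I where I: "linear I" "I \<circ> A = id"
    using linear_injective_left_inverse[OF linA \<psi>(2)] by blast
  have IA: "I (A z) = z" for z using I(2) by (metis comp_apply id_apply)
  have blI: "bounded_linear I" using linear_bounded_linear_finite_span[OF B I(1)] .
  obtain k where k: "k > 0" "\<And>z. norm (I z) \<le> norm z * k"
    using bounded_linear.pos_bounded[OF blI] by blast
  have nv: "norm v + 1 > 0" by (simp add: add_nonneg_pos)
  have ev_bound: "\<forall>\<^sub>F n in sequentially. norm (r n *\<^sub>R (\<psi> (y n) - \<psi> b)) < norm v + 1"
    using order_tendstoD(2)[OF tendsto_norm[OF lim], of "norm v + 1"] by simp
  have "(\<lambda>n. r n *\<^sub>R A (y n - b) - r n *\<^sub>R (\<psi> (y n) - \<psi> b)) \<longlonglongrightarrow> 0"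
  proof (rule tendstoI)
    fix e :: real assume "e > 0"
    \<comment> \<open>The first bound lets half of \<open>norm (y n - b)\<close> be absorbed on the
      left; the second makes the scaled remainder at most \<open>e / 2\<close>.\<close>
    define e' where "e' = min (1 / (2 * k)) (e / (4 * k * (norm v + 1)))"
    have e': "e' > 0" "e' \<le> 1 / (2 * k)" "e' \<le> e / (4 * k * (norm v + 1))"
      unfolding e'_def using \<open>e > 0\<close> k(1) nv by simp_all
    obtain d where d: "d > 0"
      "\<And>z. norm (z - b) < d \<Longrightarrow> norm (\<psi> z - \<psi> b - A (z - b)) \<le> e' * norm (z - b)"
      using has_derivative_atE[OF \<psi>(1) e'(1)] by blast
    have "\<forall>\<^sub>F n in sequentially. norm (y n - b) < d"
      using tendstoD[OF y d(1)] by (simp add: dist_norm)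
    with ev_bound show "\<forall>\<^sub>F n in sequentially.
      dist (r n *\<^sub>R A (y n - b) - r n *\<^sub>R (\<psi> (y n) - \<psi> b)) 0 < e"
    proof eventually_elim
      case (elim n)
      define \<rho> where "\<rho> = \<psi> (y n) - \<psi> b - A (y n - b)"
      have \<rho>: "norm \<rho> \<le> e' * norm (y n - b)" unfolding \<rho>_def using d(2) elim(2) .
      have "y n - b = I (\<psi> (y n) - \<psi> b) - I \<rho>"
        unfolding \<rho>_def by (simp add: linear_diff[OF I(1)] IA)
      then have "norm (y n - b) \<le> norm (I (\<psi> (y n) - \<psi> b)) + norm (I \<rho>)"
        by (metis norm_triangle_ineq4)
      also have "\<dots> \<le> norm (\<psi> (y n) - \<psi> b) * k + norm \<rho> * k"
        by (intro add_mono k(2))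
      also have "norm \<rho> * k \<le> (1 / (2 * k) * norm (y n - b)) * k"
        using k(1) order_trans[OF \<rho> mult_right_mono[OF e'(2) norm_ge_zero]] by (intro mult_right_mono) auto
      finally have 1: "norm (y n - b) \<le> 2 * k * norm (\<psi> (y n) - \<psi> b)"
        using k(1) by (simp add: field_simps)
      have "norm (r n *\<^sub>R \<rho>) \<le> \<bar>r n\<bar> * (e' * norm (y n - b))"
        using \<rho> by (simp add: mult_left_mono)
      also have "\<dots> \<le> \<bar>r n\<bar> * (e' * (2 * k * norm (\<psi> (y n) - \<psi> b)))"
        using 1 e'(1) by (intro mult_left_mono) auto
      also have "\<dots> = e' * (2 * k) * norm (r n *\<^sub>R (\<psi> (y n) - \<psi> b))"
        by simp
      also have "\<dots> \<le> e' * (2 * k) * (norm v + 1)"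
        using elim(1) e'(1) k(1) by (intro mult_left_mono) auto
      also have "\<dots> \<le> e / (4 * k * (norm v + 1)) * (2 * k) * (norm v + 1)"
        using e'(3) k(1) nv by (intro mult_right_mono) auto
      also have "\<dots> = e / 2"
      proof -
        have "e / (4 * k * c) * (2 * k) * c = e / 2" if "c > 0" for c
          using that k(1) by (simp add: field_simps)
        from this[OF nv] show ?thesis .
      qed
      also have "\<dots> < e" using \<open>e > 0\<close> by simp
      finally have "norm (r n *\<^sub>R \<rho>) < e" .
      moreover have "r n *\<^sub>R A (y n - b) - r n *\<^sub>R (\<psi> (y n) - \<psi> b) = - (r n *\<^sub>R \<rho>)"
        unfolding \<rho>_def by (simp add: scaleR_diff_right)
      ultimately show ?case by (simp only: dist_0_norm dist_commute[of _ 0] norm_minus_cancel)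
    qed
  qed
  from tendsto_add[OF this lim] have "(\<lambda>n. r n *\<^sub>R A (y n - b)) \<longlonglongrightarrow> v" by simp
  then have l: "(\<lambda>n. A (r n *\<^sub>R (y n - b))) \<longlonglongrightarrow> v" by (simp add: linear_scale[OF linA])
  \<comment> \<open>The continuous map \<open>A \<circ> I\<close> fixes every term of the sequence,
    hence also its limit; this is closedness of the range.\<close>
  have "(\<lambda>n. A (I (A (r n *\<^sub>R (y n - b))))) \<longlonglongrightarrow> A (I v)"
    by (intro bounded_linear.tendsto[OF blA] bounded_linear.tendsto[OF blI] l)
  with l have "v = A (I v)" unfolding IA using LIMSEQ_unique by blast
  then show ?thesis by blast
qed

text \<open>For \<open>y\<close> near \<open>f a\<close>, the point \<open>a + R (y - f a)\<close>
  is almost a preimage of \<open>y\<close>, and metric regularity corrects it to an exact preimage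
  \<open>u'\<close> at a cost of o(|y - f a|). Then \<open>h y\<close> is the value of
  \<open>h \<circ> f\<close> at \<open>u'\<close>, so the derivative of \<open>h\<close> is
  \<open>H \<circ> R\<close>.\<close>

lemma differentiable_descends:
  fixes f :: "'e::real_normed_vector \<Rightarrow> 'f::real_normed_vector" and B :: "'e set" and C :: "'f set"
    and h :: "'f \<Rightarrow> 'b::real_normed_vector"
  assumes B: "finite B" "span B = UNIV" and C: "finite C" "span C = UNIV"
    and "open S" "a \<in> S"
    and diff: "\<And>x. x \<in> S \<Longrightarrow> f differentiable (at x)"
    and cont: "\<And>v. continuous_on S (\<lambda>x. frechet_derivative f (at x) v)"
    and surj: "surj (frechet_derivative f (at a))"
    and hf: "(\<lambda>x. h (f x)) differentiable (at a)"
  shows "h differentiable (at (f a))"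
proof -
  define A where "A = frechet_derivative f (at a)"
  have fA: "(f has_derivative A) (at a)"
    using diff[OF \<open>a \<in> S\<close>] unfolding A_def by (simp add: frechet_derivative_works)
  have linA: "linear A" using fA has_derivative_linear by blast
  obtain R where R: "linear R" "A \<circ> R = id"
    using linear_surjective_right_inverse[OF linA] surj unfolding A_def by blast
  have AR: "A (R z) = z" for z using R(2) by (metis comp_apply id_apply)
  have blR: "bounded_linear R" using linear_bounded_linear_finite_span[OF C R(1)] .
  obtain k where k: "k > 0" "\<And>z. norm (R z) \<le> norm z * k"
    using bounded_linear.pos_bounded[OF blR] by blast
  obtain H where H: "((\<lambda>x. h (f x)) has_derivative H) (at a)"
    using hf by (auto simp: differentiable_def)
  have blH: "bounded_linear H" using H by (rule has_derivative_bounded_linear)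
  obtain m where m: "m > 0" "\<And>z. norm (H z) \<le> norm z * m"
    using bounded_linear.pos_bounded[OF blH] by blast
  obtain K \<delta> where K: "K > 0" "\<delta> > 0"
    "\<And>u y. u \<in> ball a \<delta> \<Longrightarrow> y \<in> ball (f a) \<delta> \<Longrightarrow>
       \<exists>u'\<in>S. f u' = y \<and> norm (u' - u) \<le> K * norm (y - f u)"
    using metric_regularity[OF B C \<open>open S\<close> \<open>a \<in> S\<close> diff cont surj] by metis
  have "(h has_derivative (\<lambda>z. H (R z))) (at (f a))"
    unfolding has_derivative_at_alt
  proof (intro conjI allI impI)
    show "bounded_linear (\<lambda>z. H (R z))" using blH blR by (rule bounded_linear_compose)
    fix e :: real assume "e > 0"
    \<comment> \<open>\<open>e1\<close> controls the correction \<open>H (u' - u)\<close> and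
      \<open>e2\<close> the linearisation error of \<open>h \<circ> f\<close> at \<open>u'\<close>;
      each contributes \<open>e / 2\<close>. The bound 1 on \<open>e1\<close> keeps
      \<open>u'\<close> within \<open>(k + K * k) * t\<close> of \<open>a\<close>.\<close>
    define e1 where "e1 = min 1 (e / (2 * m * K * k))"
    define e2 where "e2 = e / (2 * (k + K * k))"
    have e1: "e1 > 0" "e1 \<le> 1" "e1 \<le> e / (2 * m * K * k)"
      unfolding e1_def using \<open>e > 0\<close> k(1) K(1) m(1) by simp_all
    have kK: "k + K * k > 0" using k(1) K(1) by (simp add: add_pos_pos)
    have e2: "e2 > 0" unfolding e2_def using \<open>e > 0\<close> kK by simp
    obtain d1 where d1: "d1 > 0"
      "\<And>y. norm (y - a) < d1 \<Longrightarrow> norm (f y - f a - A (y - a)) \<le> e1 * norm (y - a)"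
      using has_derivative_atE[OF fA e1(1)] by blast
    obtain d2 where d2: "d2 > 0"
      "\<And>y. norm (y - a) < d2 \<Longrightarrow> norm (h (f y) - h (f a) - H (y - a)) \<le> e2 * norm (y - a)"
      using has_derivative_atE[OF H e2] by blast
    \<comment> \<open>The four radii put, in this order, \<open>y\<close> and \<open>u\<close> into
      the regularity balls, \<open>u\<close> into the range of the estimate for \<open>f\<close>,
      and \<open>u'\<close> into that for \<open>h \<circ> f\<close>.\<close>
    define d where "d = min \<delta> (min (\<delta> / k) (min (d1 / k) (d2 / (k + K * k))))"
    have "d > 0" unfolding d_def using K(2) k(1) kK d1(1) d2(1) by simp
    have "norm (h y - h (f a) - H (R (y - f a))) \<le> e * norm (y - f a)" if y: "norm (y - f a) < d" for y
    proof -
      define t where "t = norm (y - f a)"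
      define u where "u = a + R (y - f a)"
      have t: "t < \<delta>" "t * k < \<delta>" "t * k < d1" "(k + K * k) * t < d2"
        using y k(1) kK unfolding d_def t_def by (simp_all add: field_simps)
      have ua: "norm (u - a) \<le> t * k" unfolding u_def t_def using k(2) by simp
      have "u \<in> ball a \<delta>" using ua t(2) by (simp add: dist_norm norm_minus_commute)
      moreover have "y \<in> ball (f a) \<delta>"
        using t(1) unfolding t_def by (simp add: dist_norm norm_minus_commute)
      ultimately obtain u' where u': "f u' = y" "norm (u' - u) \<le> K * norm (y - f u)"
        using K(3) by blast
      have "norm (y - f u) = norm (f u - f a - A (u - a))"
        unfolding u_def by (simp add: AR norm_minus_commute)
      also have "\<dots> \<le> e1 * norm (u - a)"
        using d1(2)[of u] ua t(3) by simp
      also have "\<dots> \<le> e1 * (t * k)" using ua e1(1) by simp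
      finally have "K * norm (y - f u) \<le> K * (e1 * (t * k))" using K(1) by simp
      then have u'u: "norm (u' - u) \<le> e1 * (K * k * t)" using u'(2) by (simp add: mult_ac)
      have t0: "K * k * t \<ge> 0" unfolding t_def using K(1) k(1) by simp
      have "norm (u' - a) \<le> norm (u' - u) + norm (u - a)"
        by (metis diff_add_cancel add_diff_eq norm_triangle_ineq)
      also have "\<dots> \<le> 1 * (K * k * t) + t * k"
        using ua u'u mult_right_mono[OF e1(2) t0] by linarith
      finally have u'a: "norm (u' - a) \<le> (k + K * k) * t" by (simp add: algebra_simps)
      have "norm (h y - h (f a) - H (u' - a)) \<le> e2 * norm (u' - a)"
        using d2(2)[of u'] u'a t(4) u'(1) by simp
      also have "\<dots> \<le> e2 * ((k + K * k) * t)" using u'a e2 by simp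
      also have "\<dots> = e / 2 * t"
      proof -
        have "e / (2 * c) * (c * t) = e / 2 * t" if "c > 0" for c
          using that by (simp add: field_simps)
        from this[OF kK] show ?thesis unfolding e2_def .
      qed
      finally have 1: "norm (h y - h (f a) - H (u' - a)) \<le> e / 2 * t" .
      have "norm (H (u' - u)) \<le> e1 * (K * k * t) * m"
        using m order_trans[OF m(2) mult_right_mono[OF u'u]] by simp
      also have "\<dots> = e1 * (K * k * t * m)" by simp
      also have "\<dots> \<le> e / (2 * m * K * k) * (K * k * t * m)"
        using e1(3) m(1) t0 by (intro mult_right_mono) auto
      also have "\<dots> = e / 2 * t" using m(1) k(1) K(1) by simp
      finally have 2: "norm (H (u' - u)) \<le> e / 2 * t" .
      have "h y - h (f a) - H (R (y - f a)) = (h y - h (f a) - H (u' - a)) + H (u' - u)"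
        unfolding u_def using bounded_linear.linear[OF blH]
        by (simp add: linear_diff linear_add)
      then have "norm (h y - h (f a) - H (R (y - f a))) \<le> e / 2 * t + e / 2 * t"
        using 1 2 norm_triangle_mono by metis
      then show ?thesis unfolding t_def by simp
    qed
    with \<open>d > 0\<close> show "\<exists>d>0. \<forall>y. norm (y - f a) < d \<longrightarrow>
      norm (h y - h (f a) - H (R (y - f a))) \<le> e * norm (y - f a)" by blast
  qed
  then show ?thesis by (auto simp: differentiable_def)
qed

section \<open>Tangent maps\<close>

text \<open>The part of \<open>smooth_manifold\<close> that the calculus of tangent maps needs; unlike
  \<open>smooth_manifold\<close> it passes to products without effort.\<close>

definition differentiable_manifold :: "('a, 'e::real_normed_vector) manifold \<Rightarrow> bool" where
  "differentiable_manifold M \<longleftrightarrow>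
     (\<Union>c\<in>atlas M. fst c) = points M \<and>
     (\<forall>c\<in>atlas M. openin (mtop M) (fst c) \<and> inj_on (snd c) (fst c) \<and>
        (\<forall>A. openin (mtop M) A \<longrightarrow> open (snd c ` (A \<inter> fst c))) \<and>
        (\<forall>B. open B \<longrightarrow> openin (mtop M) {p \<in> fst c. snd c p \<in> B})) \<and>
     (\<forall>c\<in>atlas M. \<forall>d\<in>atlas M. \<forall>p\<in>fst c \<inter> fst d.
        (snd d \<circ> chart_inv c) differentiable (at (snd c p)))"

lemma smooth_on_imp_differentiable:
  assumes "smooth_on S f" "x \<in> S"
  shows "f differentiable (at x)"
proof -
  have "Ck_on S f (Suc 0)" using assms(1) unfolding smooth_on_def by blast
  with assms(2) show ?thesis by simp
qed

lemma smooth_on_imp_continuous_derivative: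
  assumes "smooth_on S f"
  shows "continuous_on S (\<lambda>x. frechet_derivative f (at x) v)"
proof -
  have "Ck_on S f (Suc 0)" using assms(1) unfolding smooth_on_def by blast
  then show ?thesis by simp
qed

lemma smooth_imp_differentiable_manifold:
  assumes "smooth_manifold M"
  shows "differentiable_manifold M"
proof -
  note sm = assms[unfolded smooth_manifold_def]
  have "inj_on (snd c) (fst c) \<and>
        (\<forall>A. openin (mtop M) A \<longrightarrow> open (snd c ` (A \<inter> fst c))) \<and>
        (\<forall>B. open B \<longrightarrow> openin (mtop M) {p \<in> fst c. snd c p \<in> B})" if c: "c \<in> atlas M" for c
  proof -
    have o: "openin (mtop M) (fst c)" "open (snd c ` fst c)"
      and h: "homeomorphic_map (subtopology (mtop M) (fst c)) (top_of_set (snd c ` fst c)) (snd c)"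
      using sm c by auto
    have ts: "topspace (subtopology (mtop M) (fst c)) = fst c"
      using openin_subset[OF o(1)] by (rule topspace_subtopology_subset)
    have "open (snd c ` (A \<inter> fst c))" if "openin (mtop M) A" for A
    proof -
      have "openin (subtopology (mtop M) (fst c)) (A \<inter> fst c)"
        using that by (auto simp: openin_subtopology)
      then have "openin (top_of_set (snd c ` fst c)) (snd c ` (A \<inter> fst c))"
        using homeomorphic_imp_open_map[OF h] by (simp add: open_map_def)
      then show ?thesis using o(2) openin_open_eq by blast
    qed
    moreover have "openin (mtop M) {p \<in> fst c. snd c p \<in> B}" if "open B" for B
    proof -
      have "openin (top_of_set (snd c ` fst c)) (snd c ` fst c \<inter> B)"
        using that by (auto simp: openin_open)
      then have "openin (subtopology (mtop M) (fst c)) {p \<in> fst c. snd c p \<in> snd c ` fst c \<inter> B}"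
        using homeomorphic_imp_continuous_map[OF h] unfolding continuous_map_def ts by blast
      moreover have "{p \<in> fst c. snd c p \<in> snd c ` fst c \<inter> B} = {p \<in> fst c. snd c p \<in> B}" by auto
      ultimately show ?thesis using o(1) by (simp add: openin_open_subtopology)
    qed
    moreover have "inj_on (snd c) (fst c)"
      using homeomorphic_imp_injective_map[OF h] unfolding ts .
    ultimately show ?thesis by blast
  qed
  moreover have "(snd d \<circ> chart_inv c) differentiable (at (snd c p))"
    if "c \<in> atlas M" "d \<in> atlas M" "p \<in> fst c \<inter> fst d" for c d p
    using sm that by (intro smooth_on_imp_differentiable[of "snd c ` (fst c \<inter> fst d)"]) auto
  ultimately show ?thesis
    using sm unfolding differentiable_manifold_def by auto
qed

text \<open>With the reals as a one-chart manifold, \<open>mderiv\<close> becomes an instance of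
  \<open>tmap\<close>, and a single chain rule covers functions as well as maps.\<close>

definition real_line :: "(real, real) manifold" where
  "real_line = \<lparr> mtop = euclidean, atlas = {(UNIV, id)} \<rparr>"

lemma chart_inv_UNIV_id [simp]: "chart_inv (UNIV, id) = id"
  by (rule ext) (simp add: chart_inv_def inv_into_f_f[of id UNIV, simplified])

lemma real_line_simps [simp]:
  "points real_line = UNIV" "mtop real_line = euclidean" "charts_at real_line r = {(UNIV, id)}"
  by (auto simp: real_line_def charts_at_def)

lemma differentiable_manifold_real_line: "differentiable_manifold real_line"
  by (auto simp: differentiable_manifold_def real_line_def) (simp add: id_def)

text \<open>Identities between coordinate expressions hold only near the point,
  \<open>chart_inv\<close> being arbitrary outside the chart image. The two functions have the same
  derivatives at \<open>x\<close>, so the choice inside \<open>frechet_derivative\<close> selects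
  the same one.\<close>

lemma frechet_derivative_cong_nhds:
  assumes "\<forall>\<^sub>F y in nhds x. f y = g y"
  shows "frechet_derivative f (at x) = frechet_derivative g (at x)"
    and "f differentiable (at x) \<longleftrightarrow> g differentiable (at x)"
proof -
  have "(f has_derivative F) (at x) \<longleftrightarrow> (g has_derivative F) (at x)" for F
  proof -
    have ev: "\<forall>\<^sub>F y in at x. f y = g y"
      using assms by (simp add: eventually_at_filter eventually_mono)
    have ev': "\<forall>\<^sub>F y in at x. g y = f y"
      using ev by (rule eventually_mono) simp
    have fg: "f x = g x"
      using assms by (rule eventually_nhds_x_imp_x)
    show ?thesis
      using has_derivative_transform_eventually[OF _ ev fg] has_derivative_transform_eventually[OF _ ev' fg[symmetric]]
      by auto
  qed
  then show "frechet_derivative f (at x) = frechet_derivative g (at x)"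
    "f differentiable (at x) \<longleftrightarrow> g differentiable (at x)"
    by (simp_all add: frechet_derivative_def differentiable_def)
qed

lemma charts_atD:
  assumes "differentiable_manifold M" "c \<in> charts_at M p"
  shows "c \<in> atlas M" "p \<in> fst c" "openin (mtop M) (fst c)" "inj_on (snd c) (fst c)" "p \<in> points M"
    "\<And>p'. p' \<in> fst c \<Longrightarrow> chart_inv c (snd c p') = p'"
    "\<And>A. openin (mtop M) A \<Longrightarrow> open (snd c ` (A \<inter> fst c))"
    "\<And>B. open B \<Longrightarrow> openin (mtop M) {p \<in> fst c. snd c p \<in> B}"
proof -
  show c: "c \<in> atlas M" and p: "p \<in> fst c" using assms(2) unfolding charts_at_def by auto
  show "openin (mtop M) (fst c)" and inj: "inj_on (snd c) (fst c)"
    and "\<And>A. openin (mtop M) A \<Longrightarrow> open (snd c ` (A \<inter> fst c))"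
    and "\<And>B. open B \<Longrightarrow> openin (mtop M) {p \<in> fst c. snd c p \<in> B}"
    using bspec[OF conjunct1[OF conjunct2[OF assms(1)[unfolded differentiable_manifold_def]]] c]
    by simp_all
  show "p \<in> points M"
    using conjunct1[OF assms(1)[unfolded differentiable_manifold_def]] c p by blast
  show "\<And>p'. p' \<in> fst c \<Longrightarrow> chart_inv c (snd c p') = p'"
    using inj unfolding chart_inv_def by (rule inv_into_f_f)
qed

lemma charts_at_nonempty:
  assumes "differentiable_manifold M" "p \<in> points M"
  obtains c where "c \<in> charts_at M p"
proof -
  have "p \<in> (\<Union>c\<in>atlas M. fst c)"
    using assms(2) conjunct1[OF assms(1)[unfolded differentiable_manifold_def]] by simp
  then show thesis using that unfolding charts_at_def by blast
qed

lemma eventually_in_chart: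
  assumes "differentiable_manifold M" "c \<in> charts_at M p" "openin (mtop M) A" "p \<in> A"
    and "\<And>p'. p' \<in> A \<Longrightarrow> p' \<in> fst c \<Longrightarrow> P (snd c p')"
  shows "\<forall>\<^sub>F y in nhds (snd c p). P y"
  unfolding eventually_nhds
proof (intro exI[of _ "snd c ` (A \<inter> fst c)"] conjI ballI)
  show "open (snd c ` (A \<inter> fst c))" using assms(3) by (rule charts_atD(7)[OF assms(1,2)])
  show "snd c p \<in> snd c ` (A \<inter> fst c)" using assms(4) charts_atD(2)[OF assms(1,2)] by blast
qed (use assms(5) in blast)

section \<open>Differentiability at a point and the chain rule in charts\<close>

text \<open>The neighbourhood \<open>A\<close> carries the continuity: as \<open>snd d\<close> is
  arbitrary outside \<open>fst d\<close>, differentiability of the coordinate expression does not by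
  itself keep \<open>f\<close> in the target chart. One pair of charts is enough, by
  \<open>mdiff_at_in_charts\<close>.\<close>

definition mdiff_at ::
  "('a, 'e::real_normed_vector) manifold \<Rightarrow> ('b, 'f::real_normed_vector) manifold
     \<Rightarrow> ('a \<Rightarrow> 'b) \<Rightarrow> 'a \<Rightarrow> bool" where
  "mdiff_at M N f p \<longleftrightarrow>
     (\<exists>c\<in>charts_at M p. \<exists>d\<in>charts_at N (f p). \<exists>A. openin (mtop M) A \<and> p \<in> A \<and> f ` A \<subseteq> fst d \<and>
        (snd d \<circ> f \<circ> chart_inv c) differentiable (at (snd c p)))"

lemma mdiff_atI:
  assumes "c \<in> charts_at M p" "d \<in> charts_at N (f p)" "openin (mtop M) A" "p \<in> A" "f ` A \<subseteq> fst d"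
    and "(snd d \<circ> f \<circ> chart_inv c) differentiable (at (snd c p))"
  shows "mdiff_at M N f p"
  using assms unfolding mdiff_at_def by blast

text \<open>On \<open>A\<close> the coordinates \<open>snd d\<close> and \<open>chart_inv d\<close>
  cancel, so the expression of \<open>g \<circ> f\<close> agrees near the point with a composition
  of two coordinate expressions.\<close>

lemma coordinate_chain_rule:
  assumes M: "differentiable_manifold M" and N: "differentiable_manifold N"
    and c: "c \<in> charts_at M p" and d: "d \<in> charts_at N (f p)"
    and A: "openin (mtop M) A" "p \<in> A" "f ` A \<subseteq> fst d"
    and f: "(snd d \<circ> f \<circ> chart_inv c) differentiable (at (snd c p))"
    and g: "(snd e \<circ> g \<circ> chart_inv d) differentiable (at (snd d (f p)))"
  shows "(snd e \<circ> (g \<circ> f) \<circ> chart_inv c) differentiable (at (snd c p))"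
    and "frechet_derivative (snd e \<circ> (g \<circ> f) \<circ> chart_inv c) (at (snd c p)) =
      frechet_derivative (snd e \<circ> g \<circ> chart_inv d) (at (snd d (f p))) \<circ>
      frechet_derivative (snd d \<circ> f \<circ> chart_inv c) (at (snd c p))"
proof -
  have ev: "\<forall>\<^sub>F y in nhds (snd c p). (snd e \<circ> (g \<circ> f) \<circ> chart_inv c) y =
      ((snd e \<circ> g \<circ> chart_inv d) \<circ> (snd d \<circ> f \<circ> chart_inv c)) y"
    by (rule eventually_in_chart[OF M c A(1,2)])
      (use charts_atD(6)[OF M c] charts_atD(6)[OF N d] A(3) in auto)
  have pt: "(snd d \<circ> f \<circ> chart_inv c) (snd c p) = snd d (f p)"
    using charts_atD(2,6)[OF M c] by simp
  note g' = g[folded pt]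
  show "(snd e \<circ> (g \<circ> f) \<circ> chart_inv c) differentiable (at (snd c p))"
    unfolding frechet_derivative_cong_nhds(2)[OF ev] using f g' by (rule differentiable_chain_at)
  show "frechet_derivative (snd e \<circ> (g \<circ> f) \<circ> chart_inv c) (at (snd c p)) =
      frechet_derivative (snd e \<circ> g \<circ> chart_inv d) (at (snd d (f p))) \<circ>
      frechet_derivative (snd d \<circ> f \<circ> chart_inv c) (at (snd c p))"
    unfolding frechet_derivative_cong_nhds(1)[OF ev] frechet_derivative_compose[OF f g'] pt ..
qed

lemma transition_differentiable:
  assumes "differentiable_manifold M" "c \<in> charts_at M p" "d \<in> charts_at M p"
  shows "(snd d \<circ> id \<circ> chart_inv c) differentiable (at (snd c p))"
  using assms(2,3) conjunct2[OF conjunct2[OF assms(1)[unfolded differentiable_manifold_def]]]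
  unfolding charts_at_def comp_id by blast

lemma mdiff_at_imp_continuous:
  assumes M: "differentiable_manifold M" and N: "differentiable_manifold N" and f: "mdiff_at M N f p"
    and B: "openin (mtop N) B" "f p \<in> B"
  obtains A where "openin (mtop M) A" "p \<in> A" "f ` A \<subseteq> B"
proof -
  obtain c d A where cd: "c \<in> charts_at M p" "d \<in> charts_at N (f p)" "openin (mtop M) A" "p \<in> A"
    "f ` A \<subseteq> fst d"
    and df: "(snd d \<circ> f \<circ> chart_inv c) differentiable (at (snd c p))"
    using f unfolding mdiff_at_def by blast
  note c = charts_atD[OF M cd(1)] and d = charts_atD[OF N cd(2)]
  define F where "F = snd d \<circ> f \<circ> chart_inv c"
  have cont: "isCont F (snd c p)"
    using df unfolding F_def by (rule differentiable_imp_continuous_within)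
  have "open (snd d ` (B \<inter> fst d))" using d(7) B(1) .
  moreover have "F (snd c p) = snd d (f p)" unfolding F_def using c(6)[OF c(2)] by simp
  then have "F (snd c p) \<in> snd d ` (B \<inter> fst d)" using d(2) B(2) by blast
  ultimately obtain O' where O': "open O'" "snd c p \<in> O'" "\<And>y. y \<in> O' \<Longrightarrow> F y \<in> snd d ` (B \<inter> fst d)"
    using cont[unfolded continuous_at_open, rule_format, of "snd d ` (B \<inter> fst d)"] by blast
  show thesis
  \<comment> \<open>Intersecting with \<open>A\<close> ensures that \<open>f p'\<close> lies in the
    chart \<open>d\<close>; only there does injectivity let the coordinates of \<open>f p'\<close>
    decide that it belongs to \<open>B\<close>.\<close>
  proof (rule that[of "A \<inter> {p' \<in> fst c. snd c p' \<in> O'}"])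
    show "openin (mtop M) (A \<inter> {p' \<in> fst c. snd c p' \<in> O'})"
      using cd(3) c(8)[OF O'(1)] by (rule openin_Int)
    show "p \<in> A \<inter> {p' \<in> fst c. snd c p' \<in> O'}" using cd(4) c(2) O'(2) by blast
    show "f ` (A \<inter> {p' \<in> fst c. snd c p' \<in> O'}) \<subseteq> B"
    proof
      fix z assume "z \<in> f ` (A \<inter> {p' \<in> fst c. snd c p' \<in> O'})"
      then obtain p' where p': "p' \<in> A" "p' \<in> fst c" "snd c p' \<in> O'" "z = f p'" by blast
      then have "snd d (f p') \<in> snd d ` (B \<inter> fst d)"
        using O'(3)[OF p'(3)] c(6)[OF p'(2)] unfolding F_def by simp
      moreover have "f p' \<in> fst d" using p'(1) cd(5) by blast
      ultimately show "z \<in> B" using d(4) p'(4) by (auto dest: inj_onD)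
    qed
  qed
qed

lemma mdiff_at_points:
  assumes "differentiable_manifold M" "differentiable_manifold N" "mdiff_at M N f p"
  shows "p \<in> points M" "f p \<in> points N"
proof -
  obtain c d where "c \<in> charts_at M p" "d \<in> charts_at N (f p)"
    using assms(3) unfolding mdiff_at_def by blast
  from charts_atD(5)[OF assms(1) this(1)] charts_atD(5)[OF assms(2) this(2)]
  show "p \<in> points M" "f p \<in> points N" .
qed

text \<open>Compose on both sides with transition maps, which are the coordinate expressions of
  \<open>id\<close>.\<close>

lemma mdiff_at_in_charts:
  assumes M: "differentiable_manifold M" and N: "differentiable_manifold N" and f: "mdiff_at M N f p"
    and c: "c \<in> charts_at M p" and d: "d \<in> charts_at N (f p)"
  shows "(snd d \<circ> f \<circ> chart_inv c) differentiable (at (snd c p))"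
proof -
  obtain c' d' A where cd: "c' \<in> charts_at M p" "d' \<in> charts_at N (f p)" "openin (mtop M) A" "p \<in> A"
    "f ` A \<subseteq> fst d'"
    and df: "(snd d' \<circ> f \<circ> chart_inv c') differentiable (at (snd c' p))"
    using f unfolding mdiff_at_def by blast
  have "(snd d' \<circ> (f \<circ> id) \<circ> chart_inv c) differentiable (at (snd c p))"
    by (rule coordinate_chain_rule(1)[OF M M c, where A = "fst c'" and d = c'])
      (use cd(1) df transition_differentiable[OF M c cd(1)] charts_atD(2,3)[OF M cd(1)] in auto)
  then have "(snd d \<circ> (id \<circ> f) \<circ> chart_inv c) differentiable (at (snd c p))"
    by (intro coordinate_chain_rule(1)[OF M N c cd(2-5) _ transition_differentiable[OF N cd(2) d]]) simp
  then show ?thesis by simp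
qed

lemma mdiff_at_chain:
  assumes M: "differentiable_manifold M" and N: "differentiable_manifold N" and K: "differentiable_manifold K"
    and f: "mdiff_at M N f p" and g: "mdiff_at N K g (f p)"
  shows "mdiff_at M K (g \<circ> f) p"
    and "\<And>c d e. \<lbrakk>c \<in> charts_at M p; d \<in> charts_at N (f p); e \<in> charts_at K (g (f p))\<rbrakk> \<Longrightarrow>
      frechet_derivative (snd e \<circ> (g \<circ> f) \<circ> chart_inv c) (at (snd c p)) =
      frechet_derivative (snd e \<circ> g \<circ> chart_inv d) (at (snd d (f p))) \<circ>
      frechet_derivative (snd d \<circ> f \<circ> chart_inv c) (at (snd c p))"
proof -
  have *: "(snd e \<circ> (g \<circ> f) \<circ> chart_inv c) differentiable (at (snd c p)) \<and>
      frechet_derivative (snd e \<circ> (g \<circ> f) \<circ> chart_inv c) (at (snd c p)) =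
      frechet_derivative (snd e \<circ> g \<circ> chart_inv d) (at (snd d (f p))) \<circ>
      frechet_derivative (snd d \<circ> f \<circ> chart_inv c) (at (snd c p))"
    if c: "c \<in> charts_at M p" and d: "d \<in> charts_at N (f p)" and e: "e \<in> charts_at K (g (f p))" for c d e
  proof -
    obtain A where A: "openin (mtop M) A" "p \<in> A" "f ` A \<subseteq> fst d"
      using mdiff_at_imp_continuous[OF M N f charts_atD(3,2)[OF N d]] .
    show ?thesis
      using coordinate_chain_rule[OF M N c d A mdiff_at_in_charts[OF M N f c d] mdiff_at_in_charts[OF N K g d e]]
      by blast
  qed
  then show "\<And>c d e. \<lbrakk>c \<in> charts_at M p; d \<in> charts_at N (f p); e \<in> charts_at K (g (f p))\<rbrakk> \<Longrightarrow>
      frechet_derivative (snd e \<circ> (g \<circ> f) \<circ> chart_inv c) (at (snd c p)) =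
      frechet_derivative (snd e \<circ> g \<circ> chart_inv d) (at (snd d (f p))) \<circ>
      frechet_derivative (snd d \<circ> f \<circ> chart_inv c) (at (snd c p))" by blast
  obtain c where c: "c \<in> charts_at M p" using charts_at_nonempty[OF M mdiff_at_points(1)[OF M N f]] .
  obtain d where d: "d \<in> charts_at N (f p)" using charts_at_nonempty[OF N mdiff_at_points(2)[OF M N f]] .
  obtain e where e: "e \<in> charts_at K (g (f p))" using charts_at_nonempty[OF K mdiff_at_points(2)[OF N K g]] .
  obtain B where B: "openin (mtop N) B" "f p \<in> B" "g ` B \<subseteq> fst e"
    using mdiff_at_imp_continuous[OF N K g charts_atD(3,2)[OF K e]] .
  obtain A where A: "openin (mtop M) A" "p \<in> A" "f ` A \<subseteq> B"
    using mdiff_at_imp_continuous[OF M N f B(1,2)] .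
  have "(g \<circ> f) ` A \<subseteq> fst e" using A(3) B(3) by auto
  with * [OF c d e] c e A(1,2) show "mdiff_at M K (g \<circ> f) p"
    unfolding mdiff_at_def by (intro bexI[of _ c] bexI[of _ e] exI[of _ A]) auto
qed

lemma mdiff_at_id:
  assumes M: "differentiable_manifold M" and "p \<in> points M"
  shows "mdiff_at M M id p"
proof -
  obtain c where c: "c \<in> charts_at M p" using charts_at_nonempty[OF assms] .
  show ?thesis
    unfolding mdiff_at_def using c charts_atD(2,3)[OF M c] transition_differentiable[OF M c c]
    by (intro bexI[of _ c] exI[of _ "fst c"]) auto
qed

lemma mdiff_at_cong:
  assumes M: "differentiable_manifold M" and f: "mdiff_at M N f p"
    and A: "openin (mtop M) A" "p \<in> A" "\<And>p'. p' \<in> A \<Longrightarrow> f p' = g p'"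
  shows "mdiff_at M N g p"
proof -
  obtain c d A' where cd: "c \<in> charts_at M p" "d \<in> charts_at N (f p)" "openin (mtop M) A'" "p \<in> A'"
    "f ` A' \<subseteq> fst d"
    and df: "(snd d \<circ> f \<circ> chart_inv c) differentiable (at (snd c p))"
    using f unfolding mdiff_at_def by blast
  have "\<forall>\<^sub>F y in nhds (snd c p). (snd d \<circ> f \<circ> chart_inv c) y = (snd d \<circ> g \<circ> chart_inv c) y"
    by (rule eventually_in_chart[OF M cd(1) A(1,2)]) (use charts_atD(6)[OF M cd(1)] A(3) in auto)
  from frechet_derivative_cong_nhds(2)[OF this] df
  have "(snd d \<circ> g \<circ> chart_inv c) differentiable (at (snd c p))" by blast
  moreover have "openin (mtop M) (A \<inter> A')" "p \<in> A \<inter> A'" "g ` (A \<inter> A') \<subseteq> fst d" "d \<in> charts_at N (g p)"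
    using A cd by (auto intro: openin_Int)
  ultimately show ?thesis
    unfolding mdiff_at_def using cd(1) by blast
qed

lemma smooth_map_imp_mdiff_at:
  assumes M: "differentiable_manifold M" and N: "differentiable_manifold N"
    and f: "smooth_map M N W f" and p: "p \<in> W"
  shows "mdiff_at M N f p"
proof -
  have W: "openin (mtop M) W" and cont: "continuous_map (subtopology (mtop M) W) (mtop N) f"
    using f unfolding smooth_map_def by auto
  have WM: "W \<subseteq> points M" using W by (rule openin_subset)
  have ts: "topspace (subtopology (mtop M) W) = W" using WM by (rule topspace_subtopology_subset)
  obtain c where c: "c \<in> charts_at M p" using charts_at_nonempty[OF M] WM p by blast
  have "f p \<in> points N" using cont p ts unfolding continuous_map_def by blast
  then obtain d where d: "d \<in> charts_at N (f p)" using charts_at_nonempty[OF N] by blast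
  have "openin (subtopology (mtop M) W) {x \<in> W. f x \<in> fst d}"
    using cont charts_atD(3)[OF N d] unfolding continuous_map_def ts by blast
  then have A: "openin (mtop M) {x \<in> W. f x \<in> fst d}"
    using W by (simp add: openin_open_subtopology)
  have "(snd d \<circ> f \<circ> chart_inv c) differentiable (at (snd c p))"
    by (rule smooth_on_imp_differentiable[of "snd c ` {p \<in> fst c \<inter> W. f p \<in> fst d}"])
      (use f charts_atD(1,2)[OF M c] charts_atD(1,2)[OF N d] p in \<open>auto simp: smooth_map_def\<close>)
  then show ?thesis
    unfolding mdiff_at_def using c d A p charts_atD(2)[OF N d]
    by (intro bexI[of _ c] bexI[of _ d] exI[of _ "{x \<in> W. f x \<in> fst d}"]) auto
qed

lemma smooth_fun_imp_mdiff_at: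
  assumes M: "differentiable_manifold M" and f: "smooth_fun M W f" and p: "p \<in> W"
  shows "mdiff_at M real_line f p"
proof -
  have W: "openin (mtop M) W" using f unfolding smooth_fun_def by auto
  obtain c where c: "c \<in> charts_at M p"
    using charts_at_nonempty[OF M] openin_subset[OF W] p by blast
  have "(f \<circ> chart_inv c) differentiable (at (snd c p))"
    by (rule smooth_on_imp_differentiable[of "snd c ` (fst c \<inter> W)"])
      (use f charts_atD(1,2)[OF M c] p in \<open>auto simp: smooth_fun_def\<close>)
  then show ?thesis
    unfolding mdiff_at_def using c W p by (intro bexI[of _ c] exI[of _ W]) auto
qed

lemma mdiff_at_const:
  assumes M: "differentiable_manifold M" and N: "differentiable_manifold N"
    and "p \<in> points M" "y \<in> points N"
  shows "mdiff_at M N (\<lambda>_. y) p"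
proof -
  obtain c where c: "c \<in> charts_at M p" using charts_at_nonempty[OF M assms(3)] .
  obtain d where d: "d \<in> charts_at N y" using charts_at_nonempty[OF N assms(4)] .
  have "(snd d \<circ> (\<lambda>_. y) \<circ> chart_inv c) differentiable (at (snd c p))"
    by (simp add: comp_def)
  then show ?thesis
    unfolding mdiff_at_def using c d assms(3) charts_atD(2)[OF N d]
    by (intro bexI[of _ c] bexI[of _ d] exI[of _ "points M"]) auto
qed

lemma frechet_derivative_id_chart:
  assumes M: "differentiable_manifold M" and c: "c \<in> charts_at M p"
  shows "frechet_derivative (snd c \<circ> id \<circ> chart_inv c) (at (snd c p)) = id"
proof -
  have "\<forall>\<^sub>F y in nhds (snd c p). (snd c \<circ> id \<circ> chart_inv c) y = id y"
    by (rule eventually_in_chart[OF M c charts_atD(3,2)[OF M c]]) (simp add: charts_atD(6)[OF M c])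
  then show ?thesis
    by (simp only: frechet_derivative_cong_nhds(1) frechet_derivative_id)
qed

text \<open>The chain rule for \<open>id \<circ> id\<close>. Writing transition maps with an
  explicit \<open>id\<close> makes them coordinate expressions to which that rule applies as it
  stands.\<close>

lemma transition_cocycle:
  assumes M: "differentiable_manifold M"
    and "c \<in> charts_at M p" "d \<in> charts_at M p" "e \<in> charts_at M p"
  shows "frechet_derivative (snd e \<circ> id \<circ> chart_inv c) (at (snd c p)) =
    frechet_derivative (snd e \<circ> id \<circ> chart_inv d) (at (snd d p)) \<circ>
    frechet_derivative (snd d \<circ> id \<circ> chart_inv c) (at (snd c p))"
proof -
  have id: "mdiff_at M M id p" "mdiff_at M M id (id p)"
    using mdiff_at_id[OF M charts_atD(5)[OF M assms(2)]] by simp_all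
  have "frechet_derivative (snd e \<circ> (id \<circ> id) \<circ> chart_inv c) (at (snd c p)) =
    frechet_derivative (snd e \<circ> id \<circ> chart_inv d) (at (snd d (id p))) \<circ>
    frechet_derivative (snd d \<circ> id \<circ> chart_inv c) (at (snd c p))"
    by (rule mdiff_at_chain(2)[OF M M M id(1), OF id(2)]) (use assms(2-4) in simp_all)
  then show ?thesis by (simp only: comp_id id_apply)
qed

section \<open>Tangent spaces and functoriality of the tangent map\<close>

lemma tangent_spaceD:
  assumes "v \<in> tangent_space M p"
  shows "c \<notin> charts_at M p \<Longrightarrow> v c = 0"
    and "c \<in> charts_at M p \<Longrightarrow> d \<in> charts_at M p \<Longrightarrow>
      v d = frechet_derivative (snd d \<circ> id \<circ> chart_inv c) (at (snd c p)) (v c)"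
  using assms unfolding tangent_space_def comp_id by blast+

lemma tangent_spaceI:
  assumes "\<And>c. c \<notin> charts_at M p \<Longrightarrow> v c = 0"
    and "\<And>c d. c \<in> charts_at M p \<Longrightarrow> d \<in> charts_at M p \<Longrightarrow>
      v d = frechet_derivative (snd d \<circ> id \<circ> chart_inv c) (at (snd c p)) (v c)"
  shows "v \<in> tangent_space M p"
  using assms unfolding tangent_space_def comp_id by blast

text \<open>One representative determines all others through the transition derivatives, so
  equations between tangent vectors can be checked in a single chart.\<close>

lemma tangent_eqI:
  assumes "u \<in> tangent_space M p" "v \<in> tangent_space M p" "c \<in> charts_at M p" "u c = v c"
  shows "u = v"
proof
  fix d
  show "u d = v d"
    using tangent_spaceD[OF assms(1)] tangent_spaceD[OF assms(2)] assms(3,4)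
    by (cases "d \<in> charts_at M p") metis+
qed

text \<open>The cocycle law is what makes the family of transported coordinate vectors
  consistent.\<close>

lemma tvec_of_tangent:
  assumes M: "differentiable_manifold M" and c: "c \<in> charts_at M p"
  shows "tvec_of M c p e \<in> tangent_space M p" "tvec_of M c p e c = e"
proof -
  have tv: "tvec_of M c p e d = frechet_derivative (snd d \<circ> id \<circ> chart_inv c) (at (snd c p)) e"
    if "d \<in> charts_at M p" for d
    using that unfolding tvec_of_def comp_id by simp
  show "tvec_of M c p e \<in> tangent_space M p"
  proof (rule tangent_spaceI)
    show "tvec_of M c p e d = 0" if "d \<notin> charts_at M p" for d
      using that unfolding tvec_of_def by simp
    show "tvec_of M c p e d' = frechet_derivative (snd d' \<circ> id \<circ> chart_inv d) (at (snd d p)) (tvec_of M c p e d)"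
      if "d \<in> charts_at M p" "d' \<in> charts_at M p" for d d'
      unfolding tv[OF that(1)] tv[OF that(2)] transition_cocycle[OF M c that] by simp
  qed
  show "tvec_of M c p e c = e"
    unfolding tv[OF c] frechet_derivative_id_chart[OF M c] by simp
qed

lemma frechet_derivative_linear:
  assumes "f differentiable (at x)"
  shows "linear (frechet_derivative f (at x))"
  using assms frechet_derivative_works has_derivative_linear by blast

lemma tzero_tangent:
  assumes "differentiable_manifold M"
  shows "tzero \<in> tangent_space M p"
  by (rule tangent_spaceI)
    (simp_all only: tzero_def linear_0[OF frechet_derivative_linear[OF transition_differentiable[OF assms]]])

lemma tadd_tangent:
  assumes "differentiable_manifold M" "u \<in> tangent_space M p" "v \<in> tangent_space M p"
  shows "tadd u v \<in> tangent_space M p"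
proof (rule tangent_spaceI)
  show "tadd u v c = 0" if "c \<notin> charts_at M p" for c
    using tangent_spaceD(1)[OF assms(2) that] tangent_spaceD(1)[OF assms(3) that] by (simp add: tadd_def)
  show "tadd u v d = frechet_derivative (snd d \<circ> id \<circ> chart_inv c) (at (snd c p)) (tadd u v c)"
    if "c \<in> charts_at M p" "d \<in> charts_at M p" for c d
    unfolding tadd_def linear_add[OF frechet_derivative_linear[OF transition_differentiable[OF assms(1) that]]]
    by (simp only: tangent_spaceD(2)[OF assms(2) that] tangent_spaceD(2)[OF assms(3) that])
qed

lemma tscale_tangent:
  assumes "differentiable_manifold M" "v \<in> tangent_space M p"
  shows "tscale r v \<in> tangent_space M p"
proof (rule tangent_spaceI)
  show "tscale r v c = 0" if "c \<notin> charts_at M p" for c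
    using tangent_spaceD(1)[OF assms(2) that] by (simp add: tscale_def)
  show "tscale r v d = frechet_derivative (snd d \<circ> id \<circ> chart_inv c) (at (snd c p)) (tscale r v c)"
    if "c \<in> charts_at M p" "d \<in> charts_at M p" for c d
    unfolding tscale_def linear_scale[OF frechet_derivative_linear[OF transition_differentiable[OF assms(1) that]]]
    by (simp only: tangent_spaceD(2)[OF assms(2) that])
qed

text \<open>Tangent vectors are zero on foreign charts by convention; this is the corresponding half
  of showing that \<open>tmap\<close> lands in a tangent space.\<close>

lemma tmap_outside: "d \<notin> charts_at N (f p) \<Longrightarrow> tmap M N f p v d = 0"
  by (simp add: tmap_def Let_def)

text \<open>Removes the choice of chart in \<open>tmap\<close>: the chain rule for
  \<open>f \<circ> id\<close> carries the formula from the chosen chart to \<open>c\<close>.\<close>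

lemma tmap_in_charts:
  assumes M: "differentiable_manifold M" and N: "differentiable_manifold N" and f: "mdiff_at M N f p"
    and v: "v \<in> tangent_space M p" and c: "c \<in> charts_at M p" and d: "d \<in> charts_at N (f p)"
  shows "tmap M N f p v d = frechet_derivative (snd d \<circ> f \<circ> chart_inv c) (at (snd c p)) (v c)"
proof -
  define c0 where "c0 = (SOME c. c \<in> charts_at M p)"
  have c0: "c0 \<in> charts_at M p" unfolding c0_def using c by (rule someI)
  have id: "mdiff_at M M id p" using mdiff_at_id[OF M mdiff_at_points(1)[OF M N f]] .
  have f': "mdiff_at M N f (id p)" using f by simp
  have "tmap M N f p v d = frechet_derivative (snd d \<circ> (f \<circ> id) \<circ> chart_inv c0) (at (snd c0 p)) (v c0)"
    using d by (simp add: tmap_def c0_def Let_def)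
  also have "\<dots> = frechet_derivative (snd d \<circ> f \<circ> chart_inv c) (at (snd c p))
      (frechet_derivative (snd c \<circ> id \<circ> chart_inv c0) (at (snd c0 p)) (v c0))"
    using mdiff_at_chain(2)[OF M M N id, OF f', of c0 c d] c0 c d by simp
  also have "\<dots> = frechet_derivative (snd d \<circ> f \<circ> chart_inv c) (at (snd c p)) (v c)"
    by (simp only: tangent_spaceD(2)[OF v c0 c])
  finally show ?thesis .
qed

lemma tmap_tangent:
  assumes M: "differentiable_manifold M" and N: "differentiable_manifold N" and f: "mdiff_at M N f p"
    and v: "v \<in> tangent_space M p"
  shows "tmap M N f p v \<in> tangent_space N (f p)"
proof (rule tangent_spaceI)
  obtain c where c: "c \<in> charts_at M p" using charts_at_nonempty[OF M mdiff_at_points(1)[OF M N f]] .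
  have id: "mdiff_at N N id (f p)" using mdiff_at_id[OF N mdiff_at_points(2)[OF M N f]] .
  show "tmap M N f p v d' = frechet_derivative (snd d' \<circ> id \<circ> chart_inv d) (at (snd d (f p))) (tmap M N f p v d)"
    if d: "d \<in> charts_at N (f p)" and d': "d' \<in> charts_at N (f p)" for d d'
    unfolding tmap_in_charts[OF M N f v c d] tmap_in_charts[OF M N f v c d']
    using mdiff_at_chain(2)[OF M N N f, OF id c d, of d'] d' by (simp add: o_def)
qed (rule tmap_outside)

lemma tmap_comp:
  assumes M: "differentiable_manifold M" and N: "differentiable_manifold N" and K: "differentiable_manifold K"
    and f: "mdiff_at M N f p" and g: "mdiff_at N K g (f p)" and v: "v \<in> tangent_space M p"
  shows "tmap M K (g \<circ> f) p v = tmap N K g (f p) (tmap M N f p v)"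
proof
  fix e
  obtain c where c: "c \<in> charts_at M p" using charts_at_nonempty[OF M mdiff_at_points(1)[OF M N f]] .
  obtain d where d: "d \<in> charts_at N (f p)" using charts_at_nonempty[OF N mdiff_at_points(2)[OF M N f]] .
  show "tmap M K (g \<circ> f) p v e = tmap N K g (f p) (tmap M N f p v) e"
  proof (cases "e \<in> charts_at K (g (f p))")
    case True
    then have True': "e \<in> charts_at K ((g \<circ> f) p)" by simp
    show ?thesis
      unfolding tmap_in_charts[OF M K mdiff_at_chain(1)[OF M N K f, OF g] v c True']
        tmap_in_charts[OF N K g tmap_tangent[OF M N f v] d True] tmap_in_charts[OF M N f v c d]
        mdiff_at_chain(2)[OF M N K f, OF g c d True] by simp
  qed (simp add: tmap_outside)
qed

lemma tmap_cong:
  assumes M: "differentiable_manifold M"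
    and A: "openin (mtop M) A" "p \<in> A" "\<And>p'. p' \<in> A \<Longrightarrow> f p' = g p'"
  shows "tmap M N f p v = tmap M N g p v"
proof -
  define c where "c = (SOME c. c \<in> charts_at M p)"
  obtain c' where "c' \<in> charts_at M p"
    using charts_at_nonempty[OF M] openin_subset[OF A(1)] A(2) by blast
  then have c: "c \<in> charts_at M p" unfolding c_def by (rule someI)
  have "\<forall>\<^sub>F y in nhds (snd c p). (snd d \<circ> f \<circ> chart_inv c) y = (snd d \<circ> g \<circ> chart_inv c) y" for d :: "('c, 'd) chart"
    by (rule eventually_in_chart[OF M c A(1,2)]) (use charts_atD(6)[OF M c] A(3) in auto)
  from frechet_derivative_cong_nhds(1)[OF this] show ?thesis
    unfolding tmap_def c_def[symmetric] A(3)[OF A(2)] Let_def by (simp only:)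
qed

lemma tmap_id:
  assumes M: "differentiable_manifold M" and p: "p \<in> points M" and v: "v \<in> tangent_space M p"
  shows "tmap M M id p v = v"
proof -
  obtain c where c: "c \<in> charts_at M p" using charts_at_nonempty[OF M p] .
  have id: "mdiff_at M M id p" using mdiff_at_id[OF M p] .
  have "tmap M M id p v c = v c"
    using tmap_in_charts[OF M M id v c, of c] c by (simp add: frechet_derivative_id_chart[OF M c, simplified])
  moreover have "tmap M M id p v \<in> tangent_space M p" using tmap_tangent[OF M M id v] by simp
  ultimately show ?thesis by (intro tangent_eqI[OF _ v c])
qed

lemma tmap_linear:
  assumes M: "differentiable_manifold M" and N: "differentiable_manifold N" and f: "mdiff_at M N f p"
    and u: "u \<in> tangent_space M p" and v: "v \<in> tangent_space M p"
  shows "tmap M N f p (tadd u v) = tadd (tmap M N f p u) (tmap M N f p v)"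
    and "tmap M N f p (tscale r v) = tscale r (tmap M N f p v)"
    and "tmap M N f p tzero = tzero"
proof -
  obtain c where c: "c \<in> charts_at M p" using charts_at_nonempty[OF M mdiff_at_points(1)[OF M N f]] .
  obtain d where d: "d \<in> charts_at N (f p)" using charts_at_nonempty[OF N mdiff_at_points(2)[OF M N f]] .
  note T = tmap_in_charts[OF M N f _ c d] and lin = frechet_derivative_linear[OF mdiff_at_in_charts[OF M N f c d]]
  note tan = tmap_tangent[OF M N f] and sums = tadd_tangent[OF M u v] tscale_tangent[OF M v] tzero_tangent[OF M]
  show "tmap M N f p (tadd u v) = tadd (tmap M N f p u) (tmap M N f p v)"
    by (rule tangent_eqI[OF tan[OF sums(1)] tadd_tangent[OF N tan[OF u] tan[OF v]] d])
      (subst T[OF sums(1)], simp add: T[OF u] T[OF v] tadd_def linear_add[OF lin])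
  show "tmap M N f p (tscale r v) = tscale r (tmap M N f p v)"
    by (rule tangent_eqI[OF tan[OF sums(2)] tscale_tangent[OF N tan[OF v]] d])
      (subst T[OF sums(2)], simp add: T[OF v] tscale_def linear_scale[OF lin])
  show "tmap M N f p tzero = tzero"
    by (rule tangent_eqI[OF tan[OF sums(3)] tzero_tangent[OF N] d])
      (subst T[OF sums(3)], simp add: tzero_def linear_0[OF lin])
qed

lemma tmap_const:
  assumes M: "differentiable_manifold M" and N: "differentiable_manifold N"
    and p: "p \<in> points M" and y: "y \<in> points N" and v: "v \<in> tangent_space M p"
  shows "tmap M N (\<lambda>_. y) p v = tzero"
proof -
  obtain c where c: "c \<in> charts_at M p" using charts_at_nonempty[OF M p] .
  obtain d where d: "d \<in> charts_at N y" using charts_at_nonempty[OF N y] .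
  note f = mdiff_at_const[OF M N p y]
  have "tmap M N (\<lambda>_. y) p v d = 0"
    unfolding tmap_in_charts[OF M N f v c d] by (simp add: comp_def)
  then show ?thesis
    by (intro tangent_eqI[OF tmap_tangent[OF M N f v] tzero_tangent[OF N] d]) (simp add: tzero_def)
qed

lemma mderiv_eq_tmap: "mderiv M f p v = tmap M real_line f p v (UNIV, id)"
  by (simp add: mderiv_def tmap_def Let_def)

section \<open>Product manifolds\<close>

lemma prod_chart_in_atlas:
  assumes "c \<in> atlas M" "d \<in> atlas N"
  shows "(fst c \<times> fst d, map_prod (snd c) (snd d)) \<in> atlas (prod_manifold M N)"
  using assms unfolding prod_manifold_def manifold.simps by blast

lemma charts_at_prod:
  "charts_at (prod_manifold M N) (p, q) =
    {(fst c \<times> fst d, map_prod (snd c) (snd d)) |c d. c \<in> charts_at M p \<and> d \<in> charts_at N q}"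
proof (intro equalityI subsetI)
  fix e assume "e \<in> charts_at (prod_manifold M N) (p, q)"
  then obtain c d where "c \<in> atlas M" "d \<in> atlas N" "e = (fst c \<times> fst d, map_prod (snd c) (snd d))"
    "(p, q) \<in> fst c \<times> fst d"
    unfolding charts_at_def prod_manifold_def by auto
  then show "e \<in> {(fst c \<times> fst d, map_prod (snd c) (snd d)) |c d. c \<in> charts_at M p \<and> d \<in> charts_at N q}"
    unfolding charts_at_def by blast
next
  fix e assume "e \<in> {(fst c \<times> fst d, map_prod (snd c) (snd d)) |c d. c \<in> charts_at M p \<and> d \<in> charts_at N q}"
  then show "e \<in> charts_at (prod_manifold M N) (p, q)"
    unfolding charts_at_def prod_manifold_def by auto
qed

lemma mtop_prod_manifold [simp]: "mtop (prod_manifold M N) = prod_topology (mtop M) (mtop N)"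
  by (simp add: prod_manifold_def)

lemma chart_inv_prod:
  assumes M: "differentiable_manifold M" and N: "differentiable_manifold N"
    and c: "c \<in> charts_at M p" and d: "d \<in> charts_at N q"
  shows "chart_inv (fst c \<times> fst d, map_prod (snd c) (snd d)) (snd c p, snd d q) = (p, q)"
proof -
  have "inj_on (map_prod (snd c) (snd d)) (fst c \<times> fst d)"
    by (rule map_prod_inj_on[OF charts_atD(4)[OF M c] charts_atD(4)[OF N d]])
  moreover have "(p, q) \<in> fst c \<times> fst d"
    using charts_atD(2)[OF M c] charts_atD(2)[OF N d] by simp
  ultimately have "inv_into (fst c \<times> fst d) (map_prod (snd c) (snd d)) (map_prod (snd c) (snd d) (p, q)) = (p, q)"
    by (rule inv_into_f_f)
  then show ?thesis by (simp add: chart_inv_def)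
qed

lemma eventually_in_prod_chart:
  assumes M: "differentiable_manifold M" and N: "differentiable_manifold N"
    and c: "c \<in> charts_at M p" and d: "d \<in> charts_at N q"
    and P: "\<And>p' q'. c \<in> charts_at M p' \<Longrightarrow> d \<in> charts_at N q' \<Longrightarrow> P (snd c p', snd d q')"
  shows "\<forall>\<^sub>F y in nhds (snd c p, snd d q). P y"
  unfolding eventually_nhds
proof (intro exI conjI ballI)
  have "open (snd c ` (fst c \<inter> fst c))" "open (snd d ` (fst d \<inter> fst d))"
    using charts_atD(7,3)[OF M c] charts_atD(7,3)[OF N d] by blast+
  then show "open ((snd c ` fst c) \<times> (snd d ` fst d))" by (simp add: open_Times)
  show "(snd c p, snd d q) \<in> (snd c ` fst c) \<times> (snd d ` fst d)"
    using charts_atD(2)[OF M c] charts_atD(2)[OF N d] by simp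
  fix y assume "y \<in> (snd c ` fst c) \<times> (snd d ` fst d)"
  then obtain p' q' where "p' \<in> fst c" "q' \<in> fst d" "y = (snd c p', snd d q')" by blast
  then show "P y" using P c d by (simp add: charts_at_def)
qed

text \<open>Openness is checked on boxes in both directions, and near the point a transition map of
  product charts is the pair of the transition maps of the factors.\<close>

lemma differentiable_manifold_prod:
  fixes M :: "('a, 'e::real_normed_vector) manifold" and N :: "('b, 'f::real_normed_vector) manifold"
  assumes M: "differentiable_manifold M" and N: "differentiable_manifold N"
  shows "differentiable_manifold (prod_manifold M N)"
  unfolding differentiable_manifold_def
proof (intro conjI ballI)
  have "(\<Union>c\<in>atlas M. fst c) = points M" "(\<Union>c\<in>atlas N. fst c) = points N"
    using M N unfolding differentiable_manifold_def by simp_all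
  moreover have "(\<Union>e\<in>atlas (prod_manifold M N). fst e) = (\<Union>c\<in>atlas M. fst c) \<times> (\<Union>d\<in>atlas N. fst d)"
  proof (intro equalityI subsetI)
    fix x assume "x \<in> (\<Union>e\<in>atlas (prod_manifold M N). fst e)"
    then obtain c d where "c \<in> atlas M" "d \<in> atlas N" "x \<in> fst c \<times> fst d"
      unfolding prod_manifold_def by auto
    then show "x \<in> (\<Union>c\<in>atlas M. fst c) \<times> (\<Union>d\<in>atlas N. fst d)" by blast
  next
    fix x assume "x \<in> (\<Union>c\<in>atlas M. fst c) \<times> (\<Union>d\<in>atlas N. fst d)"
    then obtain c d where "c \<in> atlas M" "d \<in> atlas N" "x \<in> fst c \<times> fst d" by blast
    then show "x \<in> (\<Union>e\<in>atlas (prod_manifold M N). fst e)"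
      by (intro UN_I[OF prod_chart_in_atlas]) auto
  qed
  ultimately show "(\<Union>e\<in>atlas (prod_manifold M N). fst e) = points (prod_manifold M N)"
    by simp
next
  fix e assume "e \<in> atlas (prod_manifold M N)"
  then obtain c d where cd: "c \<in> atlas M" "d \<in> atlas N" "e = (fst c \<times> fst d, map_prod (snd c) (snd d))"
    unfolding prod_manifold_def by auto
  have c: "openin (mtop M) (fst c)" "inj_on (snd c) (fst c)"
    "\<And>A. openin (mtop M) A \<Longrightarrow> open (snd c ` (A \<inter> fst c))"
    "\<And>B. open B \<Longrightarrow> openin (mtop M) {p \<in> fst c. snd c p \<in> B}"
    using bspec[OF conjunct1[OF conjunct2[OF M[unfolded differentiable_manifold_def]]] cd(1)] by simp_all
  have d: "openin (mtop N) (fst d)" "inj_on (snd d) (fst d)"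
    "\<And>A. openin (mtop N) A \<Longrightarrow> open (snd d ` (A \<inter> fst d))"
    "\<And>B. open B \<Longrightarrow> openin (mtop N) {p \<in> fst d. snd d p \<in> B}"
    using bspec[OF conjunct1[OF conjunct2[OF N[unfolded differentiable_manifold_def]]] cd(2)] by simp_all
  show "openin (mtop (prod_manifold M N)) (fst e)"
    using c(1) d(1) unfolding cd(3) by (simp add: openin_prod_Times_iff)
  show "inj_on (snd e) (fst e)"
    using map_prod_inj_on[OF c(2) d(2)] unfolding cd(3) by simp
  show "\<forall>A. openin (mtop (prod_manifold M N)) A \<longrightarrow> open (snd e ` (A \<inter> fst e))"
  proof (intro allI impI)
    fix A assume A: "openin (mtop (prod_manifold M N)) A"
    show "open (snd e ` (A \<inter> fst e))"
    proof (rule Topological_Spaces.openI)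
      fix z assume "z \<in> snd e ` (A \<inter> fst e)"
      then obtain x where x: "x \<in> A" "x \<in> fst e" "z = snd e x" by blast
      obtain p q where "x = (p, q)" by fastforce
      with x have pq: "(p, q) \<in> A" "p \<in> fst c" "q \<in> fst d" "z = (snd c p, snd d q)"
        unfolding cd(3) by simp_all
      obtain A1 A2 where A12: "openin (mtop M) A1" "openin (mtop N) A2" "p \<in> A1" "q \<in> A2" "A1 \<times> A2 \<subseteq> A"
        using A[unfolded mtop_prod_manifold openin_prod_topology_alt, rule_format, OF pq(1)] by blast
      have "open (snd c ` (A1 \<inter> fst c) \<times> snd d ` (A2 \<inter> fst d))"
        using c(3)[OF A12(1)] d(3)[OF A12(2)] by (rule open_Times)
      moreover have "z \<in> snd c ` (A1 \<inter> fst c) \<times> snd d ` (A2 \<inter> fst d)" using pq A12(3,4) by blast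
      moreover have "snd c ` (A1 \<inter> fst c) \<times> snd d ` (A2 \<inter> fst d) \<subseteq> snd e ` (A \<inter> fst e)"
      proof
        fix y assume "y \<in> snd c ` (A1 \<inter> fst c) \<times> snd d ` (A2 \<inter> fst d)"
        then obtain p' q' where "p' \<in> A1 \<inter> fst c" "q' \<in> A2 \<inter> fst d" "y = (snd c p', snd d q')" by blast
        then show "y \<in> snd e ` (A \<inter> fst e)"
          unfolding cd(3) using A12(5) by (intro image_eqI[of _ _ "(p', q')"]) auto
      qed
      ultimately show "\<exists>T. open T \<and> z \<in> T \<and> T \<subseteq> snd e ` (A \<inter> fst e)" by blast
    qed
  qed
  show "\<forall>B. open B \<longrightarrow> openin (mtop (prod_manifold M N)) {p \<in> fst e. snd e p \<in> B}"
  proof (intro allI impI)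
    fix B :: "('e \<times> 'f) set" assume B: "open B"
    show "openin (mtop (prod_manifold M N)) {p \<in> fst e. snd e p \<in> B}"
      unfolding mtop_prod_manifold openin_prod_topology_alt
    proof (intro allI impI)
      fix p q assume "(p, q) \<in> {p \<in> fst e. snd e p \<in> B}"
      then have pq: "p \<in> fst c" "q \<in> fst d" "(snd c p, snd d q) \<in> B" unfolding cd(3) by auto
      obtain B1 B2 where B12: "open B1" "open B2" "(snd c p, snd d q) \<in> B1 \<times> B2" "B1 \<times> B2 \<subseteq> B"
        using B[unfolded open_prod_def, rule_format, OF pq(3)] by blast
      have "{p \<in> fst c. snd c p \<in> B1} \<times> {q \<in> fst d. snd d q \<in> B2} \<subseteq> {p \<in> fst e. snd e p \<in> B}"
        unfolding cd(3) using B12(4) by auto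
      then show "\<exists>U V. openin (mtop M) U \<and> openin (mtop N) V \<and> p \<in> U \<and> q \<in> V \<and> U \<times> V \<subseteq> {p \<in> fst e. snd e p \<in> B}"
        using c(4)[OF B12(1)] d(4)[OF B12(2)] pq(1,2) B12(3)
        by (intro exI[of _ "{p \<in> fst c. snd c p \<in> B1}"] exI[of _ "{q \<in> fst d. snd d q \<in> B2}"]) auto
    qed
  qed
next
  fix e e' x
  assume "e \<in> atlas (prod_manifold M N)" "e' \<in> atlas (prod_manifold M N)" "x \<in> fst e \<inter> fst e'"
  then obtain c d c' d' p q where e: "e = (fst c \<times> fst d, map_prod (snd c) (snd d))"
      "e' = (fst c' \<times> fst d', map_prod (snd c') (snd d'))" "x = (p, q)"
    and cd: "c \<in> charts_at M p" "d \<in> charts_at N q" "c' \<in> charts_at M p" "d' \<in> charts_at N q"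
    unfolding prod_manifold_def charts_at_def by auto
  have f: "(snd c' \<circ> id \<circ> chart_inv c) differentiable (at (fst (snd c p, snd d q)))"
    "(snd d' \<circ> id \<circ> chart_inv d) differentiable (at (snd (snd c p, snd d q)))"
    using transition_differentiable[OF M cd(1,3)] transition_differentiable[OF N cd(2,4)] by simp_all
  then obtain F H where FH: "((snd c' \<circ> id \<circ> chart_inv c) has_derivative F) (at (fst (snd c p, snd d q)))"
    "((snd d' \<circ> id \<circ> chart_inv d) has_derivative H) (at (snd (snd c p, snd d q)))"
    unfolding differentiable_def by blast
  have "((\<lambda>z. ((snd c' \<circ> id \<circ> chart_inv c) (fst z), (snd d' \<circ> id \<circ> chart_inv d) (snd z)))
      has_derivative (\<lambda>z. (F (fst z), H (snd z)))) (at (snd c p, snd d q))"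
    by (intro has_derivative_Pair has_derivative_compose[OF has_derivative_fst[OF has_derivative_ident] FH(1)]
        has_derivative_compose[OF has_derivative_snd[OF has_derivative_ident] FH(2)])
  then have df: "(\<lambda>z. ((snd c' \<circ> id \<circ> chart_inv c) (fst z), (snd d' \<circ> id \<circ> chart_inv d) (snd z)))
      differentiable (at (snd c p, snd d q))"
    unfolding differentiable_def by blast
  have ev: "\<forall>\<^sub>F z in nhds (snd c p, snd d q). (snd e' \<circ> chart_inv e) z =
     ((snd c' \<circ> id \<circ> chart_inv c) (fst z), (snd d' \<circ> id \<circ> chart_inv d) (snd z))"
    by (rule eventually_in_prod_chart[OF M N cd(1,2)])
      (simp add: e chart_inv_prod[OF M N] charts_atD(6,2)[OF M] charts_atD(6,2)[OF N])
  show "(snd e' \<circ> chart_inv e) differentiable (at (snd e x))"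
    unfolding e(3) e(1) snd_conv map_prod_simp frechet_derivative_cong_nhds(2)[OF ev, unfolded e(1)]
    by (rule df)
qed

text \<open>In a product chart the two projections are the linear projections \<open>fst\<close> and
  \<open>snd\<close>. Hence the representative of a tangent vector in that chart is the pair of
  representatives of its images, which gives injectivity.\<close>

lemma
  fixes M :: "('a, 'e::real_normed_vector) manifold" and N :: "('b, 'f::real_normed_vector) manifold"
  assumes M: "differentiable_manifold M" and N: "differentiable_manifold N"
    and p: "p \<in> points M" and q: "q \<in> points N"
  shows mdiff_at_fst: "mdiff_at (prod_manifold M N) M fst (p, q)"
    and mdiff_at_snd: "mdiff_at (prod_manifold M N) N snd (p, q)"
    and tmap_fst_snd_inject: "\<And>u v. \<lbrakk>u \<in> tangent_space (prod_manifold M N) (p, q);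
      v \<in> tangent_space (prod_manifold M N) (p, q);
      tmap (prod_manifold M N) M fst (p, q) u = tmap (prod_manifold M N) M fst (p, q) v;
      tmap (prod_manifold M N) N snd (p, q) u = tmap (prod_manifold M N) N snd (p, q) v\<rbrakk> \<Longrightarrow> u = v"
proof -
  let ?P = "prod_manifold M N"
  note P = differentiable_manifold_prod[OF M N]
  obtain c where c: "c \<in> charts_at M p" using charts_at_nonempty[OF M p] .
  obtain d where d: "d \<in> charts_at N q" using charts_at_nonempty[OF N q] .
  define e where "e = (fst c \<times> fst d, map_prod (snd c) (snd d))"
  have e: "e \<in> charts_at ?P (p, q)" unfolding e_def charts_at_prod using c d by blast
  have pt: "snd e (p, q) = (snd c p, snd d q)" unfolding e_def by simp
  have ev1: "\<forall>\<^sub>F z in nhds (snd e (p, q)). (snd c \<circ> fst \<circ> chart_inv e) z = fst z"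
    unfolding pt by (rule eventually_in_prod_chart[OF M N c d])
      (simp add: e_def chart_inv_prod[OF M N] charts_atD(6,2)[OF M])
  have ev2: "\<forall>\<^sub>F z in nhds (snd e (p, q)). (snd d \<circ> snd \<circ> chart_inv e) z = snd z"
    unfolding pt by (rule eventually_in_prod_chart[OF M N c d])
      (simp add: e_def chart_inv_prod[OF M N] charts_atD(6,2)[OF N])
  have d1: "(fst has_derivative fst) (at z)" and d2: "(snd has_derivative snd) (at z)" for z :: "'e \<times> 'f"
    by (rule bounded_linear_imp_has_derivative[OF bounded_linear_fst]
        bounded_linear_imp_has_derivative[OF bounded_linear_snd])+
  have df: "fst differentiable (at z)" "snd differentiable (at z)" for z :: "'e \<times> 'f"
    using d1 d2 unfolding differentiable_def by blast+
  have ope: "openin (mtop ?P) (fst e)" "(p, q) \<in> fst e" using charts_atD(2,3)[OF P e] by simp_all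
  show m1: "mdiff_at ?P M fst (p, q)"
  proof (rule mdiff_atI[OF e _ ope])
    show "c \<in> charts_at M (fst (p, q))" using c by simp
    show "fst ` fst e \<subseteq> fst c" unfolding e_def by auto
    show "(snd c \<circ> fst \<circ> chart_inv e) differentiable (at (snd e (p, q)))"
      unfolding frechet_derivative_cong_nhds(2)[OF ev1] by (rule df)
  qed
  show m2: "mdiff_at ?P N snd (p, q)"
  proof (rule mdiff_atI[OF e _ ope])
    show "d \<in> charts_at N (snd (p, q))" using d by simp
    show "snd ` fst e \<subseteq> fst d" unfolding e_def by auto
    show "(snd d \<circ> snd \<circ> chart_inv e) differentiable (at (snd e (p, q)))"
      unfolding frechet_derivative_cong_nhds(2)[OF ev2] by (rule df)
  qed
  have c': "c \<in> charts_at M (fst (p, q))" and d': "d \<in> charts_at N (snd (p, q))" using c d by simp_all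
  have ue: "u e = (tmap ?P M fst (p, q) u c, tmap ?P N snd (p, q) u d)" if "u \<in> tangent_space ?P (p, q)" for u
    unfolding tmap_in_charts[OF P M m1 that e c'] tmap_in_charts[OF P N m2 that e d']
      frechet_derivative_cong_nhds(1)[OF ev1] frechet_derivative_cong_nhds(1)[OF ev2]
      frechet_derivative_at[OF d1, symmetric] frechet_derivative_at[OF d2, symmetric] by simp
  show "u = v" if "u \<in> tangent_space ?P (p, q)" "v \<in> tangent_space ?P (p, q)"
      "tmap ?P M fst (p, q) u = tmap ?P M fst (p, q) v"
        "tmap ?P N snd (p, q) u = tmap ?P N snd (p, q) v" for u v
    using that by (intro tangent_eqI[OF that(1,2) e]) (simp add: ue)
qed

lemma mdiff_at_Pair:
  assumes K: "differentiable_manifold K" and M: "differentiable_manifold M" and N: "differentiable_manifold N"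
    and f: "mdiff_at K M f p" and g: "mdiff_at K N g p"
  shows "mdiff_at K (prod_manifold M N) (\<lambda>x. (f x, g x)) p"
proof -
  obtain b where b: "b \<in> charts_at K p" using charts_at_nonempty[OF K mdiff_at_points(1)[OF K M f]] .
  obtain c where c: "c \<in> charts_at M (f p)" using charts_at_nonempty[OF M mdiff_at_points(2)[OF K M f]] .
  obtain d where d: "d \<in> charts_at N (g p)" using charts_at_nonempty[OF N mdiff_at_points(2)[OF K N g]] .
  define e where "e = (fst c \<times> fst d, map_prod (snd c) (snd d))"
  have e: "e \<in> charts_at (prod_manifold M N) (f p, g p)" unfolding e_def charts_at_prod using c d by blast
  obtain A where A: "openin (mtop K) A" "p \<in> A" "f ` A \<subseteq> fst c"
    using mdiff_at_imp_continuous[OF K M f charts_atD(3,2)[OF M c]] .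
  obtain B where B: "openin (mtop K) B" "p \<in> B" "g ` B \<subseteq> fst d"
    using mdiff_at_imp_continuous[OF K N g charts_atD(3,2)[OF N d]] .
  obtain F H where FH: "((snd c \<circ> f \<circ> chart_inv b) has_derivative F) (at (snd b p))"
    "((snd d \<circ> g \<circ> chart_inv b) has_derivative H) (at (snd b p))"
    using mdiff_at_in_charts[OF K M f b c] mdiff_at_in_charts[OF K N g b d] unfolding differentiable_def by blast
  have "snd e \<circ> (\<lambda>x. (f x, g x)) \<circ> chart_inv b = (\<lambda>z. ((snd c \<circ> f \<circ> chart_inv b) z, (snd d \<circ> g \<circ> chart_inv b) z))"
    unfolding e_def by auto
  then have "(snd e \<circ> (\<lambda>x. (f x, g x)) \<circ> chart_inv b) differentiable (at (snd b p))"
    using has_derivative_Pair[OF FH] unfolding differentiable_def by auto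
  moreover have "openin (mtop K) (A \<inter> B)" "p \<in> A \<inter> B" "(\<lambda>x. (f x, g x)) ` (A \<inter> B) \<subseteq> fst e"
    using A B unfolding e_def by (auto intro: openin_Int)
  ultimately show ?thesis
    unfolding mdiff_at_def using b e by blast
qed

section \<open>Products and submersions\<close>

text \<open>Each projection of a slice is either the identity or constant, so the sum of the two
  slice images projects to \<open>v\<close> and to \<open>w\<close>. This is the existence half
  behind the definite description in \<open>tpair\<close>.\<close>

lemma
  assumes M: "differentiable_manifold M" and N: "differentiable_manifold N"
    and p: "p \<in> points M" and q: "q \<in> points N"
  shows mdiff_at_slice1: "mdiff_at M (prod_manifold M N) (\<lambda>a. (a, q)) p"
    and mdiff_at_slice2: "mdiff_at N (prod_manifold M N) (\<lambda>b. (p, b)) q"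
    and tmap_slices: "\<And>v w. v \<in> tangent_space M p \<Longrightarrow> w \<in> tangent_space N q \<Longrightarrow>
      (let u = tadd (tmap M (prod_manifold M N) (\<lambda>a. (a, q)) p v) (tmap N (prod_manifold M N) (\<lambda>b. (p, b)) q w)
       in u \<in> tangent_space (prod_manifold M N) (p, q) \<and>
        tmap (prod_manifold M N) M fst (p, q) u = v \<and> tmap (prod_manifold M N) N snd (p, q) u = w)"
proof -
  let ?P = "prod_manifold M N"
  note P = differentiable_manifold_prod[OF M N]
  have m1: "mdiff_at M ?P (\<lambda>a. (a, q)) p"
    using mdiff_at_Pair[OF M M N mdiff_at_id[OF M p] mdiff_at_const[OF M N p q]] by simp
  have m2: "mdiff_at N ?P (\<lambda>b. (p, b)) q"
    using mdiff_at_Pair[OF N M N mdiff_at_const[OF N M q p] mdiff_at_id[OF N q]] by simp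
  show "mdiff_at M ?P (\<lambda>a. (a, q)) p" "mdiff_at N ?P (\<lambda>b. (p, b)) q" using m1 m2 .
  note mf = mdiff_at_fst[OF M N p q] and ms = mdiff_at_snd[OF M N p q]
  fix v w assume v: "v \<in> tangent_space M p" and w: "w \<in> tangent_space N q"
  let ?u1 = "tmap M ?P (\<lambda>a. (a, q)) p v" and ?u2 = "tmap N ?P (\<lambda>b. (p, b)) q w"
  have u: "?u1 \<in> tangent_space ?P (p, q)" "?u2 \<in> tangent_space ?P (p, q)"
    using tmap_tangent[OF M P m1 v] tmap_tangent[OF N P m2 w] .
  have "tmap ?P M fst (p, q) ?u1 = tmap M M id p v"
    using tmap_comp[OF M P M m1, OF mf v] by (simp add: comp_def id_def)
  then have 1: "tmap ?P M fst (p, q) ?u1 = v" using tmap_id[OF M p v] by simp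
  have "tmap ?P M fst (p, q) ?u2 = tmap N M (\<lambda>_. p) q w"
    using tmap_comp[OF N P M m2, OF mf w] by (simp add: comp_def)
  then have 2: "tmap ?P M fst (p, q) ?u2 = tzero" using tmap_const[OF N M q p w] by simp
  have "tmap ?P N snd (p, q) ?u1 = tmap M N (\<lambda>_. q) p v"
    using tmap_comp[OF M P N m1, OF ms v] by (simp add: comp_def)
  then have 3: "tmap ?P N snd (p, q) ?u1 = tzero" using tmap_const[OF M N p q v] by simp
  have "tmap ?P N snd (p, q) ?u2 = tmap N N id q w"
    using tmap_comp[OF N P N m2, OF ms w] by (simp add: comp_def id_def)
  then have 4: "tmap ?P N snd (p, q) ?u2 = w" using tmap_id[OF N q w] by simp
  show "let u = tadd ?u1 ?u2 in u \<in> tangent_space ?P (p, q) \<and>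
      tmap ?P M fst (p, q) u = v \<and> tmap ?P N snd (p, q) u = w"
    unfolding Let_def tmap_linear(1)[OF P M mf u] tmap_linear(1)[OF P N ms u] 1 2 3 4
    using tadd_tangent[OF P u] by (simp add: tadd_def tzero_def)
qed

lemma tpair_eqI:
  assumes M: "differentiable_manifold M" and N: "differentiable_manifold N"
    and p: "p \<in> points M" and q: "q \<in> points N"
    and u: "u \<in> tangent_space (prod_manifold M N) (p, q)"
      "tmap (prod_manifold M N) M fst (p, q) u = v" "tmap (prod_manifold M N) N snd (p, q) u = w"
  shows "tpair M N (p, q) v w = u"
  unfolding tpair_def
proof (rule the_equality)
  fix u' assume "u' \<in> tangent_space (prod_manifold M N) (p, q) \<and>
    tmap (prod_manifold M N) M fst (p, q) u' = v \<and> tmap (prod_manifold M N) N snd (p, q) u' = w"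
  then show "u' = u" using tmap_fst_snd_inject[OF M N p q, of u' u] u by simp
qed (use u in blast)

lemma tpair_eq_slices:
  assumes M: "differentiable_manifold M" and N: "differentiable_manifold N"
    and p: "p \<in> points M" and q: "q \<in> points N"
    and v: "v \<in> tangent_space M p" and w: "w \<in> tangent_space N q"
  shows "tpair M N (p, q) v w =
    tadd (tmap M (prod_manifold M N) (\<lambda>a. (a, q)) p v) (tmap N (prod_manifold M N) (\<lambda>b. (p, b)) q w)"
  using tmap_slices[OF M N p q v w] unfolding Let_def by (intro tpair_eqI[OF M N p q]) blast+

lemma tpair_tangent:
  assumes M: "differentiable_manifold M" and N: "differentiable_manifold N"
    and p: "p \<in> points M" and q: "q \<in> points N"
    and v: "v \<in> tangent_space M p" and w: "w \<in> tangent_space N q"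
  shows "tpair M N (p, q) v w \<in> tangent_space (prod_manifold M N) (p, q)"
    and "tmap (prod_manifold M N) M fst (p, q) (tpair M N (p, q) v w) = v"
    and "tmap (prod_manifold M N) N snd (p, q) (tpair M N (p, q) v w) = w"
  using tmap_slices[OF M N p q v w] unfolding Let_def tpair_eq_slices[OF assms] by blast+

lemma tpair_split:
  assumes M: "differentiable_manifold M" and N: "differentiable_manifold N"
    and p: "p \<in> points M" and q: "q \<in> points N"
    and v: "v \<in> tangent_space M p" and w: "w \<in> tangent_space N q"
  shows "tpair M N (p, q) v w = tadd (tpair M N (p, q) v tzero) (tpair M N (p, q) tzero w)"
proof -
  note P = differentiable_manifold_prod[OF M N]
  note z = tzero_tangent[OF M, of p] tzero_tangent[OF N, of q]
  note t1 = tpair_tangent[OF M N p q v z(2)] and t2 = tpair_tangent[OF M N p q z(1) w]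
  show ?thesis
    by (rule tpair_eqI[OF M N p q tadd_tangent[OF P t1(1) t2(1)]])
      (simp_all add: tmap_linear(1)[OF P M mdiff_at_fst[OF M N p q] t1(1) t2(1)]
        tmap_linear(1)[OF P N mdiff_at_snd[OF M N p q] t1(1) t2(1)] t1 t2, simp_all add: tadd_def tzero_def)
qed

lemma mderiv_linear:
  assumes M: "differentiable_manifold M" and f: "mdiff_at M real_line f p"
    and u: "u \<in> tangent_space M p" and v: "v \<in> tangent_space M p"
  shows "mderiv M f p (tadd u v) = mderiv M f p u + mderiv M f p v"
    and "mderiv M f p tzero = 0"
  unfolding mderiv_eq_tmap tmap_linear[OF M differentiable_manifold_real_line f u v]
  by (simp_all add: tadd_def tzero_def)

lemma mderiv_comp:
  assumes M: "differentiable_manifold M" and N: "differentiable_manifold N"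
    and f: "mdiff_at M N f p" and g: "mdiff_at N real_line g (f p)" and v: "v \<in> tangent_space M p"
  shows "mderiv M (g \<circ> f) p v = mderiv N g (f p) (tmap M N f p v)"
  unfolding mderiv_eq_tmap tmap_comp[OF M N differentiable_manifold_real_line f, OF g v] ..

text \<open>\<open>D1\<close> and \<open>D2\<close> are derivatives of \<open>L\<close> along the
  two slices through \<open>(p, q)\<close>; since \<open>tpair\<close> is the sum of the slice
  images, the chain rule and linearity give everything.\<close>

lemma
  assumes M: "differentiable_manifold M" and p: "p \<in> points M" and q: "q \<in> points M"
    and L: "mdiff_at (prod_manifold M M) real_line L (p, q)"
    and v: "v \<in> tangent_space M p" and w: "w \<in> tangent_space M q"
  shows mderiv_tpair: "mderiv (prod_manifold M M) L (p, q) (tpair M M (p, q) v w) = D1 M L (p, q) v + D2 M L (p, q) w"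
    and D1_add: "\<And>v'. v' \<in> tangent_space M p \<Longrightarrow> D1 M L (p, q) (tadd v v') = D1 M L (p, q) v + D1 M L (p, q) v'"
    and D2_add: "\<And>w'. w' \<in> tangent_space M q \<Longrightarrow> D2 M L (p, q) (tadd w w') = D2 M L (p, q) w + D2 M L (p, q) w'"
    and D1_zero: "D1 M L (p, q) tzero = 0" and D2_zero: "D2 M L (p, q) tzero = 0"
proof -
  let ?P = "prod_manifold M M"
  note P = differentiable_manifold_prod[OF M M]
  note R = differentiable_manifold_real_line
  note s1 = mdiff_at_slice1[OF M M p q] and s2 = mdiff_at_slice2[OF M M p q]
  have c1: "mdiff_at M real_line (L \<circ> (\<lambda>a. (a, q))) p" by (rule mdiff_at_chain(1)[OF M P R s1, OF L])
  have c2: "mdiff_at M real_line (L \<circ> (\<lambda>b. (p, b))) q" by (rule mdiff_at_chain(1)[OF M P R s2, OF L])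
  have D1: "D1 M L (p, q) = mderiv M (L \<circ> (\<lambda>a. (a, q))) p" by (rule ext) (simp add: D1_def comp_def)
  have D2: "D2 M L (p, q) = mderiv M (L \<circ> (\<lambda>b. (p, b))) q" by (rule ext) (simp add: D2_def comp_def)
  show "D1 M L (p, q) (tadd v v') = D1 M L (p, q) v + D1 M L (p, q) v'" if "v' \<in> tangent_space M p" for v'
    unfolding D1 by (rule mderiv_linear(1)[OF M c1 v that])
  show "D2 M L (p, q) (tadd w w') = D2 M L (p, q) w + D2 M L (p, q) w'" if "w' \<in> tangent_space M q" for w'
    unfolding D2 by (rule mderiv_linear(1)[OF M c2 w that])
  show "D1 M L (p, q) tzero = 0" "D2 M L (p, q) tzero = 0"
    unfolding D1 D2 using mderiv_linear(2)[OF M c1 v v] mderiv_linear(2)[OF M c2 w w] .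
  have "mderiv ?P L (p, q) (tadd (tmap M ?P (\<lambda>a. (a, q)) p v) (tmap M ?P (\<lambda>b. (p, b)) q w)) =
    mderiv ?P L (p, q) (tmap M ?P (\<lambda>a. (a, q)) p v) + mderiv ?P L (p, q) (tmap M ?P (\<lambda>b. (p, b)) q w)"
    by (rule mderiv_linear(1)[OF P L tmap_tangent[OF M P s1 v] tmap_tangent[OF M P s2 w]])
  also have "\<dots> = D1 M L (p, q) v + D2 M L (p, q) w"
    unfolding D1 D2 mderiv_comp[OF M P s1, OF L v] mderiv_comp[OF M P s2, OF L w] ..
  finally show "mderiv ?P L (p, q) (tpair M M (p, q) v w) = D1 M L (p, q) v + D2 M L (p, q) w"
    unfolding tpair_eq_slices[OF M M p q v w] .
qed

section \<open>Submersions in charts and proper free actions\<close>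

lemma smooth_manifold_span:
  fixes M :: "('a, 'e::real_normed_vector) manifold"
  assumes "smooth_manifold M"
  obtains B :: "'e set" where "finite B" "span B = UNIV"
  using assms unfolding smooth_manifold_def by blast

text \<open>Collects what the regularity lemmas ask of a coordinate expression. Surjectivity of its
  derivative comes from lifting the tangent vector with prescribed coordinates \<open>y\<close>
  along the tangent map.\<close>

lemma submersion_in_charts:
  assumes M: "smooth_manifold M" and N: "smooth_manifold N"
    and f: "submersion_on M N W f" and p: "p \<in> W"
    and c: "c \<in> charts_at M p" and d: "d \<in> charts_at N (f p)"
  defines "S \<equiv> snd c ` {p' \<in> fst c \<inter> W. f p' \<in> fst d}" and "F \<equiv> snd d \<circ> f \<circ> chart_inv c"
  shows "open S" "snd c p \<in> S" "\<And>x. x \<in> S \<Longrightarrow> F differentiable (at x)"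
    "\<And>v. continuous_on S (\<lambda>x. frechet_derivative F (at x) v)"
    "surj (frechet_derivative F (at (snd c p)))"
proof -
  note M' = smooth_imp_differentiable_manifold[OF M] and N' = smooth_imp_differentiable_manifold[OF N]
  have sm: "smooth_map M N W f" and surj: "tmap M N f p ` tangent_space M p = tangent_space N (f p)"
    using f p unfolding submersion_on_def by auto
  have W: "openin (mtop M) W" and cont: "continuous_map (subtopology (mtop M) W) (mtop N) f"
    and smF: "smooth_on S F"
    using sm charts_atD(1)[OF M' c] charts_atD(1)[OF N' d] unfolding smooth_map_def S_def F_def by auto
  have ts: "topspace (subtopology (mtop M) W) = W"
    using openin_subset[OF W] by (rule topspace_subtopology_subset)
  have "openin (subtopology (mtop M) W) {x \<in> W. f x \<in> fst d}"
    using cont charts_atD(3)[OF N' d] unfolding continuous_map_def ts by blast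
  then have A: "openin (mtop M) {x \<in> W. f x \<in> fst d}"
    using W by (simp add: openin_open_subtopology)
  have "{p' \<in> fst c \<inter> W. f p' \<in> fst d} = {x \<in> W. f x \<in> fst d} \<inter> fst c" by auto
  then show "open S" unfolding S_def using charts_atD(7)[OF M' c A] by simp
  show "snd c p \<in> S" unfolding S_def using p charts_atD(2)[OF M' c] charts_atD(2)[OF N' d] by simp
  show "F differentiable (at x)" if "x \<in> S" for x using smF that by (rule smooth_on_imp_differentiable)
  show "continuous_on S (\<lambda>x. frechet_derivative F (at x) v)" for v
    using smF by (rule smooth_on_imp_continuous_derivative)
  have mf: "mdiff_at M N f p" using M' N' sm p by (rule smooth_map_imp_mdiff_at)
  have "\<exists>x. y = frechet_derivative F (at (snd c p)) x" for y
  proof -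
    have "tvec_of N d (f p) y \<in> tmap M N f p ` tangent_space M p"
      unfolding surj by (rule tvec_of_tangent(1)[OF N' d])
    then obtain v where v: "v \<in> tangent_space M p" "tmap M N f p v = tvec_of N d (f p) y" by auto
    have "frechet_derivative F (at (snd c p)) (v c) = tmap M N f p v d"
      unfolding F_def by (rule tmap_in_charts[OF M' N' mf v(1) c d, symmetric])
    also have "\<dots> = y" unfolding v(2) by (rule tvec_of_tangent(2)[OF N' d])
    finally show ?thesis by metis
  qed
  then show "surj (frechet_derivative F (at (snd c p)))" unfolding surj_def by blast
qed

lemma mdiff_at_descends:
  fixes M :: "('a, 'e::real_normed_vector) manifold" and N :: "('b, 'f::real_normed_vector) manifold"
  assumes M: "smooth_manifold M" and N: "smooth_manifold N"
    and f: "submersion_on M N W f" and p: "p \<in> W" and hf: "mdiff_at M real_line (h \<circ> f) p"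
  shows "mdiff_at N real_line h (f p)"
proof -
  note M' = smooth_imp_differentiable_manifold[OF M] and N' = smooth_imp_differentiable_manifold[OF N]
  have mf: "mdiff_at M N f p"
    using f p unfolding submersion_on_def by (blast intro: smooth_map_imp_mdiff_at[OF M' N'])
  obtain c where c: "c \<in> charts_at M p" using charts_at_nonempty[OF M' mdiff_at_points(1)[OF M' N' mf]] .
  obtain d where d: "d \<in> charts_at N (f p)" using charts_at_nonempty[OF N' mdiff_at_points(2)[OF M' N' mf]] .
  obtain A where A: "openin (mtop M) A" "p \<in> A" "f ` A \<subseteq> fst d"
    using mdiff_at_imp_continuous[OF M' N' mf charts_atD(3,2)[OF N' d]] .
  obtain B1 :: "'e set" where B1: "finite B1" "span B1 = UNIV" using smooth_manifold_span[OF M] .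
  obtain B2 :: "'f set" where B2: "finite B2" "span B2 = UNIV" using smooth_manifold_span[OF N] .
  define F where "F = snd d \<circ> f \<circ> chart_inv c"
  have pt: "F (snd c p) = snd d (f p)" unfolding F_def using charts_atD(6,2)[OF M' c] by simp
  have "(snd (UNIV :: real set, id :: real \<Rightarrow> real) \<circ> (h \<circ> f) \<circ> chart_inv c) differentiable (at (snd c p))"
    by (rule mdiff_at_in_charts[OF M' differentiable_manifold_real_line hf c]) simp
  then have hd: "(\<lambda>x. h (f (chart_inv c x))) differentiable (at (snd c p))" by (simp add: comp_def)
  have ev: "\<forall>\<^sub>F x in nhds (snd c p). h (f (chart_inv c x)) = (h \<circ> chart_inv d) (F x)"
    by (rule eventually_in_chart[OF M' c A(1,2)])
      (use A(3) in \<open>auto simp: F_def charts_atD(6)[OF M' c] charts_atD(6)[OF N' d]\<close>)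
  have hd': "(\<lambda>x. (h \<circ> chart_inv d) (F x)) differentiable (at (snd c p))"
    using hd unfolding frechet_derivative_cong_nhds(2)[OF ev] .
  have "(h \<circ> chart_inv d) differentiable (at (F (snd c p)))"
    by (rule differentiable_descends[OF B1 B2, OF submersion_in_charts[OF M N f p c d, folded F_def] hd'])
  then have "(snd (UNIV :: real set, id :: real \<Rightarrow> real) \<circ> h \<circ> chart_inv d) differentiable (at (snd d (f p)))"
    unfolding pt by (simp add: comp_def)
  then show ?thesis
    unfolding mdiff_at_def using d charts_atD(2,3)[OF N' d]
    by (intro bexI[of _ d] bexI[of _ "(UNIV, id)"] exI[of _ "fst d"]) simp_all
qed

text \<open>The image of the group elements outside \<open>O'\<close> under \<open>(g, q') \<mapsto> (g \<cdot> q', q')\<close> is closed by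
  properness and misses \<open>(q, q)\<close> by freeness.\<close>

lemma proper_free_action_return:
  assumes proper: "proper_action MG Q \<Phi>" and free: "free_action G (points Q) \<Phi>"
    and G: "points MG = carrier G" and q: "q \<in> points Q"
    and O: "openin (mtop MG) O'" "\<one>\<^bsub>G\<^esub> \<in> O'"
  obtains A where "openin (mtop Q) A" "q \<in> A" "\<And>g. g \<in> carrier G \<Longrightarrow> \<Phi> g q \<in> A \<Longrightarrow> g \<in> O'"
proof -
  define f where "f = (\<lambda>(g, q). (\<Phi> g q, q))"
  define C where "C = f ` ((points MG - O') \<times> points Q)"
  have "closedin (prod_topology (mtop MG) (mtop Q)) ((points MG - O') \<times> points Q)"
    using closedin_diff[OF closedin_topspace O(1)] by (simp add: closedin_prod_Times_iff)
  then have C: "closedin (prod_topology (mtop Q) (mtop Q)) C"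
    using proper unfolding proper_action_def proper_map_def closed_map_def f_def[symmetric] C_def by blast
  have "(q, q) \<notin> C"
  proof
    assume "(q, q) \<in> C"
    then obtain g where g: "g \<in> points MG" "g \<notin> O'" "\<Phi> g q = q" unfolding C_def f_def by auto
    then have "g \<in> stabilizer G \<Phi> q" unfolding stabilizer_def G by simp
    then have "g = \<one>\<^bsub>G\<^esub>" using free q unfolding free_action_def by blast
    then show False using g(2) O(2) by simp
  qed
  then have "(q, q) \<in> topspace (prod_topology (mtop Q) (mtop Q)) - C" using q by simp
  moreover have "openin (prod_topology (mtop Q) (mtop Q)) (topspace (prod_topology (mtop Q) (mtop Q)) - C)"
    using C by (rule openin_diff[OF openin_topspace])
  ultimately obtain A B where AB: "openin (mtop Q) A" "q \<in> A" "q \<in> B"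
    "A \<times> B \<subseteq> topspace (prod_topology (mtop Q) (mtop Q)) - C"
    unfolding openin_prod_topology_alt by meson
  show thesis
  proof (rule that[OF AB(1,2)])
    fix g assume g: "g \<in> carrier G" "\<Phi> g q \<in> A"
    show "g \<in> O'"
    proof (rule ccontr)
      assume "g \<notin> O'"
      then have "(\<Phi> g q, q) \<in> C" unfolding C_def f_def using g(1) G q by force
      then show False using g(2) AB(3,4) by blast
    qed
  qed
qed

section \<open>Vertical vectors\<close>

lemma mdiff_at_orbit_map:
  assumes MG: "differentiable_manifold MG" "points MG = carrier G" "group G"
    and Q: "differentiable_manifold Q" and act: "smooth_action G MG Q \<Phi>" and q: "q \<in> points Q"
  shows "\<Phi> \<one>\<^bsub>G\<^esub> q = q" and "mdiff_at MG Q (\<lambda>g. \<Phi> g q) \<one>\<^bsub>G\<^esub>"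
proof -
  interpret group_action G "points Q" \<Phi> using act unfolding smooth_action_def by blast
  show "\<Phi> \<one>\<^bsub>G\<^esub> q = q" using q by (simp flip: id_eq_one)
  have one: "\<one>\<^bsub>G\<^esub> \<in> points MG" using MG(2,3) by (simp add: group.is_monoid)
  note P = differentiable_manifold_prod[OF MG(1) Q]
  have "(\<one>\<^bsub>G\<^esub>, q) \<in> points (prod_manifold MG Q)" using one q by simp
  then have "mdiff_at (prod_manifold MG Q) Q (\<lambda>(g, q). \<Phi> g q) (\<one>\<^bsub>G\<^esub>, q)"
    using act unfolding smooth_action_def by (blast intro: smooth_map_imp_mdiff_at[OF P Q])
  from mdiff_at_chain(1)[OF MG(1) P Q mdiff_at_slice1[OF MG(1) Q one q], OF this]
  show "mdiff_at MG Q (\<lambda>g. \<Phi> g q) \<one>\<^bsub>G\<^esub>" by (simp add: comp_def)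
qed

lemma projection_kernel_vertical:
  fixes MG :: "('g, 'l::real_normed_vector) manifold"
    and Q :: "('q, 'e::real_normed_vector) manifold" and S :: "('q set, 's::real_normed_vector) manifold"
  assumes G: "lie_group G MG" and Q: "smooth_manifold Q"
    and action: "smooth_action G MG Q \<Phi>" "free_action G (points Q) \<Phi>" "proper_action MG Q \<Phi>"
    and S: "quotient_manifold G \<Phi> Q (points Q) S"
    and connection: "principal_connection G MG Q \<Phi> \<AA>"
    and q: "q \<in> points Q" and v: "v \<in> tangent_space Q q" "tmap Q S (orbit G \<Phi>) q v = tzero"
  obtains \<xi> where "\<xi> \<in> lie_algebra G MG" "v = inf_gen G MG Q \<Phi> \<xi> q"
proof -
  have G': "differentiable_manifold MG" "points MG = carrier G" "group G"
    using G unfolding lie_group_def by (auto intro: smooth_imp_differentiable_manifold)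
  note Q' = smooth_imp_differentiable_manifold[OF Q]
  have S': "smooth_manifold S" and sub: "submersion_on Q S (points Q) (orbit G \<Phi>)"
    using S unfolding quotient_manifold_def by auto
  note dS = smooth_imp_differentiable_manifold[OF S']
  interpret group_action G "points Q" \<Phi> using action(1) unfolding smooth_action_def by blast
  have one: "\<one>\<^bsub>G\<^esub> \<in> points MG" using G'(2,3) by (simp add: group.is_monoid)
  note act1 = mdiff_at_orbit_map[OF G' Q' action(1) q]
  have m\<pi>: "mdiff_at Q S (orbit G \<Phi>) q"
    using sub q unfolding submersion_on_def by (blast intro: smooth_map_imp_mdiff_at[OF Q' dS])
  obtain c where c: "c \<in> charts_at Q q" using charts_at_nonempty[OF Q' q] .
  obtain s where s: "s \<in> charts_at S (orbit G \<Phi> q)"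
    using charts_at_nonempty[OF dS mdiff_at_points(2)[OF Q' dS m\<pi>]] .
  obtain e where e: "e \<in> charts_at MG \<one>\<^bsub>G\<^esub>" using charts_at_nonempty[OF G'(1) one] .
  obtain B1 :: "'e set" where B1: "finite B1" "span B1 = UNIV" using smooth_manifold_span[OF Q] .
  obtain B2 :: "'s set" where B2: "finite B2" "span B2 = UNIV" using smooth_manifold_span[OF S'] .
  define F where "F = snd s \<circ> orbit G \<Phi> \<circ> chart_inv c"
  define T where "T = snd c ` {p' \<in> fst c \<inter> points Q. orbit G \<Phi> p' \<in> fst s}"
  note cD = charts_atD[OF Q' c] and sD = charts_atD[OF dS s] and eD = charts_atD[OF G'(1) e]
  have "frechet_derivative F (at (snd c q)) (v c) = tmap Q S (orbit G \<Phi>) q v s"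
    unfolding F_def by (rule tmap_in_charts[OF Q' dS m\<pi> v(1) c s, symmetric])
  then have ker: "frechet_derivative F (at (snd c q)) (v c) = 0"
    unfolding v(2) by (simp add: tzero_def)
  note F = submersion_in_charts[OF Q S' sub q c s, folded F_def T_def]
  obtain u where u: "\<And>n. u n \<in> T" "\<And>n. F (u n) = F (snd c q)"
    "(\<lambda>n. real (Suc n) *\<^sub>R (u n - snd c q)) \<longlonglongrightarrow> v c"
    using kernel_vector_tangent_to_fibre[OF B1 B2 F ker] by blast
  have "\<exists>g. g \<in> carrier G \<and> \<Phi> g q \<in> fst c \<and> u n = snd c (\<Phi> g q)" for n
  proof -
    obtain p' where p': "p' \<in> fst c" "p' \<in> points Q" "orbit G \<Phi> p' \<in> fst s" "u n = snd c p'"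
      using u(1)[of n] unfolding T_def by blast
    have "snd s (orbit G \<Phi> p') = snd s (orbit G \<Phi> q)"
      using u(2)[of n] unfolding p'(4) F_def by (simp add: cD(6)[OF p'(1)] cD(6)[OF cD(2)])
    \<comment> \<open>\<open>T\<close> was cut down to points whose orbit lies in the chart
      \<open>s\<close>, so equal coordinates mean equal orbits.\<close>
    then have "orbit G \<Phi> p' = orbit G \<Phi> q" using sD(2,4) p'(3) by (meson inj_onD)
    then have "p' \<in> orbit G \<Phi> q" using orbit_refl[OF p'(2)] by simp
    then show ?thesis using p' unfolding orbit_def by blast
  qed
  then obtain g where g: "\<And>n. g n \<in> carrier G" "\<And>n. \<Phi> (g n) q \<in> fst c" "\<And>n. u n = snd c (\<Phi> (g n) q)"
    by metis
  \<comment> \<open>The scaled displacements converge, so the displacements themselves tend to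
    zero.\<close>
  have "(\<lambda>n. inverse (real (Suc n)) *\<^sub>R (real (Suc n) *\<^sub>R (u n - snd c q))) \<longlonglongrightarrow> 0 *\<^sub>R v c"
    by (intro tendsto_scaleR LIMSEQ_inverse_real_of_nat u(3))
  then have ulim: "u \<longlonglongrightarrow> snd c q" by (simp add: LIM_zero_iff)
  \<comment> \<open>Convergence of \<open>g n\<close> to the identity, phrased with open sets
    because \<open>mtop MG\<close> is an abstract topology.\<close>
  have return: "\<forall>\<^sub>F n in sequentially. g n \<in> O'" if O': "openin (mtop MG) O'" "\<one>\<^bsub>G\<^esub> \<in> O'" for O'
  proof -
    obtain A where A: "openin (mtop Q) A" "q \<in> A" "\<And>h. h \<in> carrier G \<Longrightarrow> \<Phi> h q \<in> A \<Longrightarrow> h \<in> O'"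
      using proper_free_action_return[OF action(3,2) G'(2) q O'] by blast
    have "open (snd c ` (A \<inter> fst c))" "snd c q \<in> snd c ` (A \<inter> fst c)"
      using cD(7)[OF A(1)] cD(2) A(2) by blast+
    then have "\<forall>\<^sub>F n in sequentially. u n \<in> snd c ` (A \<inter> fst c)"
      using ulim topological_tendstoD by blast
    then show ?thesis
    proof (rule eventually_mono)
      fix n assume "u n \<in> snd c ` (A \<inter> fst c)"
      then obtain p' where "p' \<in> A" "p' \<in> fst c" "snd c p' = snd c (\<Phi> (g n) q)"
        using g(3)[of n] by auto
      then have "\<Phi> (g n) q \<in> A" using cD(4) g(2)[of n] by (metis inj_onD)
      then show "g n \<in> O'" using A(3) g(1) by blast
    qed
  qed
  define \<psi> where "\<psi> = snd c \<circ> (\<lambda>g. \<Phi> g q) \<circ> chart_inv e"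
  define b where "b = snd e \<one>\<^bsub>G\<^esub>"
  define D where "D = frechet_derivative \<psi> (at b)"
  have c': "c \<in> charts_at Q (\<Phi> \<one>\<^bsub>G\<^esub> q)" using c act1(1) by simp
  have \<psi>D: "(\<psi> has_derivative D) (at b)"
    using mdiff_at_in_charts[OF G'(1) Q' act1(2) e c']
    unfolding D_def \<psi>_def b_def by (simp only: frechet_derivative_works)
  have gen: "inf_gen G MG Q \<Phi> (tvec_of MG e \<one>\<^bsub>G\<^esub> \<eta>) q c = D \<eta>" for \<eta>
    unfolding inf_gen_def D_def \<psi>_def b_def
      tmap_in_charts[OF G'(1) Q' act1(2) tvec_of_tangent(1)[OF G'(1) e] e c'] tvec_of_tangent(2)[OF G'(1) e] ..
  have lie: "tvec_of MG e \<one>\<^bsub>G\<^esub> \<eta> \<in> lie_algebra G MG" for \<eta>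
    unfolding lie_algebra_def by (rule tvec_of_tangent(1)[OF G'(1) e])
  have gen_tangent: "inf_gen G MG Q \<Phi> (tvec_of MG e \<one>\<^bsub>G\<^esub> \<eta>) q \<in> tangent_space Q q" for \<eta>
    using tmap_tangent[OF G'(1) Q' act1(2) tvec_of_tangent(1)[OF G'(1) e]] unfolding inf_gen_def act1(1) .
  \<comment> \<open>The connection recovers the Lie algebra element from its generator, so two
    elements with the same generator at \<open>q\<close> coincide.\<close>
  have "inj D"
  proof (rule injI)
    fix \<eta> \<eta>' assume "D \<eta> = D \<eta>'"
    then have "inf_gen G MG Q \<Phi> (tvec_of MG e \<one>\<^bsub>G\<^esub> \<eta>) q = inf_gen G MG Q \<Phi> (tvec_of MG e \<one>\<^bsub>G\<^esub> \<eta>') q"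
      by (intro tangent_eqI[OF gen_tangent gen_tangent c]) (simp add: gen)
    moreover have "\<AA> q (inf_gen G MG Q \<Phi> (tvec_of MG e \<one>\<^bsub>G\<^esub> \<eta>) q) = tvec_of MG e \<one>\<^bsub>G\<^esub> \<eta>" for \<eta>
      using connection q lie unfolding principal_connection_def by blast
    ultimately have "tvec_of MG e \<one>\<^bsub>G\<^esub> \<eta> = tvec_of MG e \<one>\<^bsub>G\<^esub> \<eta>'" by metis
    then show "\<eta> = \<eta>'" using tvec_of_tangent(2)[OF G'(1) e] by metis
  qed
  moreover have "(\<lambda>n. snd e (g n)) \<longlonglongrightarrow> b"
  proof (rule topological_tendstoI)
    fix B assume B: "open B" "b \<in> B"
    have "\<forall>\<^sub>F n in sequentially. g n \<in> {h \<in> fst e. snd e h \<in> B}"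
      using eD(8)[OF B(1)] eD(2) B(2) unfolding b_def by (intro return) auto
    then show "\<forall>\<^sub>F n in sequentially. snd e (g n) \<in> B" by (rule eventually_mono) simp
  qed
  moreover have "(\<lambda>n. real (Suc n) *\<^sub>R (\<psi> (snd e (g n)) - \<psi> b)) \<longlonglongrightarrow> v c"
  \<comment> \<open>\<open>u n\<close> can be written through \<psi> only once \<open>g n\<close>
    has entered the domain of the chart \<open>e\<close>, hence the eventual equality.\<close>
  proof (rule Lim_transform_eventually[OF u(3)])
    show "\<forall>\<^sub>F n in sequentially. real (Suc n) *\<^sub>R (u n - snd c q) = real (Suc n) *\<^sub>R (\<psi> (snd e (g n)) - \<psi> b)"
      using return[OF eD(3,2)]
    proof (rule eventually_mono)
      fix n assume "g n \<in> fst e"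
      then show "real (Suc n) *\<^sub>R (u n - snd c q) = real (Suc n) *\<^sub>R (\<psi> (snd e (g n)) - \<psi> b)"
        unfolding \<psi>_def b_def by (simp add: eD(6) eD(2) g(3) act1(1))
    qed
  qed
  ultimately have "v c \<in> range D" by (rule immersion_limit_direction_in_range[OF B1 \<psi>D])
  then obtain \<eta> where \<eta>: "v c = D \<eta>" by blast
  have "v = inf_gen G MG Q \<Phi> (tvec_of MG e \<one>\<^bsub>G\<^esub> \<eta>) q"
    by (rule tangent_eqI[OF v(1) gen_tangent c]) (simp add: gen \<eta>)
  with lie show thesis using that by blast
qed

text \<open>Discrete summation by parts: the terms are regrouped by the index of the variation, and
  a variation supported at one interior index isolates the equation there. Keeping \<open>a\<close>
  and \<open>b\<close> abstract serves both \<open>L\<close> and the reduced Lagrangian corrected by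
  the one-form.\<close>

lemma fixed_end_variations_iff:
  assumes M: "differentiable_manifold M"
    and a: "\<And>k. k < n \<Longrightarrow> a k tzero = (0::real)" and b: "\<And>k. k < n \<Longrightarrow> b k tzero = 0"
  shows "(\<forall>\<delta>\<in>fixed_end_variations M n z. (\<Sum>k<n. a k (\<delta> k) + b k (\<delta> (Suc k))) = 0) \<longleftrightarrow>
    (\<forall>k\<in>{1..<n}. \<forall>v\<in>tangent_space M (z k). b (k - 1) v + a k v = 0)"
proof (cases n)
  case 0
  then show ?thesis by simp
next
  case (Suc m)
  \<comment> \<open>With \<open>n = Suc m\<close>, the first \<open>a\<close>-term and the last
    \<open>b\<close>-term are evaluated at the fixed ends and vanish; shifting the index of the
    remaining \<open>a\<close>-terms pairs them with the \<open>b\<close>-terms.\<close>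
  have sum: "(\<Sum>k<n. a k (\<delta> k) + b k (\<delta> (Suc k))) = (\<Sum>k<m. b k (\<delta> (Suc k)) + a (Suc k) (\<delta> (Suc k)))"
    if "\<delta> \<in> fixed_end_variations M n z" for \<delta>
  proof -
    have "(\<Sum>k<n. a k (\<delta> k)) = (\<Sum>k<m. a (Suc k) (\<delta> (Suc k)))"
      using that a[of 0] unfolding Suc sum.lessThan_Suc_shift fixed_end_variations_def by simp
    moreover have "(\<Sum>k<n. b k (\<delta> (Suc k))) = (\<Sum>k<m. b k (\<delta> (Suc k)))"
      using that b[of m] unfolding Suc sum.lessThan_Suc fixed_end_variations_def by simp
    ultimately show ?thesis by (simp add: sum.distrib)
  qed
  show ?thesis
  proof (intro iffI ballI)
    fix k v assume all: "\<forall>\<delta>\<in>fixed_end_variations M n z. (\<Sum>k<n. a k (\<delta> k) + b k (\<delta> (Suc k))) = 0"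
      and k: "k \<in> {1..<n}" and v: "v \<in> tangent_space M (z k)"
    obtain i where i: "k = Suc i" "i < m" using k Suc by (cases k) auto
    define \<delta> where "\<delta> j = (if j = k then v else tzero)" for j
    have \<delta>: "\<delta> \<in> fixed_end_variations M n z"
      unfolding fixed_end_variations_def \<delta>_def using v k tzero_tangent[OF M] by auto
    have "0 = (\<Sum>j<m. b j (\<delta> (Suc j)) + a (Suc j) (\<delta> (Suc j)))"
      using all \<delta> sum[OF \<delta>] by simp
    also have "\<dots> = (\<Sum>j<m. if j = i then b i v + a (Suc i) v else 0)"
      using a b Suc unfolding \<delta>_def i(1) by (intro sum.cong) auto
    also have "\<dots> = b i v + a (Suc i) v" using i(2) by simp
    finally show "b (k - 1) v + a k v = 0" unfolding i(1) by simp
  next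
    fix \<delta> assume all: "\<forall>k\<in>{1..<n}. \<forall>v\<in>tangent_space M (z k). b (k - 1) v + a k v = 0"
      and \<delta>: "\<delta> \<in> fixed_end_variations M n z"
    have "b k (\<delta> (Suc k)) + a (Suc k) (\<delta> (Suc k)) = 0" if "k < m" for k
    proof -
      have "Suc k \<in> {1..<n}" "\<delta> (Suc k) \<in> tangent_space M (z (Suc k))"
        using that Suc \<delta> unfolding fixed_end_variations_def by auto
      with all show ?thesis by fastforce
    qed
    then show "(\<Sum>k<n. a k (\<delta> k) + b k (\<delta> (Suc k))) = 0" unfolding sum[OF \<delta>] by simp
  qed
qed

section \<open>Reduction\<close>

text \<open>The connection is linear through its coordinates in charts at the identity; on every
  other chart both sides are zero, as tangent vectors vanish there.\<close>

lemma principal_connection_add: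
  assumes conn: "principal_connection G MG Q \<Phi> \<AA>" and q: "q \<in> points Q"
    and Q: "differentiable_manifold Q"
    and v: "v \<in> tangent_space Q q" and w: "w \<in> tangent_space Q q"
  shows "\<AA> q (tadd v w) = tadd (\<AA> q v) (\<AA> q w)"
proof
  fix d
  have A: "\<AA> q u \<in> lie_algebra G MG" if "u \<in> tangent_space Q q" for u
    using conn q that unfolding principal_connection_def by blast
  show "\<AA> q (tadd v w) d = tadd (\<AA> q v) (\<AA> q w) d"
  proof (cases "d \<in> charts_at MG \<one>\<^bsub>G\<^esub>")
    case True
    then have "one_form_on Q (points Q) (\<lambda>q v. \<AA> q v d)"
      using conn unfolding principal_connection_def by blast
    then have "linear_form (tangent_space Q q) (\<lambda>v. \<AA> q v d)"
      using q unfolding one_form_on_def by blast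
    then show ?thesis using v w unfolding linear_form_def tadd_def by blast
  next
    case False
    have "\<AA> q u d = 0" if "u \<in> tangent_space Q q" for u
      using tangent_spaceD(1)[OF A[OF that, unfolded lie_algebra_def] False] .
    then show ?thesis using v w tadd_tangent[OF Q v w] unfolding tadd_def by simp
  qed
qed

lemma orbit_eq_image: "orbit G \<Phi> x = (\<lambda>g. \<Phi> g x) ` carrier G"
  unfolding orbit_def by auto

section \<open>The reduced objects and their derivatives\<close>

text \<open>The discrete curve is not among the parameters: the identities below concern a single
  pair in \<open>U\<close>, and the equivalences apply them at each index.\<close>

locale discrete_routh_reduction =
  fixes G :: "('g, 'b) monoid_scheme"
    and MG :: "('g, 'l::real_normed_vector) manifold"
    and Q :: "('q, 'e::real_normed_vector) manifold"
    and \<Phi> :: "'g \<Rightarrow> 'q \<Rightarrow> 'q"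
    and S :: "('q set, 's::real_normed_vector) manifold"
    and L :: "'q \<times> 'q \<Rightarrow> real"
    and \<mu> :: "('g, 'l) tvector \<Rightarrow> real"
    and N :: "('q \<times> 'q, 'm::real_normed_vector) manifold"
    and U :: "('q \<times> 'q) set"
    and UG :: "(('q \<times> 'q) set, 'u::real_normed_vector) manifold"
    and V :: "('q set \<times> 'q set) set"
    and \<AA> :: "'q \<Rightarrow> ('q, 'e) tvector \<Rightarrow> ('g, 'l) tvector"
    and Lr :: "'q set \<times> 'q set \<Rightarrow> real"
    and \<A> :: "'q set \<times> 'q set \<Rightarrow> ('q set \<times> 'q set, 's \<times> 's) tvector \<Rightarrow> real"
  assumes G: "lie_group G MG"
    and Q: "smooth_manifold Q"
    and action: "smooth_action G MG Q \<Phi>" "free_action G (points Q) \<Phi>" "proper_action MG Q \<Phi>"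
    and S: "quotient_manifold G \<Phi> Q (points Q) S"
    and L_smooth: "smooth_fun (prod_manifold Q Q) (points Q \<times> points Q) L"
    and L_invariant: "invariant_fun G (diag_action \<Phi>) (points Q \<times> points Q) L"
    and \<mu>: "\<mu> \<in> lie_dual G MG"
    and N: "embedded_submanifold N (prod_manifold Q Q)"
    and momentum: "\<And>p. p \<in> points N \<Longrightarrow> momentum_map G MG Q \<Phi> L p = \<mu>"
    and U: "openin (mtop N) U"
    and UG: "quotient_manifold G (diag_action \<Phi>) N U UG"
    and V: "diffeo_on UG (prod_manifold S S) (points UG) orbit_pair" "V = orbit_pair ` points UG"
    and Lr: "\<And>p. p \<in> U \<Longrightarrow> Lr (pair_proj G \<Phi> p) = L p"
    and connection: "principal_connection G MG Q \<Phi> \<AA>"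
    and \<A>_form: "one_form_on (prod_manifold S S) V \<A>"
    and \<A>: "\<And>p v. p \<in> U \<Longrightarrow> v \<in> tangent_space N p \<Longrightarrow>
         pullback N (prod_manifold S S) (pair_proj G \<Phi>) \<A> p v =
         pullback N (prod_manifold Q Q) (\<lambda>p. p) (diff_form Q (mu_form \<mu> \<AA>)) p v"
begin

abbreviation "QQ \<equiv> prod_manifold Q Q"
abbreviation "SS \<equiv> prod_manifold S S"
abbreviation "\<pi> \<equiv> orbit G \<Phi>"
abbreviation "D\<pi> \<equiv> tmap Q S \<pi>"

sublocale group_action G "points Q" \<Phi>
  using action(1) unfolding smooth_action_def by blast

lemma manifolds:
  "differentiable_manifold MG" "points MG = carrier G" "group G"
  "differentiable_manifold Q" "smooth_manifold S" "differentiable_manifold S"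
  "smooth_manifold N" "differentiable_manifold N" "smooth_manifold UG" "differentiable_manifold UG"
  "differentiable_manifold QQ" "differentiable_manifold SS"
proof -
  show "differentiable_manifold MG" "points MG = carrier G" "group G"
    using G unfolding lie_group_def by (auto intro: smooth_imp_differentiable_manifold)
  show dQ: "differentiable_manifold Q" by (rule smooth_imp_differentiable_manifold[OF Q])
  show sS: "smooth_manifold S" using S unfolding quotient_manifold_def by blast
  show dS: "differentiable_manifold S" by (rule smooth_imp_differentiable_manifold[OF sS])
  show sN: "smooth_manifold N" using N unfolding embedded_submanifold_def by blast
  show "differentiable_manifold N" by (rule smooth_imp_differentiable_manifold[OF sN])
  show sU: "smooth_manifold UG" using UG unfolding quotient_manifold_def by blast
  show "differentiable_manifold UG" by (rule smooth_imp_differentiable_manifold[OF sU])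
  show "differentiable_manifold QQ" by (rule differentiable_manifold_prod[OF dQ dQ])
  show "differentiable_manifold SS" by (rule differentiable_manifold_prod[OF dS dS])
qed

lemmas dG = manifolds(1) and ptG = manifolds(2) and gG = manifolds(3) and dQ = manifolds(4)
  and dS = manifolds(6) and dN = manifolds(8) and dUG = manifolds(10) and dQQ = manifolds(11)
  and dSS = manifolds(12) and dR = differentiable_manifold_real_line

lemma one_in: "\<one>\<^bsub>G\<^esub> \<in> points MG"
  using ptG gG by (simp add: group.is_monoid)

lemma U_points:
  assumes "(q0, q1) \<in> U"
  shows "(q0, q1) \<in> points N" "q0 \<in> points Q" "q1 \<in> points Q"
proof -
  show p: "(q0, q1) \<in> points N" using openin_subset[OF U] assms by blast
  have "points N \<subseteq> points QQ" using N unfolding embedded_submanifold_def by blast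
  with p show "q0 \<in> points Q" "q1 \<in> points Q" by auto
qed

lemma projection:
  assumes "q \<in> points Q"
  shows "\<pi> q \<in> points S" "mdiff_at Q S \<pi> q" "D\<pi> q ` tangent_space Q q = tangent_space S (\<pi> q)"
proof -
  have sub: "submersion_on Q S (points Q) \<pi>" using S unfolding quotient_manifold_def by blast
  show m: "mdiff_at Q S \<pi> q"
    using sub assms unfolding submersion_on_def by (blast intro: smooth_map_imp_mdiff_at[OF dQ dS])
  show "\<pi> q \<in> points S" using mdiff_at_points(2)[OF dQ dS m] .
  show "D\<pi> q ` tangent_space Q q = tangent_space S (\<pi> q)"
    using sub assms unfolding submersion_on_def by blast
qed

lemma inf_gen_tangent:
  assumes "q \<in> points Q" "\<xi> \<in> lie_algebra G MG"
  shows "inf_gen G MG Q \<Phi> \<xi> q \<in> tangent_space Q q"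
  using tmap_tangent[OF dG dQ mdiff_at_orbit_map(2)[OF dG ptG gG dQ action(1) assms(1)]]
    mdiff_at_orbit_map(1)[OF dG ptG gG dQ action(1) assms(1)] assms(2)
  unfolding inf_gen_def lie_algebra_def by metis

lemma L_mdiff:
  assumes "q0 \<in> points Q" "q1 \<in> points Q"
  shows "mdiff_at QQ real_line L (q0, q1)"
  using smooth_fun_imp_mdiff_at[OF dQQ L_smooth] assms by blast

text \<open>\<open>L\<close> is constant along
  \<open>g \<mapsto> (\<Phi> g q0, \<Phi> g q1)\<close>, whose tangent map at the identity sends
  \<xi> to the pair of its generators.\<close>

lemma infinitesimal_invariance:
  assumes q0: "q0 \<in> points Q" and q1: "q1 \<in> points Q" and \<xi>: "\<xi> \<in> lie_algebra G MG"
  shows "D1 Q L (q0, q1) (inf_gen G MG Q \<Phi> \<xi> q0) + D2 Q L (q0, q1) (inf_gen G MG Q \<Phi> \<xi> q1) = 0"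
proof -
  note a0 = mdiff_at_orbit_map[OF dG ptG gG dQ action(1) q0]
    and a1 = mdiff_at_orbit_map[OF dG ptG gG dQ action(1) q1]
  have \<xi>': "\<xi> \<in> tangent_space MG \<one>\<^bsub>G\<^esub>" using \<xi> unfolding lie_algebra_def .
  define h where "h g = (\<Phi> g q0, \<Phi> g q1)" for g
  have h: "mdiff_at MG QQ h \<one>\<^bsub>G\<^esub>" unfolding h_def by (rule mdiff_at_Pair[OF dG dQ dQ a0(2) a1(2)])
  have h1: "h \<one>\<^bsub>G\<^esub> = (q0, q1)" unfolding h_def by (simp add: a0(1) a1(1))
  have mf: "mdiff_at QQ Q fst (h \<one>\<^bsub>G\<^esub>)" "mdiff_at QQ Q snd (h \<one>\<^bsub>G\<^esub>)"
    unfolding h1 by (rule mdiff_at_fst[OF dQ dQ q0 q1] mdiff_at_snd[OF dQ dQ q0 q1])+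
  have "tmap QQ Q fst (q0, q1) (tmap MG QQ h \<one>\<^bsub>G\<^esub> \<xi>) = inf_gen G MG Q \<Phi> \<xi> q0"
    using tmap_comp[OF dG dQQ dQ h, OF mf(1) \<xi>'] unfolding h1 inf_gen_def by (simp add: h_def comp_def)
  moreover have "tmap QQ Q snd (q0, q1) (tmap MG QQ h \<one>\<^bsub>G\<^esub> \<xi>) = inf_gen G MG Q \<Phi> \<xi> q1"
    using tmap_comp[OF dG dQQ dQ h, OF mf(2) \<xi>'] unfolding h1 inf_gen_def by (simp add: h_def comp_def)
  moreover have "tmap MG QQ h \<one>\<^bsub>G\<^esub> \<xi> \<in> tangent_space QQ (q0, q1)"
    using tmap_tangent[OF dG dQQ h \<xi>'] unfolding h1 .
  ultimately have tp: "tmap MG QQ h \<one>\<^bsub>G\<^esub> \<xi> =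
      tpair Q Q (q0, q1) (inf_gen G MG Q \<Phi> \<xi> q0) (inf_gen G MG Q \<Phi> \<xi> q1)"
    using tpair_eqI[OF dQ dQ q0 q1] by metis
  have "tmap MG real_line (L \<circ> h) \<one>\<^bsub>G\<^esub> \<xi> = tmap MG real_line (\<lambda>_. L (q0, q1)) \<one>\<^bsub>G\<^esub> \<xi>"
  proof (rule tmap_cong[OF dG openin_topspace one_in])
    fix g assume "g \<in> points MG"
    then show "(L \<circ> h) g = L (q0, q1)"
      using L_invariant q0 q1 unfolding invariant_fun_def diag_action_def h_def ptG by force
  qed
  also have "\<dots> = tzero" by (rule tmap_const[OF dG dR one_in _ \<xi>']) simp
  finally have "mderiv MG (L \<circ> h) \<one>\<^bsub>G\<^esub> \<xi> = 0" unfolding mderiv_eq_tmap by (simp add: tzero_def)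
  moreover have "mderiv MG (L \<circ> h) \<one>\<^bsub>G\<^esub> \<xi> = mderiv QQ L (q0, q1) (tmap MG QQ h \<one>\<^bsub>G\<^esub> \<xi>)"
    using mderiv_comp[OF dG dQQ h, of L] L_mdiff[OF q0 q1] \<xi>' unfolding h1 by blast
  ultimately show ?thesis
    unfolding tp mderiv_tpair[OF dQ q0 q1 L_mdiff[OF q0 q1] inf_gen_tangent[OF q0 \<xi>] inf_gen_tangent[OF q1 \<xi>]]
    by simp
qed

text \<open>Splits \<open>pair_proj\<close> into the quotient submersion onto \<open>UG\<close> and
  the map \<open>orbit_pair\<close>, the two maps about which differential information is
  given.\<close>

lemma pair_proj_factor: "pair_proj G \<Phi> = orbit_pair \<circ> orbit G (diag_action \<Phi>)"
proof
  fix p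
  have "fst ` orbit G (diag_action \<Phi>) p = \<pi> (fst p)" "snd ` orbit G (diag_action \<Phi>) p = \<pi> (snd p)"
    by (simp_all add: orbit_eq_image image_image diag_action_def case_prod_beta)
  then show "pair_proj G \<Phi> p = (orbit_pair \<circ> orbit G (diag_action \<Phi>)) p"
    by (simp add: pair_proj_def orbit_pair_def)
qed

text \<open>On \<open>V\<close> this is the inverse of the diffeomorphism from the diagonal quotient
  of \<open>U\<close>.\<close>

definition "unpair = inv_into (points UG) orbit_pair"

lemma reduction_maps:
  assumes p: "p \<in> U"
  shows "mdiff_at N UG (orbit G (diag_action \<Phi>)) p"
    and "tmap N UG (orbit G (diag_action \<Phi>)) p ` tangent_space N p = tangent_space UG (orbit G (diag_action \<Phi>) p)"
    and "mdiff_at UG SS orbit_pair (orbit G (diag_action \<Phi>) p)"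
    and "openin (mtop SS) V" "pair_proj G \<Phi> p \<in> V"
    and "mdiff_at SS UG unpair (pair_proj G \<Phi> p)"
    and "unpair (pair_proj G \<Phi> p) = orbit G (diag_action \<Phi>) p"
    and "\<And>z. z \<in> V \<Longrightarrow> orbit_pair (unpair z) = z"
proof -
  let ?r = "orbit G (diag_action \<Phi>) p"
  have sub: "submersion_on N UG U (orbit G (diag_action \<Phi>))" and pt: "points UG = orbits G U (diag_action \<Phi>)"
    using UG unfolding quotient_manifold_def by blast+
  show "mdiff_at N UG (orbit G (diag_action \<Phi>)) p"
    using sub p unfolding submersion_on_def by (blast intro: smooth_map_imp_mdiff_at[OF dN dUG])
  show "tmap N UG (orbit G (diag_action \<Phi>)) p ` tangent_space N p = tangent_space UG ?r"
    using sub p unfolding submersion_on_def by blast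
  have r: "?r \<in> points UG" unfolding pt orbits_def using p by blast
  have V': "smooth_map UG SS (points UG) orbit_pair" "inj_on orbit_pair (points UG)"
    "openin (mtop SS) V" "smooth_map SS UG V unpair"
    using V(1) unfolding diffeo_on_def V(2) unpair_def by blast+
  show "mdiff_at UG SS orbit_pair ?r" by (rule smooth_map_imp_mdiff_at[OF dUG dSS V'(1) r])
  show "openin (mtop SS) V" by (rule V')
  show in_V: "pair_proj G \<Phi> p \<in> V" unfolding V(2) pair_proj_factor using r by simp
  show "mdiff_at SS UG unpair (pair_proj G \<Phi> p)" by (rule smooth_map_imp_mdiff_at[OF dSS dUG V'(4) in_V])
  show "unpair (pair_proj G \<Phi> p) = ?r"
    unfolding unpair_def pair_proj_factor using V'(2) r by (simp add: inv_into_f_f)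
  show "orbit_pair (unpair z) = z" if "z \<in> V" for z
    using that unfolding unpair_def V(2) by (rule f_inv_into_f)
qed

text \<open>Lift \<open>w\<close> to the quotient by the derivative of \<open>unpair\<close>, then
  to the level set by the submersion. \<open>orbit_pair \<circ> unpair\<close> is the identity only
  on \<open>V\<close>, which suffices because \<open>V\<close> is open.\<close>

lemma pair_proj_tangent_surj:
  assumes p: "p \<in> U" and w: "w \<in> tangent_space SS (pair_proj G \<Phi> p)"
  obtains u where "u \<in> tangent_space N p" "tmap N SS (pair_proj G \<Phi>) p u = w"
proof -
  let ?r = "orbit G (diag_action \<Phi>) p"
  note R = reduction_maps[OF p]
  have pp: "pair_proj G \<Phi> p \<in> points SS" using openin_subset[OF R(4)] R(5) by blast
  have "tmap SS UG unpair (pair_proj G \<Phi> p) w \<in> tangent_space UG ?r"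
    using tmap_tangent[OF dSS dUG R(6) w] unfolding R(7) .
  then obtain u where u: "u \<in> tangent_space N p"
    "tmap N UG (orbit G (diag_action \<Phi>)) p u = tmap SS UG unpair (pair_proj G \<Phi> p) w"
    unfolding R(2)[symmetric] by auto
  have R3: "mdiff_at UG SS orbit_pair (unpair (pair_proj G \<Phi> p))" unfolding R(7) by (rule R(3))
  have "tmap N SS (pair_proj G \<Phi>) p u = tmap UG SS orbit_pair ?r (tmap N UG (orbit G (diag_action \<Phi>)) p u)"
    unfolding pair_proj_factor by (rule tmap_comp[OF dN dUG dSS R(1), OF R(3) u(1)])
  also have "\<dots> = tmap SS SS (orbit_pair \<circ> unpair) (pair_proj G \<Phi> p) w"
    unfolding u(2) tmap_comp[OF dSS dUG dSS R(6), OF R3 w] R(7) ..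
  also have "\<dots> = tmap SS SS id (pair_proj G \<Phi> p) w"
    by (rule tmap_cong[OF dSS R(4,5)]) (simp add: R(8))
  also have "\<dots> = w" by (rule tmap_id[OF dSS pp w])
  finally show thesis using that u(1) by blast
qed

lemma inclusion_mdiff:
  assumes "p \<in> U"
  shows "mdiff_at N QQ (\<lambda>p. p) p"
  using N openin_subset[OF U] assms unfolding embedded_submanifold_def
  by (blast intro: smooth_map_imp_mdiff_at[OF dN dQQ])

text \<open>\<open>Lr\<close> is given by its values alone. Its composition with the projection is
  the restriction of \<open>L\<close> to \<open>U\<close>, so differentiability descends to
  \<open>UG\<close> and is carried to \<open>V\<close> by \<open>unpair\<close>.\<close>

lemma Lr_mdiff:
  assumes p: "(q0, q1) \<in> U"
  shows "mdiff_at SS real_line Lr (\<pi> q0, \<pi> q1)"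
proof -
  let ?r = "orbit G (diag_action \<Phi>) (q0, q1)"
  note R = reduction_maps[OF p]
  have sub: "submersion_on N UG U (orbit G (diag_action \<Phi>))"
    using UG unfolding quotient_manifold_def by blast
  have pp: "pair_proj G \<Phi> (q0, q1) = (\<pi> q0, \<pi> q1)" by (simp add: pair_proj_def)
  have "mdiff_at N real_line (L \<circ> (\<lambda>p. p)) (q0, q1)"
    by (rule mdiff_at_chain(1)[OF dN dQQ dR inclusion_mdiff[OF p], OF L_mdiff[OF U_points(2,3)[OF p]]])
  then have "mdiff_at N real_line ((Lr \<circ> orbit_pair) \<circ> orbit G (diag_action \<Phi>)) (q0, q1)"
    by (rule mdiff_at_cong[OF dN _ U p]) (use Lr in \<open>simp add: pair_proj_factor\<close>)
  then have "mdiff_at UG real_line (Lr \<circ> orbit_pair) ?r"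
    by (rule mdiff_at_descends[OF manifolds(7,9) sub p])
  then have h: "mdiff_at UG real_line (Lr \<circ> orbit_pair) (unpair (pair_proj G \<Phi> (q0, q1)))"
    unfolding R(7) .
  have "mdiff_at SS real_line ((Lr \<circ> orbit_pair) \<circ> unpair) (pair_proj G \<Phi> (q0, q1))"
    by (rule mdiff_at_chain(1)[OF dSS dUG dR R(6), OF h])
  then show ?thesis
    unfolding pp[symmetric] by (rule mdiff_at_cong[OF dSS _ R(4,5)]) (simp add: R(8))
qed

text \<open>The connection sends a generator back to its Lie algebra element, so a vertical shift
  changes the form by the momentum value.\<close>

lemma mu_form_add_vertical:
  assumes q: "q \<in> points Q" and v: "v \<in> tangent_space Q q" and \<xi>: "\<xi> \<in> lie_algebra G MG"
  shows "mu_form \<mu> \<AA> q (tadd v (inf_gen G MG Q \<Phi> \<xi> q)) = mu_form \<mu> \<AA> q v + \<mu> \<xi>"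
proof -
  have "\<AA> q v \<in> lie_algebra G MG" "\<AA> q (inf_gen G MG Q \<Phi> \<xi> q) = \<xi>"
    using connection q v \<xi> unfolding principal_connection_def by blast+
  then show ?thesis
    using \<mu> \<xi> principal_connection_add[OF connection q dQ v inf_gen_tangent[OF q \<xi>]]
    unfolding mu_form_def lie_dual_def lie_algebra_def cotangent_space_def linear_form_def by auto
qed

lemma vertical_difference:
  assumes q: "q \<in> points Q" and u: "u \<in> tangent_space Q q" and v: "v \<in> tangent_space Q q"
    and eq: "D\<pi> q u = D\<pi> q v"
  obtains \<xi> where "\<xi> \<in> lie_algebra G MG" "u = tadd v (inf_gen G MG Q \<Phi> \<xi> q)"
proof -
  note m = projection(2)[OF q]
  have w: "tscale (-1) v \<in> tangent_space Q q" by (rule tscale_tangent[OF dQ v])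
  have "D\<pi> q (tadd u (tscale (-1) v)) = tzero"
    unfolding tmap_linear(1)[OF dQ dS m u w] tmap_linear(2)[OF dQ dS m v v] eq
    by (simp add: tadd_def tscale_def tzero_def)
  then obtain \<xi> where \<xi>: "\<xi> \<in> lie_algebra G MG" "tadd u (tscale (-1) v) = inf_gen G MG Q \<Phi> \<xi> q"
    using projection_kernel_vertical[OF G Q action S connection q tadd_tangent[OF dQ u w]] by blast
  have "u = tadd v (inf_gen G MG Q \<Phi> \<xi> q)"
    unfolding \<xi>(2)[symmetric] by (simp add: tadd_def tscale_def)
  with \<xi>(1) show thesis using that by blast
qed

lemma momentum_vertical:
  assumes "(q0, q1) \<in> U" "\<xi> \<in> lie_algebra G MG"
  shows "D2 Q L (q0, q1) (inf_gen G MG Q \<Phi> \<xi> q1) = \<mu> \<xi>"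
proof -
  have "momentum_map G MG Q \<Phi> L (q0, q1) \<xi> = \<mu> \<xi>"
    using momentum[OF U_points(1)[OF assms(1)]] by simp
  then show ?thesis using assms(2) unfolding momentum_map_def by simp
qed

text \<open>\<open>v0\<close> and \<open>v1\<close> are arbitrary and need not be tangent to the
  level set together. Passing from the tangent pair \<open>(u0, u1)\<close> to them costs vertical
  vectors \<xi> and \<eta>, found independently, and each of the two brackets on the right absorbs
  its own.\<close>

lemma reduced_derivative:
  assumes p: "(q0, q1) \<in> U" and v0: "v0 \<in> tangent_space Q q0" and v1: "v1 \<in> tangent_space Q q1"
  shows "D1 S Lr (\<pi> q0, \<pi> q1) (D\<pi> q0 v0) + D2 S Lr (\<pi> q0, \<pi> q1) (D\<pi> q1 v1)
      - \<A> (\<pi> q0, \<pi> q1) (tpair S S (\<pi> q0, \<pi> q1) (D\<pi> q0 v0) (D\<pi> q1 v1))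
    = (D1 Q L (q0, q1) v0 + mu_form \<mu> \<AA> q0 v0) + (D2 Q L (q0, q1) v1 - mu_form \<mu> \<AA> q1 v1)"
proof -
  note q = U_points(2,3)[OF p]
  note \<pi>0 = projection[OF q(1)] and \<pi>1 = projection[OF q(2)]
  let ?x = "(\<pi> q0, \<pi> q1)"
  have w0: "D\<pi> q0 v0 \<in> tangent_space S (\<pi> q0)" and w1: "D\<pi> q1 v1 \<in> tangent_space S (\<pi> q1)"
    using v0 v1 \<pi>0(3) \<pi>1(3) by blast+
  define w where "w = tpair S S ?x (D\<pi> q0 v0) (D\<pi> q1 v1)"
  note w = tpair_tangent[OF dS dS \<pi>0(1) \<pi>1(1) w0 w1, folded w_def]
  have pp: "pair_proj G \<Phi> (q0, q1) = ?x" by (simp add: pair_proj_def)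
  obtain u where u: "u \<in> tangent_space N (q0, q1)" "tmap N SS (pair_proj G \<Phi>) (q0, q1) u = w"
    using pair_proj_tangent_surj[OF p, unfolded pp, OF w(1)] by blast
  define i where "i = tmap N QQ (\<lambda>p. p) (q0, q1) u"
  note incl = inclusion_mdiff[OF p]
  have i: "i \<in> tangent_space QQ (q0, q1)" unfolding i_def by (rule tmap_tangent[OF dN dQQ incl u(1)])
  define u0 where "u0 = tmap QQ Q fst (q0, q1) i"
  define u1 where "u1 = tmap QQ Q snd (q0, q1) i"
  note mf = mdiff_at_fst[OF dQ dQ q] and ms = mdiff_at_snd[OF dQ dQ q]
  have u0: "u0 \<in> tangent_space Q q0" and u1: "u1 \<in> tangent_space Q q1"
    using tmap_tangent[OF dQQ dQ mf i] tmap_tangent[OF dQQ dQ ms i] unfolding u0_def u1_def by simp_all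
  have i_pair: "i = tpair Q Q (q0, q1) u0 u1"
    using tpair_eqI[OF dQ dQ q i] unfolding u0_def u1_def by metis
  have m\<pi>: "mdiff_at QQ S (\<pi> \<circ> fst) (q0, q1)" "mdiff_at QQ S (\<pi> \<circ> snd) (q0, q1)"
    by (rule mdiff_at_chain(1)[OF dQQ dQ dS mf], simp add: \<pi>0)
      (rule mdiff_at_chain(1)[OF dQQ dQ dS ms], simp add: \<pi>1)
  have "mdiff_at QQ SS (\<lambda>x. ((\<pi> \<circ> fst) x, (\<pi> \<circ> snd) x)) (q0, q1)"
    by (rule mdiff_at_Pair[OF dQQ dS dS m\<pi>])
  moreover have "(\<lambda>x. ((\<pi> \<circ> fst) x, (\<pi> \<circ> snd) x)) = pair_proj G \<Phi>"
    by (rule ext) (simp add: pair_proj_def)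
  ultimately have mpp: "mdiff_at QQ SS (pair_proj G \<Phi>) (q0, q1)" by simp
  have "tmap N SS (pair_proj G \<Phi> \<circ> (\<lambda>p. p)) (q0, q1) u = tmap QQ SS (pair_proj G \<Phi>) (q0, q1) i"
    unfolding i_def by (rule tmap_comp[OF dN dQQ dSS incl, OF mpp u(1)])
  then have wi: "tmap QQ SS (pair_proj G \<Phi>) (q0, q1) i = w" using u(2) by (simp add: comp_def)
  have msS: "mdiff_at SS S fst (pair_proj G \<Phi> (q0, q1))" "mdiff_at SS S snd (pair_proj G \<Phi> (q0, q1))"
    unfolding pp by (rule mdiff_at_fst[OF dS dS \<pi>0(1) \<pi>1(1)] mdiff_at_snd[OF dS dS \<pi>0(1) \<pi>1(1)])+
  have "D\<pi> q0 u0 = tmap QQ S (\<pi> \<circ> fst) (q0, q1) i"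
    using tmap_comp[OF dQQ dQ dS mf, of \<pi>] \<pi>0(2) i unfolding u0_def by simp
  also have "\<pi> \<circ> fst = fst \<circ> pair_proj G \<Phi>" by (rule ext) (simp add: pair_proj_def)
  also have "tmap QQ S (fst \<circ> pair_proj G \<Phi>) (q0, q1) i = D\<pi> q0 v0"
    unfolding tmap_comp[OF dQQ dSS dS mpp, OF msS(1) i] wi pp w(2) ..
  finally obtain \<xi> where \<xi>: "\<xi> \<in> lie_algebra G MG" "u0 = tadd v0 (inf_gen G MG Q \<Phi> \<xi> q0)"
    using vertical_difference[OF q(1) u0 v0] by blast
  have "D\<pi> q1 u1 = tmap QQ S (\<pi> \<circ> snd) (q0, q1) i"
    using tmap_comp[OF dQQ dQ dS ms, of \<pi>] \<pi>1(2) i unfolding u1_def by simp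
  also have "\<pi> \<circ> snd = snd \<circ> pair_proj G \<Phi>" by (rule ext) (simp add: pair_proj_def)
  also have "tmap QQ S (snd \<circ> pair_proj G \<Phi>) (q0, q1) i = D\<pi> q1 v1"
    unfolding tmap_comp[OF dQQ dSS dS mpp, OF msS(2) i] wi pp w(3) ..
  finally obtain \<eta> where \<eta>: "\<eta> \<in> lie_algebra G MG" "u1 = tadd v1 (inf_gen G MG Q \<Phi> \<eta> q1)"
    using vertical_difference[OF q(2) u1 v1] by blast
  note Ld = L_mdiff[OF q]
  have "mderiv SS Lr ?x w = mderiv QQ L (q0, q1) i"
  proof -
    have "mdiff_at N SS (pair_proj G \<Phi> \<circ> (\<lambda>p. p)) (q0, q1)"
      by (rule mdiff_at_chain(1)[OF dN dQQ dSS incl, OF mpp])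
    then have mN: "mdiff_at N SS (pair_proj G \<Phi>) (q0, q1)" by (simp add: comp_def)
    have "mdiff_at SS real_line Lr (pair_proj G \<Phi> (q0, q1))" unfolding pp by (rule Lr_mdiff[OF p])
    then have "mderiv N (Lr \<circ> pair_proj G \<Phi>) (q0, q1) u = mderiv SS Lr ?x w"
      using mderiv_comp[OF dN dSS mN, of Lr u] u unfolding pp by simp
    moreover have "mderiv N (L \<circ> (\<lambda>p. p)) (q0, q1) u = mderiv QQ L (q0, q1) i"
      unfolding i_def by (rule mderiv_comp[OF dN dQQ incl, OF Ld u(1)])
    moreover have "mderiv N (Lr \<circ> pair_proj G \<Phi>) (q0, q1) u = mderiv N (L \<circ> (\<lambda>p. p)) (q0, q1) u"
      \<comment> \<open>The two functions agree on the open subset \<open>U\<close> of the level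
        set, which is enough for equal derivatives along \<open>u\<close>.\<close>
      unfolding mderiv_eq_tmap by (subst tmap_cong[OF dN U p, of _ "L \<circ> (\<lambda>p. p)"]) (use Lr in simp_all)
    ultimately show ?thesis by simp
  qed
  moreover have "mderiv SS Lr ?x w = D1 S Lr ?x (D\<pi> q0 v0) + D2 S Lr ?x (D\<pi> q1 v1)"
    unfolding w_def by (rule mderiv_tpair[OF dS \<pi>0(1) \<pi>1(1) Lr_mdiff[OF p] w0 w1])
  moreover have "mderiv QQ L (q0, q1) i = D1 Q L (q0, q1) u0 + D2 Q L (q0, q1) u1"
    unfolding i_pair by (rule mderiv_tpair[OF dQ q Ld u0 u1])
  \<comment> \<open>The momentum gives \<open>D2\<close> on the generator of \<xi> at
    \<open>q1\<close>; invariance converts this into minus that value for \<open>D1\<close> at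
    \<open>q0\<close>.\<close>
  moreover have "D1 Q L (q0, q1) u0 = D1 Q L (q0, q1) v0 - \<mu> \<xi>"
    using infinitesimal_invariance[OF q \<xi>(1)] momentum_vertical[OF p \<xi>(1)]
    unfolding \<xi>(2) D1_add[OF dQ q Ld v0 v1 inf_gen_tangent[OF q(1) \<xi>(1)]] by simp
  moreover have "D2 Q L (q0, q1) u1 = D2 Q L (q0, q1) v1 + \<mu> \<eta>"
    unfolding \<eta>(2) D2_add[OF dQ q Ld v0 v1 inf_gen_tangent[OF q(2) \<eta>(1)]] momentum_vertical[OF p \<eta>(1)] ..
  moreover have "\<A> ?x w = mu_form \<mu> \<AA> q1 u1 - mu_form \<mu> \<AA> q0 u0"
    using \<A>[OF p u(1)] unfolding pullback_def diff_form_def pp u(2) i_def[symmetric] u0_def u1_def by simp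
  moreover have "mu_form \<mu> \<AA> q0 u0 = mu_form \<mu> \<AA> q0 v0 + \<mu> \<xi>"
    "mu_form \<mu> \<AA> q1 u1 = mu_form \<mu> \<AA> q1 v1 + \<mu> \<eta>"
    unfolding \<xi>(2) \<eta>(2) by (rule mu_form_add_vertical[OF q(1) v0 \<xi>(1)] mu_form_add_vertical[OF q(2) v1 \<eta>(1)])+
  ultimately show ?thesis unfolding w_def[symmetric] by simp
qed

lemma one_form_components:
  assumes p: "(q0, q1) \<in> U" and w0: "w0 \<in> tangent_space S (\<pi> q0)" and w1: "w1 \<in> tangent_space S (\<pi> q1)"
  shows "\<A> (\<pi> q0, \<pi> q1) (tpair S S (\<pi> q0, \<pi> q1) w0 w1) =
      form_comp1 S \<A> (\<pi> q0, \<pi> q1) w0 + form_comp2 S \<A> (\<pi> q0, \<pi> q1) w1"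
    and "form_comp1 S \<A> (\<pi> q0, \<pi> q1) tzero = 0" "form_comp2 S \<A> (\<pi> q0, \<pi> q1) tzero = 0"
proof -
  let ?x = "(\<pi> q0, \<pi> q1)"
  note \<pi>0 = projection(1)[OF U_points(2)[OF p]] and \<pi>1 = projection(1)[OF U_points(3)[OF p]]
  note t = tpair_tangent(1)[OF dS dS \<pi>0 \<pi>1]
  note z0 = tzero_tangent[OF dS, of "\<pi> q0"] and z1 = tzero_tangent[OF dS, of "\<pi> q1"]
  have "?x \<in> V" using reduction_maps(5)[OF p] by (simp add: pair_proj_def)
  then have lin: "linear_form (tangent_space SS ?x) (\<A> ?x)"
    using \<A>_form unfolding one_form_on_def by blast
  have add: "\<A> ?x (tpair S S ?x w0 w1) = form_comp1 S \<A> ?x w0 + form_comp2 S \<A> ?x w1"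
    if "w0 \<in> tangent_space S (\<pi> q0)" "w1 \<in> tangent_space S (\<pi> q1)" for w0 w1
    unfolding tpair_split[OF dS dS \<pi>0 \<pi>1 that] form_comp1_def form_comp2_def
    using lin t[OF that(1) z1] t[OF z0 that(2)] unfolding linear_form_def by blast
  then show "\<A> ?x (tpair S S ?x w0 w1) = form_comp1 S \<A> ?x w0 + form_comp2 S \<A> ?x w1" using w0 w1 .
  \<comment> \<open>For two zero vectors both components are the same number as the total, so that
    number is twice itself.\<close>
  have "\<A> ?x (tpair S S ?x tzero tzero) = \<A> ?x (tpair S S ?x tzero tzero) + \<A> ?x (tpair S S ?x tzero tzero)"
    using add[OF z0 z1] unfolding form_comp1_def form_comp2_def .
  then show "form_comp1 S \<A> ?x tzero = 0" "form_comp2 S \<A> ?x tzero = 0"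
    unfolding form_comp1_def form_comp2_def by simp_all
qed

text \<open>The joint identity for \<open>(v0, v1)\<close> separates into its two components when
  the other vector is \<open>tzero\<close>.\<close>

lemma reduced_partial_derivatives:
  assumes p: "(q0, q1) \<in> U"
  shows "v \<in> tangent_space Q q0 \<Longrightarrow>
      D1 S Lr (\<pi> q0, \<pi> q1) (D\<pi> q0 v) - form_comp1 S \<A> (\<pi> q0, \<pi> q1) (D\<pi> q0 v) =
      D1 Q L (q0, q1) v + mu_form \<mu> \<AA> q0 v"
    and "v' \<in> tangent_space Q q1 \<Longrightarrow>
      D2 S Lr (\<pi> q0, \<pi> q1) (D\<pi> q1 v') - form_comp2 S \<A> (\<pi> q0, \<pi> q1) (D\<pi> q1 v') =
      D2 Q L (q0, q1) v' - mu_form \<mu> \<AA> q1 v'"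
proof -
  note q = U_points(2,3)[OF p]
  note \<pi>0 = projection[OF q(1)] and \<pi>1 = projection[OF q(2)]
  note z0 = tzero_tangent[OF dQ, of q0] and z1 = tzero_tangent[OF dQ, of q1]
  note zS0 = tzero_tangent[OF dS, of "\<pi> q0"] and zS1 = tzero_tangent[OF dS, of "\<pi> q1"]
  have D\<pi>_zero: "D\<pi> q0 tzero = tzero" "D\<pi> q1 tzero = tzero"
    using tmap_linear(3)[OF dQ dS \<pi>0(2) z0 z0] tmap_linear(3)[OF dQ dS \<pi>1(2) z1 z1] .
  note DS = D1_zero[OF dS \<pi>0(1) \<pi>1(1) Lr_mdiff[OF p] zS0 zS1] D2_zero[OF dS \<pi>0(1) \<pi>1(1) Lr_mdiff[OF p] zS0 zS1]
  note DQ = D1_zero[OF dQ q L_mdiff[OF q] z0 z1] D2_zero[OF dQ q L_mdiff[OF q] z0 z1]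
  have mu_zero: "mu_form \<mu> \<AA> r tzero = 0" if r: "r \<in> points Q" for r
  proof -
    note z = tzero_tangent[OF dQ, of r]
    have tt: "tadd tzero tzero = tzero" by (simp add: tadd_def tzero_def)
    have "\<AA> r tzero = tadd (\<AA> r tzero) (\<AA> r tzero)" "\<AA> r tzero \<in> lie_algebra G MG"
      using principal_connection_add[OF connection r dQ z z] connection r z
      unfolding principal_connection_def tt by blast+
    then have "\<mu> (\<AA> r tzero) = \<mu> (\<AA> r tzero) + \<mu> (\<AA> r tzero)"
      using \<mu> unfolding lie_dual_def lie_algebra_def cotangent_space_def linear_form_def
      by (metis (mono_tags, lifting) mem_Collect_eq)
    then show ?thesis unfolding mu_form_def by simp
  qed
  show "D1 S Lr (\<pi> q0, \<pi> q1) (D\<pi> q0 v) - form_comp1 S \<A> (\<pi> q0, \<pi> q1) (D\<pi> q0 v) =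
      D1 Q L (q0, q1) v + mu_form \<mu> \<AA> q0 v" if v: "v \<in> tangent_space Q q0"
  proof -
    have "D\<pi> q0 v \<in> tangent_space S (\<pi> q0)" using v \<pi>0(3) by blast
    from one_form_components[OF p this zS1] show ?thesis
      using reduced_derivative[OF p v z1] unfolding D\<pi>_zero DS DQ mu_zero[OF q(2)] by simp
  qed
  show "D2 S Lr (\<pi> q0, \<pi> q1) (D\<pi> q1 v') - form_comp2 S \<A> (\<pi> q0, \<pi> q1) (D\<pi> q1 v') =
      D2 Q L (q0, q1) v' - mu_form \<mu> \<AA> q1 v'" if v: "v' \<in> tangent_space Q q1"
  proof -
    have "D\<pi> q1 v' \<in> tangent_space S (\<pi> q1)" using v \<pi>1(3) by blast
    from one_form_components[OF p zS0 this] show ?thesis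
      using reduced_derivative[OF p z0 v] unfolding D\<pi>_zero DS DQ mu_zero[OF q(1)] by simp
  qed
qed

section \<open>The equivalences along a discrete curve\<close>

lemma DEL_iff_discrete_routh:
  assumes U: "\<And>k. k < n \<Longrightarrow> (q k, q (Suc k)) \<in> U" and x: "\<And>k. k \<le> n \<Longrightarrow> x k = \<pi> (q k)"
  shows "DEL Q L n q \<longleftrightarrow> discrete_routh S Lr \<A> n x"
proof -
  have "(\<forall>v\<in>tangent_space Q (q k). D2 Q L (q (k - 1), q k) v + D1 Q L (q k, q (k + 1)) v = 0) \<longleftrightarrow>
    (\<forall>w\<in>tangent_space S (x k). D2 S Lr (x (k - 1), x k) w + D1 S Lr (x k, x (k + 1)) w =
        form_comp2 S \<A> (x (k - 1), x k) w + form_comp1 S \<A> (x k, x (k + 1)) w)"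
    if k: "k \<in> {1..<n}" for k
  proof -
    have p: "(q (k - 1), q k) \<in> U" "(q k, q (k + 1)) \<in> U"
      using U[of "k - 1"] U[of k] k by auto
    have xq: "x (k - 1) = \<pi> (q (k - 1))" "x k = \<pi> (q k)" "x (k + 1) = \<pi> (q (k + 1))"
      using x[of "k - 1"] x[of k] x[of "k + 1"] k by auto
    have "D2 S Lr (x (k - 1), x k) (D\<pi> (q k) v) + D1 S Lr (x k, x (k + 1)) (D\<pi> (q k) v) =
        form_comp2 S \<A> (x (k - 1), x k) (D\<pi> (q k) v) + form_comp1 S \<A> (x k, x (k + 1)) (D\<pi> (q k) v) \<longleftrightarrow>
      D2 Q L (q (k - 1), q k) v + D1 Q L (q k, q (k + 1)) v = 0" if v: "v \<in> tangent_space Q (q k)" for v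
      \<comment> \<open>Both pairs contribute the connection term at the same point
        \<open>q k\<close> and vector \<open>v\<close>, with opposite signs since \<open>q k\<close>
        is the second entry of one pair and the first of the other.\<close>
      using reduced_partial_derivatives(2)[OF p(1) v] reduced_partial_derivatives(1)[OF p(2) v]
      unfolding xq by linarith
    \<comment> \<open>Replacing the tangent space of \<open>S\<close> by the image of that of
      \<open>Q\<close> turns the quantifier over \<open>w\<close> into one over
      \<open>v\<close>.\<close>
    then show ?thesis
      unfolding xq(2) projection(3)[OF U_points(2)[OF p(2)], symmetric] by (simp add: xq(2))
  qed
  then show ?thesis unfolding DEL_def discrete_routh_def by blast
qed

lemma DEL_iff_discrete_hamilton:
  assumes U: "\<And>k. k < n \<Longrightarrow> (q k, q (Suc k)) \<in> U"
  shows "DEL Q L n q \<longleftrightarrow> discrete_hamilton Q L n q"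
proof -
  have z: "D1 Q L (q k, q (Suc k)) tzero = 0" "D2 Q L (q k, q (Suc k)) tzero = 0" if "k < n" for k
    using D1_zero[OF dQ] D2_zero[OF dQ] U_points(2,3)[OF U[OF that]] L_mdiff tzero_tangent[OF dQ] by metis+
  \<comment> \<open>The point \<open>q (Suc (k - 1))\<close> is what summation by parts produces; it
    is \<open>q k\<close> because the indices start at 1.\<close>
  have "discrete_hamilton Q L n q \<longleftrightarrow> (\<forall>k\<in>{1..<n}. \<forall>v\<in>tangent_space Q (q k).
      D2 Q L (q (k - 1), q (Suc (k - 1))) v + D1 Q L (q k, q (Suc k)) v = 0)"
    unfolding discrete_hamilton_def sum_variation_def
    by (rule fixed_end_variations_iff[where a = "\<lambda>k. D1 Q L (q k, q (Suc k))"
          and b = "\<lambda>k. D2 Q L (q k, q (Suc k))", OF dQ z])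
  also have "\<dots> \<longleftrightarrow> DEL Q L n q"
    unfolding DEL_def by (intro ball_cong refl) simp
  finally show ?thesis by simp
qed

lemma discrete_routh_iff_reduced_variational:
  assumes U: "\<And>k. k < n \<Longrightarrow> (q k, q (Suc k)) \<in> U" and x: "\<And>k. k \<le> n \<Longrightarrow> x k = \<pi> (q k)"
  shows "discrete_routh S Lr \<A> n x \<longleftrightarrow> reduced_variational S Lr \<A> n x"
proof -
  \<comment> \<open>Moving the one-form to the left makes the reduced principle a vanishing sum, so
    the same summation by parts applies.\<close>
  define a where "a k v = D1 S Lr (x k, x (Suc k)) v - form_comp1 S \<A> (x k, x (Suc k)) v" for k v
  define b where "b k v = D2 S Lr (x k, x (Suc k)) v - form_comp2 S \<A> (x k, x (Suc k)) v" for k v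
  have xq: "(x k, x (Suc k)) = (\<pi> (q k), \<pi> (q (Suc k)))" if "k < n" for k using that by (simp add: x)
  have zero: "a k tzero = 0" "b k tzero = 0" if k: "k < n" for k
  proof -
    note p = U[OF k]
    note \<pi>0 = projection(1)[OF U_points(2)[OF p]] and \<pi>1 = projection(1)[OF U_points(3)[OF p]]
    note z = tzero_tangent[OF dS]
    show "a k tzero = 0" "b k tzero = 0"
      unfolding a_def b_def xq[OF k] D1_zero[OF dS \<pi>0 \<pi>1 Lr_mdiff[OF p] z z]
        D2_zero[OF dS \<pi>0 \<pi>1 Lr_mdiff[OF p] z z] one_form_components(2,3)[OF p z z] by simp_all
  qed
  have diff: "sum_variation S Lr n x \<delta> -
      (\<Sum>k<n. \<A> (x k, x (Suc k)) (tpair S S (x k, x (Suc k)) (\<delta> k) (\<delta> (Suc k)))) =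
      (\<Sum>k<n. a k (\<delta> k) + b k (\<delta> (Suc k)))" if \<delta>: "\<delta> \<in> fixed_end_variations S n x" for \<delta>
    unfolding sum_variation_def sum_subtractf[symmetric]
  proof (rule sum.cong[OF refl])
    fix k assume "k \<in> {..<n}"
    then have k: "k < n" by simp
    then have d: "\<delta> k \<in> tangent_space S (\<pi> (q k))" "\<delta> (Suc k) \<in> tangent_space S (\<pi> (q (Suc k)))"
      using \<delta> x[of k, symmetric] x[of "Suc k", symmetric] unfolding fixed_end_variations_def by simp_all
    show "D1 S Lr (x k, x (Suc k)) (\<delta> k) + D2 S Lr (x k, x (Suc k)) (\<delta> (Suc k)) -
        \<A> (x k, x (Suc k)) (tpair S S (x k, x (Suc k)) (\<delta> k) (\<delta> (Suc k))) = a k (\<delta> k) + b k (\<delta> (Suc k))"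
      unfolding a_def b_def xq[OF k] one_form_components(1)[OF U[OF k] d] by simp
  qed
  have "reduced_variational S Lr \<A> n x \<longleftrightarrow>
      (\<forall>\<delta>\<in>fixed_end_variations S n x. (\<Sum>k<n. a k (\<delta> k) + b k (\<delta> (Suc k))) = 0)"
    unfolding reduced_variational_def by (rule ball_cong[OF refl]) (use diff in fastforce)
  also have "\<dots> \<longleftrightarrow> (\<forall>k\<in>{1..<n}. \<forall>v\<in>tangent_space S (x k). b (k - 1) v + a k v = 0)"
    by (rule fixed_end_variations_iff[where a = a and b = b, OF dS zero])
  also have "\<dots> \<longleftrightarrow> discrete_routh S Lr \<A> n x"
    unfolding discrete_routh_def
  proof (intro ball_cong refl)
    fix k v assume "k \<in> {1..<n}"
    then have "Suc (k - 1) = k" by simp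
    then show "b (k - 1) v + a k v = 0 \<longleftrightarrow>
        D2 S Lr (x (k - 1), x k) v + D1 S Lr (x k, x (k + 1)) v =
        form_comp2 S \<A> (x (k - 1), x k) v + form_comp1 S \<A> (x k, x (k + 1)) v"
      unfolding a_def b_def by (simp, linarith)
  qed
  finally show ?thesis by simp
qed

end

theorem theorem2p3:
  fixes G :: "('g, 'b) monoid_scheme"
    and MG :: "('g, 'l::real_normed_vector) manifold"
    and Q :: "('q, 'e::real_normed_vector) manifold"
    and \<Phi> :: "'g \<Rightarrow> 'q \<Rightarrow> 'q"
    and S :: "('q set, 's::real_normed_vector) manifold"
    and L :: "'q \<times> 'q \<Rightarrow> real"
    and \<mu> :: "('g, 'l) tvector \<Rightarrow> real"
    and W :: "('q \<times> 'q) set"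
    and N :: "('q \<times> 'q, 'm::real_normed_vector) manifold"
    and U :: "('q \<times> 'q) set"
    and UG :: "(('q \<times> 'q) set, 'u::real_normed_vector) manifold"
    and V :: "('q set \<times> 'q set) set"
    and \<AA> :: "'q \<Rightarrow> ('q, 'e) tvector \<Rightarrow> ('g, 'l) tvector"
    and Lr :: "'q set \<times> 'q set \<Rightarrow> real"
    and \<A> :: "'q set \<times> 'q set \<Rightarrow> ('q set \<times> 'q set, 's \<times> 's) tvector \<Rightarrow> real"
    and n :: nat
    and x :: "nat \<Rightarrow> 'q set"
    and q :: "nat \<Rightarrow> 'q"
  assumes G: "comm_group G" "lie_group G MG"
    and Q: "smooth_manifold Q"
    and action: "smooth_action G MG Q \<Phi>" "free_action G (points Q) \<Phi>" "proper_action MG Q \<Phi>"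
    and S: "quotient_manifold G \<Phi> Q (points Q) S"
    and L_smooth: "smooth_fun (prod_manifold Q Q) (points Q \<times> points Q) L"
    and L_invariant: "invariant_fun G (diag_action \<Phi>) (points Q \<times> points Q) L"
    and L_regular: "regular_lagrangian Q L"
    and L_group_regular: "group_regular_lagrangian G MG Q \<Phi> L"
    and \<mu>: "\<mu> \<in> lie_dual G MG"
    and W: "openin (mtop (prod_manifold Q Q)) W" "invariant_set G (diag_action \<Phi>) W"
      "\<forall>q\<in>points Q. (q, q) \<in> W"
      "local_diffeo_on (prod_manifold Q Q) (cotangent_bundle Q) W (discrete_legendre Q L)"
    and N: "embedded_submanifold N (prod_manifold Q Q)"
      "points N = {p \<in> W. momentum_map G MG Q \<Phi> L p = \<mu>}"
    and U: "openin (mtop N) U" "invariant_set G (diag_action \<Phi>) U"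
    and UG: "quotient_manifold G (diag_action \<Phi>) N U UG"
    and V: "diffeo_on UG (prod_manifold S S) (points UG) orbit_pair" "V = orbit_pair ` points UG"
    and Lr: "\<forall>p\<in>U. Lr (pair_proj G \<Phi> p) = L p"
    and connection: "principal_connection G MG Q \<Phi> \<AA>"
    and \<A>: "one_form_on (prod_manifold S S) V \<A>"
      "\<forall>p\<in>U. \<forall>v\<in>tangent_space N p.
         pullback N (prod_manifold S S) (pair_proj G \<Phi>) \<A> p v =
         pullback N (prod_manifold Q Q) (\<lambda>p. p) (diff_form Q (mu_form \<mu> \<AA>)) p v"
    and x: "\<forall>k\<le>n. x k \<in> points S" "\<forall>k<n. (x k, x (k + 1)) \<in> V"
    and q: "\<forall>k\<le>n. q k \<in> points Q \<and> orbit G \<Phi> (q k) = x k" "\<forall>k<n. (q k, q (k + 1)) \<in> U"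
  shows "(DEL Q L n q \<longleftrightarrow> discrete_hamilton Q L n q) \<and>
         (discrete_hamilton Q L n q \<longleftrightarrow> discrete_routh S Lr \<A> n x) \<and>
         (discrete_routh S Lr \<A> n x \<longleftrightarrow> reduced_variational S Lr \<A> n x)"
proof -
  interpret discrete_routh_reduction G MG Q \<Phi> S L \<mu> N U UG V \<AA> Lr \<A>
    using G(2) Q action S L_smooth L_invariant \<mu> N U(1) UG V Lr connection \<A>
    by unfold_locales auto
  have qU: "(q k, q (Suc k)) \<in> U" if "k < n" for k using q(2) that by simp
  have xq: "x k = orbit G \<Phi> (q k)" if "k \<le> n" for k using q(1) that by simp
  \<comment> \<open>The discrete Euler-Lagrange equations are the hub: the middle equivalence of the
    claim passes through them.\<close>
  show ?thesis
    using DEL_iff_discrete_hamilton[where q = q and n = n, OF qU]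
      DEL_iff_discrete_routh[where q = q and n = n and x = x, OF qU xq]
      discrete_routh_iff_reduced_variational[where q = q and n = n and x = x, OF qU xq] by blast
qed

end
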